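(* Let $\Lambda$ be an artin algebra and let $\alpha\colon X\to Y$ be a morphism of finitely generated left $\Lambda$-modules. Let $K$ be the kernel of $\alpha$ and $Q$ the cokernel of $\alpha$. Then $\alpha$ is right determined by $\operatorname{Tr}D(K)\oplus P(\operatorname{soc}Q)$.
   Context: All modules are finitely generated left modules over an artin algebra $\Lambda$; a composition $\beta\alpha$ means first $\alpha$, then $\beta$. A morphism $\alpha\colon X\to Y$ is said to be right determined by a module $C$ if the following holds: whenever $\alpha'\colon X'\to Y$ is a morphism such that for every $\phi\colon C\to X'$ the composition $\alpha'\phi$ factors through $\alpha$ (that is, $\alpha'\phi=\alpha\phi'$ for some $\phi'\colon C\to X$), then $\alpha'$ itself factors through $\alpha$. For a module $M$: $P(M)$ is its projective cover, $\operatorname{soc}M$ its socle, $D$ the usual duality between left and right modules, $\operatorname{Tr}$ the Auslander–Bridger transpose (defined using a minimal projective presentation), so $\operatorname{Tr}D$ is the inverse Auslander–Reiten translate (it sends injective modules to $0$). *)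

theory Defs
  imports "HOL-Algebra.Module" "HOL-Algebra.RingHom" "HOL-Algebra.QuotRing"
begin

section \<open>Left modules over a not necessarily commutative ring\<close>

text \<open>
  The locale \<^locale>\<open>module\<close> requires a commutative ring of scalars.  The record
  \<^typ>\<open>('a, 'b) module\<close> and the locale \<^locale>\<open>submodule\<close> do not, and are reused here.
  Only the fields \<open>carrier\<close>, \<open>zero\<close>, \<open>add\<close> and \<open>smult\<close> of a module are meaningful; its ring fields
  \<open>mult\<close> and \<open>one\<close> are never inspected.
\<close>

locale left_module = R?: ring R + M?: abelian_group M
  for R :: "'r ring" and M :: "('r, 'm) module" (structure) +
  assumes smult_closed [simp, intro]:
      "\<lbrakk> a \<in> carrier R; x \<in> carrier M \<rbrakk> \<Longrightarrow> a \<odot> x \<in> carrier M"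
    and smult_l_distr:
      "\<lbrakk> a \<in> carrier R; b \<in> carrier R; x \<in> carrier M \<rbrakk> \<Longrightarrow> (a \<oplus>\<^bsub>R\<^esub> b) \<odot> x = a \<odot> x \<oplus> b \<odot> x"
    and smult_r_distr:
      "\<lbrakk> a \<in> carrier R; x \<in> carrier M; y \<in> carrier M \<rbrakk> \<Longrightarrow> a \<odot> (x \<oplus> y) = a \<odot> x \<oplus> a \<odot> y"
    and smult_assoc:
      "\<lbrakk> a \<in> carrier R; b \<in> carrier R; x \<in> carrier M \<rbrakk> \<Longrightarrow> (a \<otimes>\<^bsub>R\<^esub> b) \<odot> x = a \<odot> (b \<odot> x)"
    and smult_one [simp]:
      "x \<in> carrier M \<Longrightarrow> \<one>\<^bsub>R\<^esub> \<odot> x = x"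

text \<open>Module homomorphisms are only constrained on the carrier, as in \<^const>\<open>hom\<close>.\<close>

definition mod_hom :: "'r ring \<Rightarrow> ('r, 'm) module \<Rightarrow> ('r, 'n) module \<Rightarrow> ('m \<Rightarrow> 'n) set" where
  "mod_hom R M N = {f \<in> hom (add_monoid M) (add_monoid N).
     \<forall>a \<in> carrier R. \<forall>x \<in> carrier M. f (a \<odot>\<^bsub>M\<^esub> x) = a \<odot>\<^bsub>N\<^esub> f x}"

definition submod :: "('r, 'm) module \<Rightarrow> 'm set \<Rightarrow> ('r, 'm) module" where
  "submod M N = M\<lparr>carrier := N\<rparr>"

definition module_span :: "'r ring \<Rightarrow> ('r, 'm) module \<Rightarrow> 'm set \<Rightarrow> 'm set" where
  "module_span R M S = \<Inter>{N. submodule N R M \<and> S \<subseteq> N}"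

definition fg_module :: "'r ring \<Rightarrow> ('r, 'm) module \<Rightarrow> bool" where
  "fg_module R M \<longleftrightarrow> left_module R M \<and>
     (\<exists>S. finite S \<and> S \<subseteq> carrier M \<and> module_span R M S = carrier M)"

definition quotient_module :: "('r, 'm) module \<Rightarrow> 'm set \<Rightarrow> ('r, 'm set) module" where
  "quotient_module M N =
     \<lparr> carrier = a_rcosets\<^bsub>M\<^esub> N, mult = undefined, one = undefined, zero = N, add = set_add M,
       smult = (\<lambda>a C. \<Union>x\<in>C. N +>\<^bsub>M\<^esub> (a \<odot>\<^bsub>M\<^esub> x)) \<rparr>"

definition kernel_module :: "('r, 'm) module \<Rightarrow> ('r, 'n) module \<Rightarrow> ('m \<Rightarrow> 'n) \<Rightarrow> ('r, 'm) module" where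
  "kernel_module M N f = submod M (a_kernel M N f)"

definition cokernel_module :: "('r, 'm) module \<Rightarrow> ('r, 'n) module \<Rightarrow> ('m \<Rightarrow> 'n) \<Rightarrow> ('r, 'n set) module" where
  "cokernel_module M N f = quotient_module N (f ` carrier M)"

definition direct_sum :: "('r, 'm) module \<Rightarrow> ('r, 'n) module \<Rightarrow> ('r, 'm \<times> 'n) module" where
  "direct_sum M N =
     \<lparr> carrier = carrier M \<times> carrier N, mult = undefined, one = undefined,
       zero = (\<zero>\<^bsub>M\<^esub>, \<zero>\<^bsub>N\<^esub>),
       add = (\<lambda>(x, y) (x', y'). (x \<oplus>\<^bsub>M\<^esub> x', y \<oplus>\<^bsub>N\<^esub> y')),
       smult = (\<lambda>a (x, y). (a \<odot>\<^bsub>M\<^esub> x, a \<odot>\<^bsub>N\<^esub> y)) \<rparr>"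

definition regular_module :: "'r ring \<Rightarrow> ('r, 'r) module" where
  "regular_module R =
     \<lparr> carrier = carrier R, mult = undefined, one = undefined, zero = \<zero>\<^bsub>R\<^esub>, add = add R,
       smult = mult R \<rparr>"

definition restrict_scalars :: "('k \<Rightarrow> 'r) \<Rightarrow> ('r, 'm) module \<Rightarrow> ('k, 'm) module" where
  "restrict_scalars \<phi> M =
     \<lparr> carrier = carrier M, mult = undefined, one = undefined, zero = \<zero>\<^bsub>M\<^esub>, add = add M,
       smult = (\<lambda>c x. \<phi> c \<odot>\<^bsub>M\<^esub> x) \<rparr>"

text \<open>Right \<open>R\<close>-modules are represented as left modules over the opposite ring.\<close>

definition op_ring :: "'r ring \<Rightarrow> 'r ring" where
  "op_ring R = R\<lparr>mult := (\<lambda>a b. b \<otimes>\<^bsub>R\<^esub> a)\<rparr>"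

lemma op_ring_op_ring [simp]: "op_ring (op_ring R) = R"
  by (simp add: op_ring_def)

lemma op_ring_simps [simp]:
  "carrier (op_ring R) = carrier R" "a \<otimes>\<^bsub>op_ring R\<^esub> b = b \<otimes>\<^bsub>R\<^esub> a" "\<one>\<^bsub>op_ring R\<^esub> = \<one>\<^bsub>R\<^esub>"
  "\<zero>\<^bsub>op_ring R\<^esub> = \<zero>\<^bsub>R\<^esub>" "a \<oplus>\<^bsub>op_ring R\<^esub> b = a \<oplus>\<^bsub>R\<^esub> b"
  by (simp_all add: op_ring_def)

lemma regular_module_simps [simp]:
  "carrier (regular_module R) = carrier R" "\<zero>\<^bsub>regular_module R\<^esub> = \<zero>\<^bsub>R\<^esub>"
  "x \<oplus>\<^bsub>regular_module R\<^esub> y = x \<oplus>\<^bsub>R\<^esub> y" "a \<odot>\<^bsub>regular_module R\<^esub> x = a \<otimes>\<^bsub>R\<^esub> x"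
  by (simp_all add: regular_module_def)

lemma restrict_scalars_simps [simp]:
  "carrier (restrict_scalars \<phi> M) = carrier M" "\<zero>\<^bsub>restrict_scalars \<phi> M\<^esub> = \<zero>\<^bsub>M\<^esub>"
  "x \<oplus>\<^bsub>restrict_scalars \<phi> M\<^esub> y = x \<oplus>\<^bsub>M\<^esub> y" "c \<odot>\<^bsub>restrict_scalars \<phi> M\<^esub> x = \<phi> c \<odot>\<^bsub>M\<^esub> x"
  by (simp_all add: restrict_scalars_def)

lemma ring_op_ring: "ring R \<Longrightarrow> ring (op_ring R)"
proof -
  assume "ring R"
  then interpret ring R .
  show ?thesis
    by (rule ringI)
      (auto simp: op_ring_def l_distr r_distr m_assoc a_ac
        intro!: abelian_groupI monoidI intro: add.l_inv_ex)
qed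

context left_module
begin

lemma smult_r_zero [simp]: "a \<in> carrier R \<Longrightarrow> a \<odot> \<zero> = \<zero>"
  by (metis M.add.r_cancel_one' M.l_zero M.zero_closed smult_closed smult_r_distr)

lemma smult_l_zero [simp]: "x \<in> carrier M \<Longrightarrow> \<zero>\<^bsub>R\<^esub> \<odot> x = \<zero>"
  by (metis M.add.r_cancel_one' R.l_zero R.zero_closed smult_closed smult_l_distr)

lemma smult_r_minus: "\<lbrakk> a \<in> carrier R; x \<in> carrier M \<rbrakk> \<Longrightarrow> a \<odot> (\<ominus> x) = \<ominus> (a \<odot> x)"
  by (metis M.add.inv_closed M.l_neg M.minus_equality smult_closed smult_r_distr smult_r_zero)

lemma smult_l_minus: "\<lbrakk> a \<in> carrier R; x \<in> carrier M \<rbrakk> \<Longrightarrow> (\<ominus>\<^bsub>R\<^esub> a) \<odot> x = \<ominus> (a \<odot> x)"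
  by (metis M.minus_equality R.add.inv_closed R.l_neg smult_closed smult_l_distr smult_l_zero)

lemma submodI:
  assumes "N \<subseteq> carrier M" "\<zero> \<in> N"
    and "\<And>x y. \<lbrakk> x \<in> N; y \<in> N \<rbrakk> \<Longrightarrow> x \<oplus> y \<in> N"
    and "\<And>a x. \<lbrakk> a \<in> carrier R; x \<in> N \<rbrakk> \<Longrightarrow> a \<odot> x \<in> N"
  shows "submodule N R M"
proof -
  have neg: "\<ominus> x \<in> N" if "x \<in> N" for x
    using assms(4)[of "\<ominus>\<^bsub>R\<^esub> \<one>\<^bsub>R\<^esub>" x] smult_l_minus[of "\<one>\<^bsub>R\<^esub>" x] that assms(1) by auto
  have "subgroup N (add_monoid M)"
    by (rule M.add.subgroupI) (use assms neg in \<open>auto simp: a_inv_def\<close>)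
  then show ?thesis
    using assms(4) by (auto simp: submodule_def submodule_axioms_def)
qed

lemma submodD:
  assumes "submodule N R M"
  shows "N \<subseteq> carrier M" "\<zero> \<in> N"
    and "\<And>x y. \<lbrakk> x \<in> N; y \<in> N \<rbrakk> \<Longrightarrow> x \<oplus> y \<in> N"
    and "\<And>a x. \<lbrakk> a \<in> carrier R; x \<in> N \<rbrakk> \<Longrightarrow> a \<odot> x \<in> N"
    and "\<And>x. x \<in> N \<Longrightarrow> \<ominus> x \<in> N"
  using assms subgroup.subset[of N "add_monoid M"] subgroup.one_closed[of N "add_monoid M"]
    subgroup.m_closed[of N "add_monoid M"] subgroup.m_inv_closed[of N "add_monoid M"]
  by (auto simp: submodule_def submodule_axioms_def a_inv_def)

lemma left_module_submod:
  assumes "submodule N R M"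
  shows "left_module R (submod M N)"
proof -
  note N = submodD[OF assms]
  have "abelian_group (submod M N)"
  proof (rule abelian_groupI)
    fix x assume "x \<in> carrier (submod M N)"
    then show "\<exists>y \<in> carrier (submod M N). y \<oplus>\<^bsub>submod M N\<^esub> x = \<zero>\<^bsub>submod M N\<^esub>"
      using N(1,5) by (intro bexI[of _ "\<ominus> x"]) (auto simp: submod_def M.l_neg)
  qed (use N in \<open>auto simp: submod_def M.a_ac subset_iff\<close>)
  moreover have "left_module_axioms R (submod M N)"
    unfolding left_module_axioms_def
    using N by (auto simp: submod_def subset_iff smult_l_distr smult_r_distr smult_assoc)
  ultimately show ?thesis
    using R.ring_axioms by (simp add: left_module_def)
qed

lemma left_module_quotient:
  assumes "submodule N R M"
  shows "left_module R (quotient_module M N)"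
proof -
  note N = submodD[OF assms]
  have sub: "subgroup N (add_monoid M)"
    using assms by (simp add: submodule_def)
  interpret A: abelian_subgroup N M
    by (rule abelian_subgroupI3) (use sub in \<open>auto simp: additive_subgroup_def M.abelian_group_axioms\<close>)
  have car: "carrier (quotient_module M N) = (\<lambda>x. N +> x) ` carrier M"
    by (auto simp: quotient_module_def A_RCOSETS_def')
  have add: "(N +> x) \<oplus>\<^bsub>quotient_module M N\<^esub> (N +> y) = N +> (x \<oplus> y)"
    if "x \<in> carrier M" "y \<in> carrier M" for x y
    using that by (simp add: quotient_module_def A.a_rcos_sum)
  have zero: "\<zero>\<^bsub>quotient_module M N\<^esub> = N +> \<zero>"
    using N by (simp add: quotient_module_def M.a_coset_add_zero)
  have smult: "a \<odot>\<^bsub>quotient_module M N\<^esub> (N +> x) = N +> (a \<odot> x)"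
    if "a \<in> carrier R" "x \<in> carrier M" for a x
  proof -
    have "N +> (a \<odot> y) = N +> (a \<odot> x)" if y: "y \<in> N +> x" for y
    proof -
      from y obtain n where n: "n \<in> N" "y = n \<oplus> x" by (auto simp: a_r_coset_def')
      then have "a \<odot> y = a \<odot> n \<oplus> a \<odot> x"
        using \<open>a \<in> carrier R\<close> \<open>x \<in> carrier M\<close> N(1) by (auto simp: smult_r_distr)
      moreover have "a \<odot> n \<in> N" using n N \<open>a \<in> carrier R\<close> by auto
      ultimately have "a \<odot> y \<in> N +> (a \<odot> x)"
        by (auto simp: a_r_coset_def')
      then show ?thesis
        using A.a_repr_independence'[of "a \<odot> y" "a \<odot> x"]
          smult_closed[OF \<open>a \<in> carrier R\<close> \<open>x \<in> carrier M\<close>] by metis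
    qed
    moreover have "x \<in> N +> x" using that A.a_rcos_self by auto
    ultimately have "(\<Union>y \<in> N +> x. N +> (a \<odot> y)) = N +> (a \<odot> x)" by blast
    then show ?thesis by (simp add: quotient_module_def)
  qed
  have "abelian_group (quotient_module M N)"
  proof (rule abelian_groupI)
    fix C assume "C \<in> carrier (quotient_module M N)"
    then obtain x where x: "x \<in> carrier M" "C = N +> x" by (auto simp: car)
    then have "(N +> (\<ominus> x)) \<oplus>\<^bsub>quotient_module M N\<^esub> C = \<zero>\<^bsub>quotient_module M N\<^esub>"
      by (simp add: add zero M.l_neg)
    then show "\<exists>C' \<in> carrier (quotient_module M N).
        C' \<oplus>\<^bsub>quotient_module M N\<^esub> C = \<zero>\<^bsub>quotient_module M N\<^esub>"
      using x(1) by (auto simp: car)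
  qed (auto simp: car add zero M.a_ac)
  moreover have "left_module_axioms R (quotient_module M N)"
    unfolding left_module_axioms_def
    by (auto simp: car add smult smult_l_distr smult_r_distr smult_assoc)
  ultimately show ?thesis
    using R.ring_axioms by (simp add: left_module_def)
qed

end

lemma mod_homD:
  assumes "f \<in> mod_hom R M N"
  shows "\<And>x. x \<in> carrier M \<Longrightarrow> f x \<in> carrier N"
    and "\<And>x y. \<lbrakk> x \<in> carrier M; y \<in> carrier M \<rbrakk> \<Longrightarrow> f (x \<oplus>\<^bsub>M\<^esub> y) = f x \<oplus>\<^bsub>N\<^esub> f y"
    and "\<And>a x. \<lbrakk> a \<in> carrier R; x \<in> carrier M \<rbrakk> \<Longrightarrow> f (a \<odot>\<^bsub>M\<^esub> x) = a \<odot>\<^bsub>N\<^esub> f x"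
  using assms by (auto simp: mod_hom_def hom_def)

lemma mod_homI:
  assumes "\<And>x. x \<in> carrier M \<Longrightarrow> f x \<in> carrier N"
    and "\<And>x y. \<lbrakk> x \<in> carrier M; y \<in> carrier M \<rbrakk> \<Longrightarrow> f (x \<oplus>\<^bsub>M\<^esub> y) = f x \<oplus>\<^bsub>N\<^esub> f y"
    and "\<And>a x. \<lbrakk> a \<in> carrier R; x \<in> carrier M \<rbrakk> \<Longrightarrow> f (a \<odot>\<^bsub>M\<^esub> x) = a \<odot>\<^bsub>N\<^esub> f x"
  shows "f \<in> mod_hom R M N"
  using assms by (auto simp: mod_hom_def hom_def)

lemma mod_hom_zero:
  assumes "left_module R M" "left_module R N" "f \<in> mod_hom R M N"
  shows "f \<zero>\<^bsub>M\<^esub> = \<zero>\<^bsub>N\<^esub>"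
proof -
  interpret M: left_module R M by fact
  interpret N: left_module R N by fact
  show ?thesis
    using mod_homD(1,3)[OF assms(3)] M.smult_l_zero N.smult_l_zero M.R.zero_closed M.M.zero_closed
    by metis
qed

lemma submodule_vimage:
  assumes "left_module R M" "left_module R N" "f \<in> mod_hom R M N" "submodule L R N"
  shows "submodule {x \<in> carrier M. f x \<in> L} R M"
proof -
  interpret M: left_module R M by fact
  interpret N: left_module R N by fact
  show ?thesis
    by (rule M.submodI)
      (use mod_homD[OF assms(3)] N.submodD[OF assms(4)] mod_hom_zero[OF assms(1-3)] in auto)
qed

lemma submodule_image:
  assumes "left_module R M" "left_module R N" "f \<in> mod_hom R M N"
  shows "submodule (f ` carrier M) R N"
proof -
  interpret M: left_module R M by fact
  interpret N: left_module R N by fact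
  note f = mod_homD[OF assms(3)]
  show ?thesis
  proof (rule N.submodI)
    show "\<zero>\<^bsub>N\<^esub> \<in> f ` carrier M" using mod_hom_zero[OF assms] by force
    fix u v assume "u \<in> f ` carrier M" "v \<in> f ` carrier M"
    then obtain x y where x: "x \<in> carrier M" "u = f x" and y: "y \<in> carrier M" "v = f y" by blast
    then show "u \<oplus>\<^bsub>N\<^esub> v \<in> f ` carrier M"
      using f(2)[OF x(1) y(1)] by (intro image_eqI[of _ f "x \<oplus>\<^bsub>M\<^esub> y"]) auto
  next
    fix a u assume a: "a \<in> carrier R" and "u \<in> f ` carrier M"
    then obtain x where x: "x \<in> carrier M" "u = f x" by blast
    then show "a \<odot>\<^bsub>N\<^esub> u \<in> f ` carrier M"
      using f(3)[OF a x(1)] a by (intro image_eqI[of _ f "a \<odot>\<^bsub>M\<^esub> x"]) auto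
  qed (use f(1) in auto)
qed

lemma fg_module_image:
  assumes "fg_module R M" "left_module R N" "f \<in> mod_hom R M N" "f ` carrier M = carrier N"
  shows "fg_module R N"
proof -
  from assms(1) obtain S where M: "left_module R M"
    and S: "finite S" "S \<subseteq> carrier M" "module_span R M S = carrier M"
    by (auto simp: fg_module_def)
  interpret M: left_module R M by fact
  interpret N: left_module R N by fact
  have "carrier N \<subseteq> L" if "submodule L R N" "f ` S \<subseteq> L" for L
  proof -
    have "submodule {x \<in> carrier M. f x \<in> L} R M"
      using submodule_vimage[OF M assms(2,3) that(1)] .
    moreover have "S \<subseteq> {x \<in> carrier M. f x \<in> L}" using S that by auto
    ultimately have "module_span R M S \<subseteq> {x \<in> carrier M. f x \<in> L}"
      unfolding module_span_def by (intro Inter_lower CollectI conjI)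
    then show ?thesis using assms(4) S(3) by (auto simp flip: assms(4))
  qed
  then have "carrier N \<subseteq> module_span R N (f ` S)" by (auto simp: module_span_def)
  moreover have fS: "f ` S \<subseteq> carrier N" using S(2) assms(4) by blast
  moreover have "submodule (carrier N) R N" by (rule N.submodI) auto
  ultimately have "module_span R N (f ` S) = carrier N"
    by (intro antisym) (auto simp: module_span_def)
  then show ?thesis
    using assms(2) S(1) fS by (auto simp: fg_module_def intro!: exI[of _ "f ` S"])
qed

lemma fg_module_iso_list:
  fixes M :: "('r, 'm) module" (structure)
  assumes "fg_module R M"
  shows "\<exists>(M' :: ('r, 'r list) module) h.
           fg_module R M' \<and> h \<in> mod_hom R M M' \<and> bij_betw h (carrier M) (carrier M')"
proof -
  from assms obtain S where M: "left_module R M"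
    and S: "finite S" "S \<subseteq> carrier M" "module_span R M S = carrier M"
    by (auto simp: fg_module_def)
  interpret left_module R M by fact
  obtain xs where xs: "set xs = S" using S(1) finite_list by blast
  have "\<exists>N d. submodule N R M \<and> set ys \<subseteq> N \<and> N \<subseteq> range (d :: 'r list \<Rightarrow> 'm)"
    if "set ys \<subseteq> carrier M" for ys
    using that
  proof (induction ys)
    case Nil
    have "submodule {\<zero>} R M" by (rule submodI) auto
    then show ?case by (intro exI[of _ "{\<zero>}"] exI[of _ "\<lambda>_. \<zero>"]) auto
  next
    case (Cons y ys)
    then obtain N d where N: "submodule N R M" "set ys \<subseteq> N" "N \<subseteq> range (d :: 'r list \<Rightarrow> 'm)"
      by auto
    note Nd = submodD[OF N(1)]
    from Cons have y: "y \<in> carrier M" by simp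
    let ?N = "{a \<odot> y \<oplus> n | a n. a \<in> carrier R \<and> n \<in> N}"
    have "submodule ?N R M"
    proof (rule submodI)
      show "?N \<subseteq> carrier M" using y Nd(1) by auto
      have "\<zero> = \<zero>\<^bsub>R\<^esub> \<odot> y \<oplus> \<zero>" using y by simp
      then show "\<zero> \<in> ?N" using Nd(2) R.zero_closed by blast
    next
      fix u v assume "u \<in> ?N" "v \<in> ?N"
      then obtain a n b m where *: "a \<in> carrier R" "n \<in> N" "u = a \<odot> y \<oplus> n"
        "b \<in> carrier R" "m \<in> N" "v = b \<odot> y \<oplus> m" by blast
      then have nm: "n \<in> carrier M" "m \<in> carrier M" using Nd(1) by auto
      have "u \<oplus> v = (a \<oplus>\<^bsub>R\<^esub> b) \<odot> y \<oplus> (n \<oplus> m)"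
        using * nm y by (simp add: smult_l_distr M.a_ac)
      then show "u \<oplus> v \<in> ?N" using * Nd(3) R.add.m_closed by blast
    next
      fix c u assume c: "c \<in> carrier R" and "u \<in> ?N"
      then obtain a n where *: "a \<in> carrier R" "n \<in> N" "u = a \<odot> y \<oplus> n" by blast
      then have n: "n \<in> carrier M" using Nd(1) by auto
      have "c \<odot> u = (c \<otimes>\<^bsub>R\<^esub> a) \<odot> y \<oplus> c \<odot> n"
        using * n c y by (simp add: smult_r_distr smult_assoc)
      then show "c \<odot> u \<in> ?N" using * c Nd(4) R.m_closed by blast
    qed
    moreover have "set (y # ys) \<subseteq> ?N"
    proof -
      have "y = \<one>\<^bsub>R\<^esub> \<odot> y \<oplus> \<zero>" using y by simp
      then have "y \<in> ?N" using Nd(2) R.one_closed by blast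
      moreover have "n \<in> ?N" if "n \<in> N" for n
      proof -
        have "n = \<zero>\<^bsub>R\<^esub> \<odot> y \<oplus> n" using y that Nd(1) by auto
        then show ?thesis using that R.zero_closed by blast
      qed
      ultimately show ?thesis using N(2) by auto
    qed
    moreover have "?N \<subseteq> range (\<lambda>l. hd l \<odot> y \<oplus> d (tl l))"
    proof
      fix u assume "u \<in> ?N"
      then obtain a n where *: "n \<in> N" "u = a \<odot> y \<oplus> n" by blast
      then obtain l where "n = d l" using N(3) by auto
      then have "u = (\<lambda>l. hd l \<odot> y \<oplus> d (tl l)) (a # l)" using * by simp
      then show "u \<in> range (\<lambda>l. hd l \<odot> y \<oplus> d (tl l))" by blast
    qed
    ultimately show ?case by blast
  qed
  from this[of xs] obtain N d where N: "submodule N R M" "S \<subseteq> N" "N \<subseteq> range (d :: 'r list \<Rightarrow> 'm)"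
    using xs S(2) by auto
  then have "module_span R M S \<subseteq> N"
    unfolding module_span_def by (intro Inter_lower CollectI conjI)
  with N(3) S(3) have d: "carrier M \<subseteq> range d" by simp
  define h where "h = inv_into UNIV d"
  have dh: "d (h x) = x" if "x \<in> carrier M" for x
    using that d by (auto simp: h_def f_inv_into_f subset_iff)
  define M' :: "('r, 'r list) module" where
    "M' = \<lparr> carrier = h ` carrier M, mult = undefined, one = undefined, zero = h \<zero>,
       add = (\<lambda>u v. h (d u \<oplus> d v)), smult = (\<lambda>a u. h (a \<odot> d u)) \<rparr>"
  have "abelian_group M'"
  proof (rule abelian_groupI)
    fix u assume "u \<in> carrier M'"
    then show "\<exists>v \<in> carrier M'. v \<oplus>\<^bsub>M'\<^esub> u = \<zero>\<^bsub>M'\<^esub>"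
      by (intro bexI[of _ "h (\<ominus> d u)"]) (auto simp: M'_def dh M.l_neg)
  qed (auto simp: M'_def dh M.a_ac)
  moreover have "left_module_axioms R M'"
    unfolding left_module_axioms_def
    by (auto simp: M'_def dh smult_l_distr smult_r_distr smult_assoc)
  ultimately have M': "left_module R M'"
    using R.ring_axioms by (simp add: left_module_def)
  have h: "h \<in> mod_hom R M M'"
    by (rule mod_homI) (auto simp: M'_def dh)
  have "inj_on h (carrier M)" by (rule inj_on_inverseI[of _ d]) (rule dh)
  then have "bij_betw h (carrier M) (carrier M')"
    by (simp add: bij_betw_def M'_def)
  moreover from this have "fg_module R M'"
    using fg_module_image[OF assms M' h] by (simp add: bij_betw_def)
  ultimately show ?thesis using h by blast
qed


section \<open>Socle, projective covers and injective envelopes\<close>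

definition simple_submodule :: "'m set \<Rightarrow> 'r ring \<Rightarrow> ('r, 'm) module \<Rightarrow> bool" where
  "simple_submodule N R M \<longleftrightarrow> submodule N R M \<and> N \<noteq> {\<zero>\<^bsub>M\<^esub>} \<and>
     (\<forall>L. submodule L R M \<and> L \<subseteq> N \<longrightarrow> L = {\<zero>\<^bsub>M\<^esub>} \<or> L = N)"

definition socle :: "'r ring \<Rightarrow> ('r, 'm) module \<Rightarrow> 'm set" where
  "socle R M = module_span R M (\<Union>{N. simple_submodule N R M})"

text \<open>
  A formula cannot quantify over types, so the lifting and extension properties below range over the
  finitely generated modules whose elements lie in the type of lists over the ring.
  Up to isomorphism these are all the finitely generated modules (an element is encoded by
  its coefficients with respect to a generating tuple), see \<open>fg_module_iso_list\<close> above.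
  By definition \<open>projective_module\<close> thus means projective in the category of finitely
  generated modules, which for a finitely generated module is the same as projective among all modules.
  Over a noetherian ring \<open>injective_module\<close> means injective among all modules by Baer's
  criterion, since left ideals are then finitely generated.
\<close>

definition projective_module :: "'r ring \<Rightarrow> ('r, 'p) module \<Rightarrow> bool" where
  "projective_module R P \<longleftrightarrow> fg_module R P \<and>
     (\<forall>(A :: ('r, 'r list) module) (B :: ('r, 'r list) module) e g.
        fg_module R A \<and> fg_module R B \<and>
        e \<in> mod_hom R A B \<and> e ` carrier A = carrier B \<and> g \<in> mod_hom R P B \<longrightarrow>
        (\<exists>h \<in> mod_hom R P A. \<forall>x \<in> carrier P. e (h x) = g x))"

definition injective_module :: "'r ring \<Rightarrow> ('r, 'e) module \<Rightarrow> bool" where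
  "injective_module R E \<longleftrightarrow> left_module R E \<and>
     (\<forall>(A :: ('r, 'r list) module) (B :: ('r, 'r list) module) i g.
        fg_module R A \<and> fg_module R B \<and>
        i \<in> mod_hom R A B \<and> inj_on i (carrier A) \<and> g \<in> mod_hom R A E \<longrightarrow>
        (\<exists>h \<in> mod_hom R B E. \<forall>x \<in> carrier A. h (i x) = g x))"

definition projective_cover ::
  "'r ring \<Rightarrow> ('r, 'p) module \<Rightarrow> ('p \<Rightarrow> 'm) \<Rightarrow> ('r, 'm) module \<Rightarrow> bool" where
  "projective_cover R P \<pi> M \<longleftrightarrow> projective_module R P \<and>
     \<pi> \<in> mod_hom R P M \<and> \<pi> ` carrier P = carrier M \<and>
     (\<forall>N. submodule N R P \<and> N <+>\<^bsub>P\<^esub> a_kernel P M \<pi> = carrier P \<longrightarrow> N = carrier P)"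

definition injective_envelope ::
  "'r ring \<Rightarrow> ('r, 'm) module \<Rightarrow> ('m \<Rightarrow> 'e) \<Rightarrow> ('r, 'e) module \<Rightarrow> bool" where
  "injective_envelope R M \<iota> E \<longleftrightarrow> injective_module R E \<and>
     \<iota> \<in> mod_hom R M E \<and> inj_on \<iota> (carrier M) \<and>
     (\<forall>N. submodule N R E \<and> N \<inter> \<iota> ` carrier M = {\<zero>\<^bsub>E\<^esub>} \<longrightarrow> N = {\<zero>\<^bsub>E\<^esub>})"

text \<open>\<open>P\<^sub>1 \<rightarrow> P\<^sub>0 \<rightarrow> M \<rightarrow> 0\<close>, with maps \<open>f\<close> and \<open>p\<close>\<close>

definition minimal_projective_presentation ::
  "'r ring \<Rightarrow> ('r, 'p1) module \<Rightarrow> ('p1 \<Rightarrow> 'p0) \<Rightarrow> ('r, 'p0) module \<Rightarrow> ('p0 \<Rightarrow> 'm) \<Rightarrow>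
     ('r, 'm) module \<Rightarrow> bool" where
  "minimal_projective_presentation R P1 f P0 p M \<longleftrightarrow>
     projective_cover R P0 p M \<and> projective_cover R P1 f (kernel_module P0 M p)"


section \<open>Artin algebras, duality and transpose\<close>

definition artinian_cring :: "'k ring \<Rightarrow> bool" where
  "artinian_cring k \<longleftrightarrow> cring k \<and>
     (\<forall>I :: nat \<Rightarrow> 'k set. (\<forall>n. ideal (I n) k \<and> I (Suc n) \<subseteq> I n) \<longrightarrow> (\<exists>n. \<forall>m\<ge>n. I m = I n))"

text \<open>The radical of a commutative ring; it is the whole ring if the ring is zero.\<close>

definition jacobson_radical :: "'k ring \<Rightarrow> 'k set" where
  "jacobson_radical k = carrier k \<inter> \<Inter>{I. maximalideal I k}"

text \<open>\<open>\<Lambda>\<close> is an artin algebra over \<open>k\<close> via the structure map \<open>\<phi>\<close>.\<close>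

definition artin_algebra :: "'k ring \<Rightarrow> ('k \<Rightarrow> 'r) \<Rightarrow> 'r ring \<Rightarrow> bool" where
  "artin_algebra k \<phi> \<Lambda> \<longleftrightarrow> artinian_cring k \<and> ring \<Lambda> \<and> \<phi> \<in> ring_hom k \<Lambda> \<and>
     (\<forall>c \<in> carrier k. \<forall>a \<in> carrier \<Lambda>. \<phi> c \<otimes>\<^bsub>\<Lambda>\<^esub> a = a \<otimes>\<^bsub>\<Lambda>\<^esub> \<phi> c) \<and>
     fg_module k (restrict_scalars \<phi> (regular_module \<Lambda>))"

text \<open>
  The group of \<open>R\<close>-homomorphisms \<open>M \<rightarrow> N\<close>, with scalars acting by
  \<open>(a \<cdot> f) x = act a f x\<close>.  Its elements are extensional, so that equal homomorphisms are
  equal elements.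
\<close>

definition hom_module ::
  "'r ring \<Rightarrow> ('r, 'm) module \<Rightarrow> ('r, 'n) module \<Rightarrow> ('s \<Rightarrow> ('m \<Rightarrow> 'n) \<Rightarrow> 'm \<Rightarrow> 'n) \<Rightarrow>
     ('s, 'm \<Rightarrow> 'n) module" where
  "hom_module R M N act =
     \<lparr> carrier = mod_hom R M N \<inter> extensional (carrier M), mult = undefined, one = undefined,
       zero = (\<lambda>x\<in>carrier M. \<zero>\<^bsub>N\<^esub>),
       add = (\<lambda>f g. \<lambda>x\<in>carrier M. f x \<oplus>\<^bsub>N\<^esub> g x),
       smult = (\<lambda>a f. \<lambda>x\<in>carrier M. act a f x) \<rparr>"

text \<open>
  \<open>D M = Hom\<^sub>k(M, J)\<close>, where \<open>J\<close> is to be an injective envelope of \<open>k / rad k\<close>.  If \<open>M\<close> is a left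
  \<open>\<Lambda>\<close>-module, then this is a right \<open>\<Lambda>\<close>-module, i.e. a module over \<^term>\<open>op_ring \<Lambda>\<close>, by
  \<open>(f \<cdot> a) x = f (a \<cdot> x)\<close>.
\<close>

definition dual_module ::
  "'k ring \<Rightarrow> ('k \<Rightarrow> 'r) \<Rightarrow> ('k, 'j) module \<Rightarrow> ('r, 'm) module \<Rightarrow> ('r, 'm \<Rightarrow> 'j) module" where
  "dual_module k \<phi> J M = hom_module k (restrict_scalars \<phi> M) J (\<lambda>a f x. f (a \<odot>\<^bsub>M\<^esub> x))"

text \<open>
  \<open>Hom\<^sub>R(M, R)\<close>, which is a module over \<^term>\<open>op_ring R\<close> by \<open>(f \<cdot> a) x = f x \<cdot> a\<close>.
\<close>

definition ring_dual :: "'r ring \<Rightarrow> ('r, 'm) module \<Rightarrow> ('r, 'm \<Rightarrow> 'r) module" where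
  "ring_dual R M = hom_module R M (regular_module R) (\<lambda>a f x. f x \<otimes>\<^bsub>R\<^esub> a)"

text \<open>
  The transpose of an \<open>R\<close>-module with minimal projective presentation \<open>f : P\<^sub>1 \<rightarrow> P\<^sub>0\<close>: the cokernel of
  \<open>Hom\<^sub>R(f, R) : Hom\<^sub>R(P\<^sub>0, R) \<rightarrow> Hom\<^sub>R(P\<^sub>1, R)\<close>.  It is a module over \<^term>\<open>op_ring R\<close>.
\<close>

definition transpose_module ::
  "'r ring \<Rightarrow> ('r, 'p1) module \<Rightarrow> ('p1 \<Rightarrow> 'p0) \<Rightarrow> ('r, 'p0) module \<Rightarrow> ('r, ('p1 \<Rightarrow> 'r) set) module" where
  "transpose_module R P1 f P0 =
     cokernel_module (ring_dual R P0) (ring_dual R P1) (\<lambda>g. \<lambda>x\<in>carrier P1. g (f x))"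


text \<open>The constructions above do yield modules over the rings claimed.\<close>

lemma left_module_regular_module:
  assumes "ring R"
  shows "left_module R (regular_module R)"
proof -
  interpret ring R by fact
  have "abelian_group (regular_module R)"
  proof (rule abelian_groupI)
    fix x assume "x \<in> carrier (regular_module R)"
    then show "\<exists>y \<in> carrier (regular_module R).
        y \<oplus>\<^bsub>regular_module R\<^esub> x = \<zero>\<^bsub>regular_module R\<^esub>"
      by (intro bexI[of _ "\<ominus>\<^bsub>R\<^esub> x"]) (auto simp: regular_module_def l_neg)
  qed (auto simp: regular_module_def a_ac)
  moreover have "left_module_axioms R (regular_module R)"
    by (auto simp: left_module_axioms_def regular_module_def l_distr r_distr m_assoc)
  ultimately show ?thesis
    using assms by (simp add: left_module_def)
qed

lemma left_module_restrict_scalars: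
  assumes "left_module R M" "ring k" "\<phi> \<in> ring_hom k R"
  shows "left_module k (restrict_scalars \<phi> M)"
proof -
  interpret left_module R M by fact
  have "abelian_group (restrict_scalars \<phi> M)"
  proof (rule abelian_groupI)
    fix x assume "x \<in> carrier (restrict_scalars \<phi> M)"
    then show "\<exists>y \<in> carrier (restrict_scalars \<phi> M).
        y \<oplus>\<^bsub>restrict_scalars \<phi> M\<^esub> x = \<zero>\<^bsub>restrict_scalars \<phi> M\<^esub>"
      by (intro bexI[of _ "\<ominus>\<^bsub>M\<^esub> x"]) (auto simp: restrict_scalars_def M.l_neg)
  qed (auto simp: restrict_scalars_def M.a_ac)
  moreover have "left_module_axioms k (restrict_scalars \<phi> M)"
    using ring_hom_closed[OF assms(3)] ring_hom_mult[OF assms(3)] ring_hom_add[OF assms(3)]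
      ring_hom_one[OF assms(3)]
    by (auto simp: left_module_axioms_def restrict_scalars_def
        smult_l_distr smult_r_distr smult_assoc)
  ultimately show ?thesis
    using assms(2) by (simp add: left_module_def)
qed

lemma left_module_direct_sum:
  assumes "left_module R M" "left_module R N"
  shows "left_module R (direct_sum M N)"
proof -
  interpret M: left_module R M by fact
  interpret N: left_module R N by fact
  have "abelian_group (direct_sum M N)"
  proof (rule abelian_groupI)
    fix x assume "x \<in> carrier (direct_sum M N)"
    then show "\<exists>y \<in> carrier (direct_sum M N).
        y \<oplus>\<^bsub>direct_sum M N\<^esub> x = \<zero>\<^bsub>direct_sum M N\<^esub>"
      by (intro bexI[of _ "(\<ominus>\<^bsub>M\<^esub> fst x, \<ominus>\<^bsub>N\<^esub> snd x)"])
        (auto simp: direct_sum_def M.M.l_neg N.M.l_neg)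
  qed (auto simp: direct_sum_def M.M.a_ac N.M.a_ac)
  moreover have "left_module_axioms R (direct_sum M N)"
    by (auto simp: left_module_axioms_def direct_sum_def M.smult_l_distr M.smult_r_distr
        M.smult_assoc N.smult_l_distr N.smult_r_distr N.smult_assoc)
  ultimately show ?thesis
    using M.R.ring_axioms by (simp add: left_module_def)
qed

lemma mod_hom_cong:
  assumes "f \<in> mod_hom R M N" "\<And>x. x \<in> carrier M \<Longrightarrow> g x = f x" "left_module R M"
  shows "g \<in> mod_hom R M N"
proof -
  interpret left_module R M by fact
  show ?thesis
    by (rule mod_homI) (use mod_homD[OF assms(1)] assms(2) in auto)
qed

lemma left_module_hom_module:
  assumes M: "left_module R M" and N: "left_module R N" and S: "ring S"
    and closed: "\<And>a f. \<lbrakk> a \<in> carrier S; f \<in> mod_hom R M N \<rbrakk> \<Longrightarrow> act a f \<in> mod_hom R M N"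
    and ext: "\<And>a f g x. \<lbrakk> a \<in> carrier S; x \<in> carrier M; \<And>y. y \<in> carrier M \<Longrightarrow> f y = g y \<rbrakk> \<Longrightarrow>
      act a f x = act a g x"
    and ladd: "\<And>a b f x. \<lbrakk> a \<in> carrier S; b \<in> carrier S; f \<in> mod_hom R M N; x \<in> carrier M \<rbrakk> \<Longrightarrow>
      act (a \<oplus>\<^bsub>S\<^esub> b) f x = act a f x \<oplus>\<^bsub>N\<^esub> act b f x"
    and radd: "\<And>a f g x. \<lbrakk> a \<in> carrier S; f \<in> mod_hom R M N; g \<in> mod_hom R M N; x \<in> carrier M \<rbrakk> \<Longrightarrow>
      act a (\<lambda>x. f x \<oplus>\<^bsub>N\<^esub> g x) x = act a f x \<oplus>\<^bsub>N\<^esub> act a g x"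
    and mul: "\<And>a b f x. \<lbrakk> a \<in> carrier S; b \<in> carrier S; f \<in> mod_hom R M N; x \<in> carrier M \<rbrakk> \<Longrightarrow>
      act (a \<otimes>\<^bsub>S\<^esub> b) f x = act a (act b f) x"
    and one: "\<And>f x. \<lbrakk> f \<in> mod_hom R M N; x \<in> carrier M \<rbrakk> \<Longrightarrow> act \<one>\<^bsub>S\<^esub> f x = f x"
  shows "left_module S (hom_module R M N act)"
proof -
  interpret M: left_module R M by fact
  interpret N: left_module R N by fact
  let ?H = "hom_module R M N act"
  note [simp] = hom_module_def
  have add: "(\<lambda>x. f x \<oplus>\<^bsub>N\<^esub> g x) \<in> mod_hom R M N"
    if "f \<in> mod_hom R M N" "g \<in> mod_hom R M N" for f g
    by (rule mod_homI)
      (use mod_homD[OF that(1)] mod_homD[OF that(2)] in \<open>simp_all add: N.M.a_ac N.smult_r_distr\<close>)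
  have zero: "(\<lambda>x. \<zero>\<^bsub>N\<^esub>) \<in> mod_hom R M N" by (rule mod_homI) auto
  have neg: "(\<lambda>x. \<ominus>\<^bsub>N\<^esub> f x) \<in> mod_hom R M N" if "f \<in> mod_hom R M N" for f
    by (rule mod_homI)
      (use mod_homD[OF that] in \<open>simp_all add: N.M.minus_add N.smult_r_minus\<close>)
  have restr: "restrict f (carrier M) \<in> mod_hom R M N" if "f \<in> mod_hom R M N" for f
    by (rule mod_hom_cong[OF that _ M]) simp
  have "abelian_group ?H"
  proof (rule abelian_groupI)
    show "f \<oplus>\<^bsub>?H\<^esub> g \<in> carrier ?H" if "f \<in> carrier ?H" "g \<in> carrier ?H" for f g
      using that restr[OF add, of f g] by simp
    show "\<zero>\<^bsub>?H\<^esub> \<in> carrier ?H"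
      using restr[OF zero] by simp
    show "f \<oplus>\<^bsub>?H\<^esub> g \<oplus>\<^bsub>?H\<^esub> h = f \<oplus>\<^bsub>?H\<^esub> (g \<oplus>\<^bsub>?H\<^esub> h)"
      if "f \<in> carrier ?H" "g \<in> carrier ?H" "h \<in> carrier ?H" for f g h
      using that mod_homD(1)[of f R M N] mod_homD(1)[of g R M N] mod_homD(1)[of h R M N]
      by (auto simp: fun_eq_iff restrict_def N.M.a_assoc)
    show "f \<oplus>\<^bsub>?H\<^esub> g = g \<oplus>\<^bsub>?H\<^esub> f" if "f \<in> carrier ?H" "g \<in> carrier ?H" for f g
      using that mod_homD(1)[of f R M N] mod_homD(1)[of g R M N]
      by (auto simp: fun_eq_iff restrict_def N.M.a_comm)
    show "\<zero>\<^bsub>?H\<^esub> \<oplus>\<^bsub>?H\<^esub> f = f" if "f \<in> carrier ?H" for f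
      using that mod_homD(1)[of f R M N]
      by (auto simp: fun_eq_iff restrict_def extensional_def)
    show "\<exists>g \<in> carrier ?H. g \<oplus>\<^bsub>?H\<^esub> f = \<zero>\<^bsub>?H\<^esub>" if "f \<in> carrier ?H" for f
      using that mod_homD(1)[of f R M N] restr[OF neg, of f]
      by (intro bexI[of _ "\<lambda>x\<in>carrier M. \<ominus>\<^bsub>N\<^esub> f x"])
        (auto simp: fun_eq_iff restrict_def extensional_def N.M.l_neg)
  qed
  moreover have "left_module_axioms S ?H"
    unfolding left_module_axioms_def
  proof (intro conjI allI impI)
    fix a b f g assume a: "a \<in> carrier S" and f: "f \<in> carrier ?H"
    then have f': "f \<in> mod_hom R M N" by simp
    show "a \<odot>\<^bsub>?H\<^esub> f \<in> carrier ?H"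
      using restr[OF closed[OF a f']] by simp
    show "a \<odot>\<^bsub>?H\<^esub> (f \<oplus>\<^bsub>?H\<^esub> g) = a \<odot>\<^bsub>?H\<^esub> f \<oplus>\<^bsub>?H\<^esub> a \<odot>\<^bsub>?H\<^esub> g" if "g \<in> carrier ?H"
    proof -
      have "act a (\<lambda>x\<in>carrier M. f x \<oplus>\<^bsub>N\<^esub> g x) x = act a f x \<oplus>\<^bsub>N\<^esub> act a g x"
        if "x \<in> carrier M" for x
        using radd[OF a f' _ that, of g] \<open>g \<in> carrier ?H\<close>
          ext[OF a that, of "\<lambda>x\<in>carrier M. f x \<oplus>\<^bsub>N\<^esub> g x" "\<lambda>x. f x \<oplus>\<^bsub>N\<^esub> g x"] by simp
      then show ?thesis by (auto simp: fun_eq_iff restrict_def)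
    qed
    assume b: "b \<in> carrier S"
    show "(a \<oplus>\<^bsub>S\<^esub> b) \<odot>\<^bsub>?H\<^esub> f = a \<odot>\<^bsub>?H\<^esub> f \<oplus>\<^bsub>?H\<^esub> b \<odot>\<^bsub>?H\<^esub> f"
      using ladd[OF a b f'] by (auto simp: fun_eq_iff restrict_def)
    have "act a (restrict (act b f) (carrier M)) x = act a (act b f) x" if "x \<in> carrier M" for x
      by (rule ext[OF a that]) simp
    then show "(a \<otimes>\<^bsub>S\<^esub> b) \<odot>\<^bsub>?H\<^esub> f = a \<odot>\<^bsub>?H\<^esub> (b \<odot>\<^bsub>?H\<^esub> f)"
      using mul[OF a b f'] by (auto simp: fun_eq_iff restrict_def)
  next
    fix f assume f: "f \<in> carrier ?H"
    then show "\<one>\<^bsub>S\<^esub> \<odot>\<^bsub>?H\<^esub> f = f"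
      using one[of f] by (auto simp: fun_eq_iff restrict_def extensional_def)
  qed
  ultimately show ?thesis
    using S by (simp add: left_module_def)
qed

lemma left_module_ring_dual:
  assumes "left_module R M"
  shows "left_module (op_ring R) (ring_dual R M)"
proof -
  interpret left_module R M by fact
  have D1: "f x \<in> carrier R" if "f \<in> mod_hom R M (regular_module R)" "x \<in> carrier M" for f x
    using mod_homD(1)[OF that] by simp
  show ?thesis
    unfolding ring_dual_def
  proof (rule left_module_hom_module)
    show "(\<lambda>x. f x \<otimes>\<^bsub>R\<^esub> a) \<in> mod_hom R M (regular_module R)"
      if "a \<in> carrier (op_ring R)" "f \<in> mod_hom R M (regular_module R)" for a f
      by (rule mod_homI)
        (use that(1) D1[OF that(2)] mod_homD(2,3)[OF that(2)] in
          \<open>simp_all add: R.l_distr R.m_assoc\<close>)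
  qed (simp_all add: assms left_module_regular_module ring_op_ring R.ring_axioms D1
      R.l_distr R.r_distr R.m_assoc)
qed

lemma left_module_dual_module:
  assumes "artin_algebra k \<phi> \<Lambda>" "left_module k J" "left_module \<Lambda> M"
  shows "left_module (op_ring \<Lambda>) (dual_module k \<phi> J M)"
proof -
  interpret J: left_module k J by fact
  interpret M: left_module \<Lambda> M by fact
  have \<phi>: "\<phi> \<in> ring_hom k \<Lambda>"
    and central: "\<And>c a. \<lbrakk> c \<in> carrier k; a \<in> carrier \<Lambda> \<rbrakk> \<Longrightarrow> \<phi> c \<otimes>\<^bsub>\<Lambda>\<^esub> a = a \<otimes>\<^bsub>\<Lambda>\<^esub> \<phi> c"
    using assms(1) by (auto simp: artin_algebra_def)
  let ?M = "restrict_scalars \<phi> M"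
  have res: "left_module k ?M"
    by (rule left_module_restrict_scalars[OF assms(3) J.R.ring_axioms \<phi>])
  have D1: "f x \<in> carrier J" if "f \<in> mod_hom k ?M J" "x \<in> carrier M" for f x
    using mod_homD(1)[OF that(1)] that(2) by simp
  have D2: "f (x \<oplus>\<^bsub>M\<^esub> y) = f x \<oplus>\<^bsub>J\<^esub> f y"
    if "f \<in> mod_hom k ?M J" "x \<in> carrier M" "y \<in> carrier M" for f x y
    using mod_homD(2)[OF that(1)] that(2,3) by simp
  have D3: "f (\<phi> c \<odot>\<^bsub>M\<^esub> x) = c \<odot>\<^bsub>J\<^esub> f x"
    if "f \<in> mod_hom k ?M J" "c \<in> carrier k" "x \<in> carrier M" for f x c
    using mod_homD(3)[OF that(1)] that(2,3) by simp
  have comm: "a \<odot>\<^bsub>M\<^esub> (\<phi> c \<odot>\<^bsub>M\<^esub> x) = \<phi> c \<odot>\<^bsub>M\<^esub> (a \<odot>\<^bsub>M\<^esub> x)"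
    if "a \<in> carrier \<Lambda>" "c \<in> carrier k" "x \<in> carrier M" for a c x
    using central[OF that(2,1)] that ring_hom_closed[OF \<phi> that(2)]
    by (simp flip: M.smult_assoc)
  show ?thesis
    unfolding dual_module_def
  proof (rule left_module_hom_module)
    show "(\<lambda>x. f (a \<odot>\<^bsub>M\<^esub> x)) \<in> mod_hom k ?M J"
      if "a \<in> carrier (op_ring \<Lambda>)" "f \<in> mod_hom k ?M J" for a f
      by (rule mod_homI)
        (use that(1) D1[OF that(2)] D2[OF that(2)] D3[OF that(2)] in
          \<open>simp_all add: M.smult_r_distr comm\<close>)
  qed (simp_all add: assms(2) res ring_op_ring M.R.ring_axioms D1 D2
      M.smult_l_distr M.smult_assoc)
qed

lemma ring_dual_map:
  assumes "left_module R P1" "left_module R P0" "f \<in> mod_hom R P1 P0"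
  shows "(\<lambda>g. \<lambda>x\<in>carrier P1. g (f x)) \<in> mod_hom (op_ring R) (ring_dual R P0) (ring_dual R P1)"
proof -
  interpret P1: left_module R P1 by fact
  interpret P0: left_module R P0 by fact
  note f = mod_homD[OF assms(3)]
  show ?thesis
  proof (rule mod_homI)
    fix g assume "g \<in> carrier (ring_dual R P0)"
    then have g: "g \<in> mod_hom R P0 (regular_module R)" by (simp add: ring_dual_def hom_module_def)
    have "(\<lambda>x\<in>carrier P1. g (f x)) \<in> mod_hom R P1 (regular_module R)"
      by (rule mod_homI) (use f mod_homD[OF g] in auto)
    then show "(\<lambda>x\<in>carrier P1. g (f x)) \<in> carrier (ring_dual R P1)"
      by (simp add: ring_dual_def hom_module_def)
  qed (use f(1) in \<open>auto simp: ring_dual_def hom_module_def fun_eq_iff restrict_def\<close>)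
qed

lemma left_module_transpose_module:
  assumes "left_module R P1" "left_module R P0" "f \<in> mod_hom R P1 P0"
  shows "left_module (op_ring R) (transpose_module R P1 f P0)"
  unfolding transpose_module_def cokernel_module_def
  using left_module_ring_dual[OF assms(1)] left_module_ring_dual[OF assms(2)] ring_dual_map[OF assms]
  by (intro left_module.left_module_quotient submodule_image)


section \<open>Determined morphisms\<close>

text \<open>
  \<open>\<alpha> : X \<rightarrow> Y\<close> is right determined by \<open>C\<close>, tested on all finitely generated modules \<open>X'\<close> with
  elements in the given type.
\<close>

definition right_determined ::
  "'x itself \<Rightarrow> 'r ring \<Rightarrow> ('r, 'a) module \<Rightarrow> ('a \<Rightarrow> 'b) \<Rightarrow> ('r, 'b) module \<Rightarrow> ('r, 'c) module \<Rightarrow> bool" where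
  "right_determined (_ :: 'x itself) R X \<alpha> Y C \<longleftrightarrow>
     (\<forall>(X' :: ('r, 'x) module) \<alpha>'. fg_module R X' \<and> \<alpha>' \<in> mod_hom R X' Y \<and>
        (\<forall>\<phi> \<in> mod_hom R C X'. \<exists>\<phi>' \<in> mod_hom R C X. \<forall>c \<in> carrier C. \<alpha>' (\<phi> c) = \<alpha> (\<phi>' c)) \<longrightarrow>
        (\<exists>\<beta> \<in> mod_hom R X' X. \<forall>x \<in> carrier X'. \<alpha>' x = \<alpha> (\<beta> x)))"

end

theory Submission
  imports Defs
begin

text \<open>
  Let \<open>\<alpha>'\<close> satisfy the hypothesis.  If its image were not contained in that of \<open>\<alpha>\<close>, the image of \<open>\<alpha>'\<close> in
  \<open>Q\<close> would contain a simple module \<open>S\<close>, and the nonzero map \<open>P(soc Q) \<rightarrow> soc Q \<rightarrow> S\<close> would lift to the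
  source of \<open>\<alpha>'\<close>, contradicting the hypothesis.  Hence the pullback of \<open>\<alpha>\<close> along \<open>\<alpha>'\<close> is an extension
  \<open>0 \<rightarrow> K \<rightarrow> E \<rightarrow> X' \<rightarrow> 0\<close>, which has to be split.  Every map \<open>Tr D K \<rightarrow> X'\<close> lifts to \<open>E\<close>.
  With a projective presentation \<open>P1 \<rightarrow> P0 \<rightarrow> D K\<close>, the group \<open>Hom(Tr D K, N)\<close> is the kernel of
  \<open>P1 \<otimes> N \<rightarrow> P0 \<otimes> N\<close>, so by the snake lemma \<open>D K \<otimes> K \<rightarrow> D K \<otimes> E\<close> is injective.  Since \<open>J\<close> is injective,
  the evaluation \<open>D K \<otimes> K \<rightarrow> J\<close> extends to \<open>D K \<otimes> E\<close>; the extension is a map \<open>E \<rightarrow> D D K = K\<close>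
  that restricts to the identity on \<open>K\<close>.
\<close>


section \<open>Composition series\<close>

text \<open>Finiteness over \<open>k\<close> shapes the proof. \<open>J\<close> extends functionals
  only between finitely generated modules, so every submodule that carries a functional has to be
  finitely generated. This is read off from finite length over \<open>k\<close>, and thus from the
  fact that an artinian commutative ring has finite length over itself. Simple submodules over
  \<open>\<Lambda>\<close> are found by minimising length over \<open>k\<close> as well. The
  equality K = D D K rests on one property of \<open>J\<close>: for each maximal ideal m of
  \<open>k\<close>, the elements of \<open>J\<close> killed by m form a one-dimensional space over
  k/m. It is extracted from \<open>J\<close> being essential over k / rad k. The tensor product D K
  \<otimes> N is never formed. It is the cokernel of P1 \<otimes> N \<rightarrow> P0 \<otimes> N,
  and since it only serves as a source of maps to \<open>J\<close>, functionals on P0 \<otimes> N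
  that vanish on the image of P1 \<otimes> N take its place. Elements of P \<otimes> N, for P
  projective, are controlled by a dual basis of P.\<close>

definition submodule_cover :: "'r ring \<Rightarrow> ('r, 'm) module \<Rightarrow> 'm set \<Rightarrow> 'm set \<Rightarrow> bool" where
  "submodule_cover R M N N' \<longleftrightarrow> submodule N R M \<and> submodule N' R M \<and> N \<subset> N' \<and>
     (\<forall>L. submodule L R M \<and> N \<subseteq> L \<and> L \<subseteq> N' \<longrightarrow> L = N \<or> L = N')"

text \<open>\<open>submodule_cover\<close> says that N'/N is simple without forming the quotient. A
  composition series therefore stays in the submodule lattice of one module, and hence in one
  type.\<close>

inductive has_length :: "'r ring \<Rightarrow> ('r, 'm) module \<Rightarrow> nat \<Rightarrow> 'm set \<Rightarrow> bool"
  for R M where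
  zero: "has_length R M 0 {\<zero>\<^bsub>M\<^esub>}"
| Suc: "\<lbrakk> has_length R M n N; submodule_cover R M N N' \<rbrakk> \<Longrightarrow> has_length R M (Suc n) N'"

definition finite_length :: "'r ring \<Rightarrow> ('r, 'm) module \<Rightarrow> 'm set \<Rightarrow> bool" where
  "finite_length R M N \<longleftrightarrow> (\<exists>n. has_length R M n N)"

lemma finite_length_induct [consumes 1, case_names zero cover]:
  assumes "finite_length R M N" "Q {\<zero>\<^bsub>M\<^esub>}"
    and "\<And>N N'. \<lbrakk> finite_length R M N; Q N; submodule_cover R M N N' \<rbrakk> \<Longrightarrow> Q N'"
  shows "Q N"
proof -
  obtain n where "has_length R M n N" using assms(1) by (auto simp: finite_length_def)
  then show ?thesis
    by induction (use assms(2,3) in \<open>auto simp: finite_length_def\<close>)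
qed

lemma finite_length_zero [simp]: "finite_length R M {\<zero>\<^bsub>M\<^esub>}"
  by (auto simp: finite_length_def intro: has_length.zero)

lemma finite_length_cover:
  "\<lbrakk> finite_length R M N; submodule_cover R M N N' \<rbrakk> \<Longrightarrow> finite_length R M N'"
  by (auto simp: finite_length_def intro: has_length.Suc)

section \<open>The submodule lattice and composition series\<close>

context left_module
begin

lemma minus_closed: "submodule N R M \<Longrightarrow> x \<in> N \<Longrightarrow> y \<in> N \<Longrightarrow> x \<ominus> y \<in> N"
  using submodD by (auto simp: a_minus_def)

lemma add_minus_cancel: "\<lbrakk> a \<in> carrier M; b \<in> carrier M \<rbrakk> \<Longrightarrow> (a \<oplus> b) \<ominus> a = b"
  by (simp add: a_minus_def M.a_comm[of a b] M.a_assoc M.r_neg)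

lemma submodule_zero: "submodule {\<zero>} R M"
  by (rule submodI) auto

lemma submodule_carrier: "submodule (carrier M) R M"
  by (rule submodI) auto

lemma submodule_Int:
  assumes "submodule A R M" "submodule B R M"
  shows "submodule (A \<inter> B) R M"
  by (rule submodI) (use submodD[OF assms(1)] submodD[OF assms(2)] in auto)

lemma mem_set_add: "x \<in> A <+>\<^bsub>M\<^esub> B \<longleftrightarrow> (\<exists>a\<in>A. \<exists>b\<in>B. x = a \<oplus> b)"
  by (auto simp: set_add_def')

lemma submodule_set_add:
  assumes "submodule A R M" "submodule B R M"
  shows "submodule (A <+>\<^bsub>M\<^esub> B) R M"
proof -
  note A = submodD[OF assms(1)] and B = submodD[OF assms(2)]
  show ?thesis
  proof (rule submodI)
    show "A <+>\<^bsub>M\<^esub> B \<subseteq> carrier M" using A(1) B(1) by (auto simp: mem_set_add subset_iff)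
    show "\<zero> \<in> A <+>\<^bsub>M\<^esub> B" unfolding mem_set_add using A(2) B(2) M.l_zero M.zero_closed by metis
  next
    fix x y assume "x \<in> A <+>\<^bsub>M\<^esub> B" "y \<in> A <+>\<^bsub>M\<^esub> B"
    then obtain a b a' b' where *: "a \<in> A" "b \<in> B" "x = a \<oplus> b" "a' \<in> A" "b' \<in> B" "y = a' \<oplus> b'"
      by (auto simp: mem_set_add)
    then have "x \<oplus> y = (a \<oplus> a') \<oplus> (b \<oplus> b')"
      using A(1) B(1) by (auto simp: subset_iff M.a_ac)
    then show "x \<oplus> y \<in> A <+>\<^bsub>M\<^esub> B" unfolding mem_set_add using * A(3) B(3) by blast
  next
    fix c x assume c: "c \<in> carrier R" and "x \<in> A <+>\<^bsub>M\<^esub> B"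
    then obtain a b where *: "a \<in> A" "b \<in> B" "x = a \<oplus> b"
      by (auto simp: mem_set_add)
    then have "c \<odot> x = c \<odot> a \<oplus> c \<odot> b"
      using A(1) B(1) c by (auto simp: subset_iff smult_r_distr)
    then show "c \<odot> x \<in> A <+>\<^bsub>M\<^esub> B" unfolding mem_set_add using * c A(4) B(4) by blast
  qed
qed

lemma set_add_upper:
  assumes "submodule A R M" "submodule B R M"
  shows "A \<subseteq> A <+>\<^bsub>M\<^esub> B" "B \<subseteq> A <+>\<^bsub>M\<^esub> B"
proof -
  note A = submodD[OF assms(1)] and B = submodD[OF assms(2)]
  show "A \<subseteq> A <+>\<^bsub>M\<^esub> B" unfolding mem_set_add subset_iff
    using A(1,2) B(1,2) M.r_zero by (metis subsetD)
  show "B \<subseteq> A <+>\<^bsub>M\<^esub> B" unfolding mem_set_add subset_iff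
    using A(1,2) B(1,2) M.l_zero by (metis subsetD)
qed

lemma set_add_least:
  assumes "submodule L R M" "A \<subseteq> L" "B \<subseteq> L"
  shows "A <+>\<^bsub>M\<^esub> B \<subseteq> L"
  using submodD(3)[OF assms(1)] assms(2,3) by (auto simp: mem_set_add subset_iff)

lemma modular_law:
  assumes "submodule A R M" "submodule B R M" "submodule L R M" "A \<subseteq> L"
  shows "L \<inter> (A <+>\<^bsub>M\<^esub> B) = A <+>\<^bsub>M\<^esub> (L \<inter> B)"
proof
  show "A <+>\<^bsub>M\<^esub> (L \<inter> B) \<subseteq> L \<inter> (A <+>\<^bsub>M\<^esub> B)"
    using set_add_least[OF assms(3,4), of "L \<inter> B"] by (fastforce simp: mem_set_add)
  show "L \<inter> (A <+>\<^bsub>M\<^esub> B) \<subseteq> A <+>\<^bsub>M\<^esub> (L \<inter> B)"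
  proof
    fix x assume "x \<in> L \<inter> (A <+>\<^bsub>M\<^esub> B)"
    then obtain a b where *: "x \<in> L" "a \<in> A" "b \<in> B" "x = a \<oplus> b" by (auto simp: mem_set_add)
    have c: "a \<in> carrier M" "b \<in> carrier M" using * submodD(1)[OF assms(1)] submodD(1)[OF assms(2)] by auto
    have "b = x \<ominus> a" using c *(4) by (simp add: add_minus_cancel)
    then have "b \<in> L" using minus_closed[OF assms(3) *(1)] *(2) assms(4) by auto
    then show "x \<in> A <+>\<^bsub>M\<^esub> (L \<inter> B)" using * by (auto simp: mem_set_add)
  qed
qed

lemma has_length_submodule: "has_length R M n N \<Longrightarrow> submodule N R M"
  by (induction rule: has_length.induct) (auto simp: submodule_zero submodule_cover_def)

lemma finite_length_submodule: "finite_length R M N \<Longrightarrow> submodule N R M"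
  by (auto simp: finite_length_def has_length_submodule)

text \<open>The lattice form of L/(L \<inter> N) = (L + N)/N = N'/N. An intermediate
  \<open>A\<close> gives A + N = N or A + N = N'; in the second case the modular law yields L = L
  \<inter> (A + N) = A + (L \<inter> N) = A.\<close>

lemma cover_Int:
  assumes "submodule_cover R M N N'" "submodule L R M" "L \<subseteq> N'" "\<not> L \<subseteq> N"
  shows "submodule_cover R M (L \<inter> N) L"
proof -
  from assms(1) have N: "submodule N R M" and N': "submodule N' R M" and NN': "N \<subset> N'"
    and max: "\<And>A. submodule A R M \<Longrightarrow> N \<subseteq> A \<Longrightarrow> A \<subseteq> N' \<Longrightarrow> A = N \<or> A = N'"
    by (auto simp: submodule_cover_def)
  have "A = L \<inter> N \<or> A = L" if A: "submodule A R M" "L \<inter> N \<subseteq> A" "A \<subseteq> L" for A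
  proof -
    have "A <+>\<^bsub>M\<^esub> N = N \<or> A <+>\<^bsub>M\<^esub> N = N'"
    proof (rule max)
      show "A <+>\<^bsub>M\<^esub> N \<subseteq> N'" using set_add_least[OF N', of A N] A assms(3) NN' by auto
    qed (use submodule_set_add[OF A(1) N] set_add_upper[OF A(1) N] in auto)
    then show ?thesis
    proof
      assume "A <+>\<^bsub>M\<^esub> N = N"
      then show ?thesis using set_add_upper[OF A(1) N] A by auto
    next
      assume *: "A <+>\<^bsub>M\<^esub> N = N'"
      have "L = L \<inter> (A <+>\<^bsub>M\<^esub> N)" using * assms(3) by auto
      also have "\<dots> = A <+>\<^bsub>M\<^esub> (L \<inter> N)" by (rule modular_law[OF A(1) N assms(2) A(3)])
      also have "\<dots> \<subseteq> A" by (rule set_add_least[OF A(1)]) (use A in auto)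
      finally show ?thesis using A by auto
    qed
  qed
  then show ?thesis
    using submodule_Int[OF assms(2) N] assms(2,4) by (auto simp: submodule_cover_def)
qed

text \<open>Intersecting a series of \<open>N\<close> with \<open>L\<close> turns each step into a
  cover, by \<open>cover_Int\<close>, or into an equality. The strict inequality is what lets
  \<open>ex_simple_submodule\<close> work with a nonzero submodule of least length.\<close>

lemma has_length_mono:
  assumes "has_length R M n N" "submodule L R M" "L \<subseteq> N"
  shows "\<exists>m\<le>n. has_length R M m L \<and> (L \<noteq> N \<longrightarrow> m < n)"
  using assms
proof (induction arbitrary: L rule: has_length.induct)
  case zero
  then have "L = {\<zero>}" using submodD(2)[OF zero(1)] by auto
  then show ?case using has_length.zero by auto
next
  case (Suc n N N')
  from Suc.hyps have N: "submodule N R M" and NN': "N \<subset> N'"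
    and max: "\<And>A. submodule A R M \<Longrightarrow> N \<subseteq> A \<Longrightarrow> A \<subseteq> N' \<Longrightarrow> A = N \<or> A = N'"
    by (auto simp: submodule_cover_def)
  obtain m where m: "m \<le> n" "has_length R M m (L \<inter> N)" "L \<inter> N \<noteq> N \<longrightarrow> m < n"
    using Suc.IH[OF submodule_Int[OF Suc.prems(1) N]] by auto
  show ?case
  proof (cases "L \<subseteq> N")
    case True
    then have "L \<inter> N = L" by auto
    then show ?thesis using m by (intro exI[of _ m]) auto
  next
    case False
    have "has_length R M (Suc m) L"
      using has_length.Suc[OF m(2) cover_Int[OF Suc.hyps(2) Suc.prems False]] .
    moreover have "L \<inter> N \<noteq> N" if "L \<noteq> N'"
      using max[OF Suc.prems(1) _ Suc.prems(2)] False that by auto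
    ultimately show ?thesis using m by (intro exI[of _ "Suc m"]) auto
  qed
qed

lemma finite_length_mono:
  assumes "finite_length R M N" "submodule L R M" "L \<subseteq> N"
  shows "finite_length R M L"
  using assms has_length_mono unfolding finite_length_def by blast

text \<open>\<open>A\<close> is added to every member of a series of \<open>B\<close>. By the
  modular law a submodule between A + B and A + B' is \<open>A\<close> plus its intersection with
  \<open>B'\<close>, so each step stays a cover or collapses.\<close>

lemma finite_length_set_add:
  assumes "finite_length R M B" "finite_length R M A"
  shows "finite_length R M (A <+>\<^bsub>M\<^esub> B)"
  using assms(1)
proof (induction rule: finite_length_induct)
  case zero
  have "A <+>\<^bsub>M\<^esub> {\<zero>} = A"
    using submodD(1)[OF finite_length_submodule[OF assms(2)]] by (auto simp: mem_set_add subset_iff)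
  then show ?case using assms(2) by simp
next
  case (cover B B')
  note A = finite_length_submodule[OF assms(2)]
  from cover have B: "submodule B R M" and B': "submodule B' R M" and BB': "B \<subset> B'"
    and max: "\<And>A. submodule A R M \<Longrightarrow> B \<subseteq> A \<Longrightarrow> A \<subseteq> B' \<Longrightarrow> A = B \<or> A = B'"
    by (auto simp: submodule_cover_def)
  have le: "A <+>\<^bsub>M\<^esub> B \<subseteq> A <+>\<^bsub>M\<^esub> B'" using BB' by (fastforce simp: mem_set_add)
  have mx: "L = A <+>\<^bsub>M\<^esub> B \<or> L = A <+>\<^bsub>M\<^esub> B'"
    if L: "submodule L R M" "A <+>\<^bsub>M\<^esub> B \<subseteq> L" "L \<subseteq> A <+>\<^bsub>M\<^esub> B'" for L
  proof -
    have AL: "A \<subseteq> L" "B \<subseteq> L" using set_add_upper[OF A B] L(2) by auto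
    have "L = L \<inter> (A <+>\<^bsub>M\<^esub> B')" using L by auto
    also have "\<dots> = A <+>\<^bsub>M\<^esub> (L \<inter> B')" by (rule modular_law[OF A B' L(1) AL(1)])
    finally have "L = A <+>\<^bsub>M\<^esub> (L \<inter> B')" .
    moreover have "L \<inter> B' = B \<or> L \<inter> B' = B'"
      by (rule max) (use AL BB' submodule_Int[OF L(1) B'] in auto)
    ultimately show ?thesis by auto
  qed
  show ?case
  proof (cases "A <+>\<^bsub>M\<^esub> B = A <+>\<^bsub>M\<^esub> B'")
    case False
    then have "submodule_cover R M (A <+>\<^bsub>M\<^esub> B) (A <+>\<^bsub>M\<^esub> B')"
      using mx le submodule_set_add[OF A B] submodule_set_add[OF A B']
      by (auto simp: submodule_cover_def)
    then show ?thesis using finite_length_cover cover by blast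
  qed (use cover in simp)
qed

section \<open>Cyclic submodules, spans and maximal submodules\<close>

lemma submodule_cyclic:
  assumes "x \<in> carrier M"
  shows "submodule ((\<lambda>c. c \<odot> x) ` carrier R) R M"
proof (rule submodI)
  show "\<zero> \<in> (\<lambda>c. c \<odot> x) ` carrier R"
    using assms by (intro image_eqI[of _ _ "\<zero>\<^bsub>R\<^esub>"]) auto
  fix u v assume "u \<in> (\<lambda>c. c \<odot> x) ` carrier R" "v \<in> (\<lambda>c. c \<odot> x) ` carrier R"
  then obtain a b where "a \<in> carrier R" "u = a \<odot> x" "b \<in> carrier R" "v = b \<odot> x" by auto
  then show "u \<oplus> v \<in> (\<lambda>c. c \<odot> x) ` carrier R"
    using assms by (intro image_eqI[of _ _ "a \<oplus>\<^bsub>R\<^esub> b"]) (auto simp: smult_l_distr)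
next
  fix c u assume c: "c \<in> carrier R" "u \<in> (\<lambda>c. c \<odot> x) ` carrier R"
  then obtain a where "a \<in> carrier R" "u = a \<odot> x" by auto
  then show "c \<odot> u \<in> (\<lambda>c. c \<odot> x) ` carrier R"
    using assms c by (intro image_eqI[of _ _ "c \<otimes>\<^bsub>R\<^esub> a"]) (auto simp: smult_assoc)
qed (use assms in auto)

lemma cyclic_self: "x \<in> carrier M \<Longrightarrow> x \<in> (\<lambda>c. c \<odot> x) ` carrier R"
  by (intro image_eqI[of _ _ "\<one>\<^bsub>R\<^esub>"]) auto

lemma cyclic_least: "submodule L R M \<Longrightarrow> x \<in> L \<Longrightarrow> (\<lambda>c. c \<odot> x) ` carrier R \<subseteq> L"
  by (simp add: image_subset_iff submodD(4))

text \<open>The simple quotient N'/N is generated by any nonzero class. Elements of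
  \<open>N'\<close> thus have the form n + c w, the description from which functionals on
  \<open>N'\<close> are built.\<close>

lemma cover_generated:
  assumes "submodule_cover R M N N'" "w \<in> N'" "w \<notin> N"
  shows "N' = N <+>\<^bsub>M\<^esub> (\<lambda>c. c \<odot> w) ` carrier R"
proof -
  from assms(1) have N: "submodule N R M" and N': "submodule N' R M" and NN': "N \<subset> N'"
    and max: "\<And>A. submodule A R M \<Longrightarrow> N \<subseteq> A \<Longrightarrow> A \<subseteq> N' \<Longrightarrow> A = N \<or> A = N'"
    by (auto simp: submodule_cover_def)
  have w: "w \<in> carrier M" using assms(2) submodD(1)[OF N'] by auto
  note W = submodule_cyclic[OF w]
  have "N <+>\<^bsub>M\<^esub> (\<lambda>c. c \<odot> w) ` carrier R = N \<or> N <+>\<^bsub>M\<^esub> (\<lambda>c. c \<odot> w) ` carrier R = N'"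
    by (rule max)
      (use submodule_set_add[OF N W] set_add_upper[OF N W]
        set_add_least[OF N' _ cyclic_least[OF N' assms(2)], of N] NN' in auto)
  then show ?thesis using cyclic_self[OF w] set_add_upper(2)[OF N W] assms(3) by auto
qed

lemma submodule_span:
  assumes "S \<subseteq> carrier M"
  shows "submodule (module_span R M S) R M"
proof (rule submodI)
  show "module_span R M S \<subseteq> carrier M"
    using submodule_carrier assms by (auto simp: module_span_def)
qed (use submodD in \<open>auto simp: module_span_def\<close>)

lemma span_superset: "S \<subseteq> module_span R M S"
  by (auto simp: module_span_def)

lemma span_least: "submodule L R M \<Longrightarrow> S \<subseteq> L \<Longrightarrow> module_span R M S \<subseteq> L"
  by (auto simp: module_span_def)

lemma finite_length_fg:
  assumes "finite_length R M N"
  shows "\<exists>S. finite S \<and> S \<subseteq> N \<and> module_span R M S = N"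
  using assms
proof (induction rule: finite_length_induct)
  case zero
  have "module_span R M {} \<subseteq> {\<zero>}" by (rule span_least[OF submodule_zero]) auto
  then have "module_span R M {} = {\<zero>}" using submodD(2)[OF submodule_span[of "{}"]] by auto
  then show ?case by auto
next
  case (cover N N')
  then obtain S where S: "finite S" "S \<subseteq> N" "module_span R M S = N" by auto
  from cover obtain w where w: "w \<in> N'" "w \<notin> N" by (auto simp: submodule_cover_def)
  from cover have N': "submodule N' R M" "N \<subset> N'" by (auto simp: submodule_cover_def)
  have sub: "insert w S \<subseteq> carrier M" using submodD(1)[OF N'(1)] w S(2) N'(2) by auto
  note sp = submodule_span[OF sub]
  have "N' = N <+>\<^bsub>M\<^esub> (\<lambda>c. c \<odot> w) ` carrier R" by (rule cover_generated[OF cover(2) w])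
  also have "\<dots> \<subseteq> module_span R M (insert w S)"
  proof (rule set_add_least[OF sp])
    show "N \<subseteq> module_span R M (insert w S)"
      using span_least[OF sp, of S] span_superset[of "insert w S"] S(3) by auto
    show "(\<lambda>c. c \<odot> w) ` carrier R \<subseteq> module_span R M (insert w S)"
      by (rule cyclic_least[OF sp]) (use span_superset[of "insert w S"] in auto)
  qed
  finally have "module_span R M (insert w S) = N'"
    using span_least[OF N'(1), of "insert w S"] w S(2) N'(2) by auto
  then show ?case using S w N' by (intro exI[of _ "insert w S"]) auto
qed

lemma finite_length_span:
  assumes "finite S" "S \<subseteq> carrier M"
    and "\<And>x. x \<in> S \<Longrightarrow> finite_length R M ((\<lambda>c. c \<odot> x) ` carrier R)"
  shows "finite_length R M (module_span R M S)"
proof -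
  have "\<exists>N. S \<subseteq> N \<and> finite_length R M N"
    using assms
  proof (induction S rule: finite_induct)
    case (insert x S)
    then obtain N where N: "S \<subseteq> N" "finite_length R M N" by auto
    let ?X = "(\<lambda>c. c \<odot> x) ` carrier R"
    have X: "finite_length R M ?X" using insert by auto
    have "finite_length R M (?X <+>\<^bsub>M\<^esub> N)" by (rule finite_length_set_add[OF N(2) X])
    moreover have "insert x S \<subseteq> ?X <+>\<^bsub>M\<^esub> N"
      using set_add_upper[OF finite_length_submodule[OF X] finite_length_submodule[OF N(2)]]
        N(1) cyclic_self[of x] insert by auto
    ultimately show ?case by blast
  qed (use finite_length_zero in blast)
  then obtain N where "S \<subseteq> N" "finite_length R M N" by auto
  then show ?thesis
    using finite_length_mono submodule_span[OF assms(2)] span_least finite_length_submodule by metis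
qed

text \<open>Zorn's lemma. No chain condition is imposed on \<open>N\<close>, so this applies to the
  ideal of infinite length in \<open>artinian_finite_length\<close>. There and in
  \<open>socle_projection\<close>, \<open>H\<close> becomes a complement of a simple submodule that
  contains \<open>x\<close>.\<close>

lemma ex_maximal_avoiding:
  assumes "submodule N R M" "x \<noteq> \<zero>"
  shows "\<exists>H. submodule H R M \<and> H \<subseteq> N \<and> x \<notin> H \<and>
           (\<forall>L. submodule L R M \<and> H \<subseteq> L \<and> L \<subseteq> N \<and> x \<notin> L \<longrightarrow> L = H)"
proof -
  let ?F = "{L. submodule L R M \<and> L \<subseteq> N \<and> x \<notin> L}"
  have "\<exists>H\<in>?F. \<forall>L\<in>?F. H \<subseteq> L \<longrightarrow> L = H"
  proof (rule subset_Zorn_nonempty)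
    show "?F \<noteq> {}" using submodule_zero submodD(2)[OF assms(1)] assms(2) by blast
    fix C assume C: "C \<noteq> {}" "subset.chain ?F C"
    then have CF: "C \<subseteq> ?F" and lin: "\<And>A B. A \<in> C \<Longrightarrow> B \<in> C \<Longrightarrow> A \<subseteq> B \<or> B \<subseteq> A"
      by (auto simp: subset_chain_def)
    have "submodule (\<Union>C) R M"
    proof (rule submodI)
      show "\<Union>C \<subseteq> carrier M" using CF submodD(1) by blast
      show "\<zero> \<in> \<Union>C" using CF C(1) submodD(2) by blast
      fix u v assume "u \<in> \<Union>C" "v \<in> \<Union>C"
      then obtain A B where *: "A \<in> C" "u \<in> A" "B \<in> C" "v \<in> B" by auto
      with lin[of A B] obtain D where "D \<in> C" "u \<in> D" "v \<in> D" by blast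
      then show "u \<oplus> v \<in> \<Union>C" using CF submodD(3) by blast
    next
      fix a u assume "a \<in> carrier R" "u \<in> \<Union>C"
      then show "a \<odot> u \<in> \<Union>C" using CF submodD(4) by blast
    qed
    then show "\<Union>C \<in> ?F" using CF by auto
  qed
  then obtain H where H: "H \<in> ?F" and max: "\<And>L. L \<in> ?F \<Longrightarrow> H \<subseteq> L \<Longrightarrow> L = H" by auto
  show ?thesis
    by (rule exI[of _ H]) (use H max in simp)
qed

end


section \<open>Homomorphisms and finite length\<close>

lemma submod_simps [simp]:
  "carrier (submod M N) = N" "\<zero>\<^bsub>submod M N\<^esub> = \<zero>\<^bsub>M\<^esub>" "x \<oplus>\<^bsub>submod M N\<^esub> y = x \<oplus>\<^bsub>M\<^esub> y"
  "a \<odot>\<^bsub>submod M N\<^esub> x = a \<odot>\<^bsub>M\<^esub> x"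
  by (simp_all add: submod_def)

lemma direct_sum_simps [simp]:
  "carrier (direct_sum M N) = carrier M \<times> carrier N" "\<zero>\<^bsub>direct_sum M N\<^esub> = (\<zero>\<^bsub>M\<^esub>, \<zero>\<^bsub>N\<^esub>)"
  "(x, y) \<oplus>\<^bsub>direct_sum M N\<^esub> (x', y') = (x \<oplus>\<^bsub>M\<^esub> x', y \<oplus>\<^bsub>N\<^esub> y')"
  "a \<odot>\<^bsub>direct_sum M N\<^esub> (x, y) = (a \<odot>\<^bsub>M\<^esub> x, a \<odot>\<^bsub>N\<^esub> y)"
  by (simp_all add: direct_sum_def)

lemma mod_hom_submod: "h \<in> mod_hom R M N \<Longrightarrow> A \<subseteq> carrier M \<Longrightarrow> h \<in> mod_hom R (submod M A) N"
  by (rule mod_homI) (auto simp: mod_homD subset_iff)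

lemma mod_hom_into_submod:
  "h \<in> mod_hom R M N \<Longrightarrow> (\<And>x. x \<in> carrier M \<Longrightarrow> h x \<in> B) \<Longrightarrow> h \<in> mod_hom R M (submod N B)"
  by (rule mod_homI) (auto simp: mod_homD)

lemma mod_hom_compose:
  "g \<in> mod_hom R M N \<Longrightarrow> h \<in> mod_hom R N L \<Longrightarrow> (\<lambda>x. h (g x)) \<in> mod_hom R M L"
  by (rule mod_homI) (auto simp: mod_homD)

lemma submodule_image_of:
  assumes "left_module R M" "left_module R N" "h \<in> mod_hom R M N" "submodule A R M"
  shows "submodule (h ` A) R N"
proof -
  interpret M: left_module R M by fact
  have "h \<in> mod_hom R (submod M A) N"
    by (rule mod_hom_submod[OF assms(3) M.submodD(1)[OF assms(4)]])
  from submodule_image[OF M.left_module_submod[OF assms(4)] assms(2) this] show ?thesis by simp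
qed

lemma mod_hom_minus:
  assumes "left_module R M" "left_module R N" "h \<in> mod_hom R M N" "x \<in> carrier M" "y \<in> carrier M"
  shows "h (x \<ominus>\<^bsub>M\<^esub> y) = h x \<ominus>\<^bsub>N\<^esub> h y"
proof -
  interpret M: left_module R M by fact
  interpret N: left_module R N by fact
  note h = mod_homD[OF assms(3)]
  have "h (\<ominus>\<^bsub>M\<^esub> y) \<oplus>\<^bsub>N\<^esub> h y = \<zero>\<^bsub>N\<^esub>"
    using h(2)[of "\<ominus>\<^bsub>M\<^esub> y" y] assms(5) mod_hom_zero[OF assms(1-3)] by (simp add: M.M.l_neg)
  then have "h (\<ominus>\<^bsub>M\<^esub> y) = \<ominus>\<^bsub>N\<^esub> h y"
    using N.M.minus_equality[of "h (\<ominus>\<^bsub>M\<^esub> y)" "h y"] h(1) assms(5) by simp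
  then show ?thesis using h(2)[of x "\<ominus>\<^bsub>M\<^esub> y"] assms(4,5) by (simp add: a_minus_def)
qed

text \<open>A submodule between h A and h A' is the image of its preimage in \<open>A'\<close>, and
  that preimage lies between \<open>A\<close> and \<open>A'\<close>. So each step of the series
  stays a cover or collapses.\<close>

lemma finite_length_image:
  assumes "left_module R M" "left_module R N" "h \<in> mod_hom R M N" "finite_length R M A"
  shows "finite_length R N (h ` A)"
  using assms(4)
proof (induction rule: finite_length_induct)
  case zero
  show ?case using mod_hom_zero[OF assms(1-3)] by simp
next
  case (cover A A')
  interpret M: left_module R M by fact
  interpret N: left_module R N by fact
  from cover have A: "submodule A R M" and A': "submodule A' R M" and AA': "A \<subset> A'"
    and max: "\<And>L. submodule L R M \<Longrightarrow> A \<subseteq> L \<Longrightarrow> L \<subseteq> A' \<Longrightarrow> L = A \<or> L = A'"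
    by (auto simp: submodule_cover_def)
  note sub = submodule_image_of[OF assms(1-3)]
  have mx: "L = h ` A \<or> L = h ` A'"
    if L: "submodule L R N" "h ` A \<subseteq> L" "L \<subseteq> h ` A'" for L
  proof -
    let ?L = "A' \<inter> {x \<in> carrier M. h x \<in> L}"
    have "?L = A \<or> ?L = A'"
      by (rule max) (use M.submodule_Int[OF A' submodule_vimage[OF assms(1-3) L(1)]] L(2) AA'
          M.submodD(1)[OF A'] in auto)
    then have "h ` ?L = h ` A \<or> h ` ?L = h ` A'" by (elim disjE) simp_all
    moreover have "h ` ?L = L" using L(3) M.submodD(1)[OF A'] by blast
    ultimately show ?thesis by (simp only:)
  qed
  show ?case
  proof (cases "h ` A = h ` A'")
    case False
    then have "submodule_cover R N (h ` A) (h ` A')"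
      using mx sub[OF A] sub[OF A'] AA' by (auto simp: submodule_cover_def)
    then show ?thesis using finite_length_cover cover by blast
  qed (use cover in simp)
qed

text \<open>The series of h A is pulled back along \<open>h\<close>. It starts with the kernel of
  \<open>h\<close> on \<open>A\<close>, of finite length by assumption, and each cover pulls back to
  a cover or an equality.\<close>

lemma finite_length_extension:
  assumes "left_module R M" "left_module R N" "h \<in> mod_hom R M N" "submodule A R M"
    and "finite_length R N (h ` A)" "finite_length R M {x \<in> A. h x = \<zero>\<^bsub>N\<^esub>}"
  shows "finite_length R M A"
proof -
  interpret M: left_module R M by fact
  interpret N: left_module R N by fact
  note Ac = M.submodD(1)[OF assms(4)]
  note h = mod_homD[OF assms(3)]
  have vim: "submodule {x \<in> A. h x \<in> B} R M" if "submodule B R N" for B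
  proof -
    have "{x \<in> A. h x \<in> B} = A \<inter> {x \<in> carrier M. h x \<in> B}" using Ac by auto
    then show ?thesis using M.submodule_Int[OF assms(4) submodule_vimage[OF assms(1-3) that]] by simp
  qed
  \<comment> \<open>The side condition is carried through the induction so that every element of
    \<open>B\<close> has a preimage in \<open>A\<close>; it is what makes \<open>B\<close> the image
    of its own preimage.\<close>
  have "B \<subseteq> h ` A \<Longrightarrow> finite_length R M {x \<in> A. h x \<in> B}" if "finite_length R N B" for B
    using that
  proof (induction rule: finite_length_induct)
    case zero
    show ?case using assms(6) by simp
  next
    case (cover B B')
    from cover have B: "submodule B R N" and B': "submodule B' R N" and BB': "B \<subset> B'"
      and max: "\<And>L. submodule L R N \<Longrightarrow> B \<subseteq> L \<Longrightarrow> L \<subseteq> B' \<Longrightarrow> L = B \<or> L = B'"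
      by (auto simp: submodule_cover_def)
    let ?B = "{x \<in> A. h x \<in> B}" let ?B' = "{x \<in> A. h x \<in> B'}"
    have mx: "L = ?B \<or> L = ?B'" if L: "submodule L R M" "?B \<subseteq> L" "L \<subseteq> ?B'" for L
    proof -
      have "h ` L = B \<or> h ` L = B'"
      proof (rule max)
        show "B \<subseteq> h ` L"
        proof
          fix b assume b: "b \<in> B"
          then obtain a where "a \<in> A" "b = h a" using cover.prems BB' by auto
          then show "b \<in> h ` L" using L(2) b by auto
        qed
      qed (use submodule_image_of[OF assms(1-3) L(1)] L(3) in auto)
      then show ?thesis
      proof
        assume "h ` L = B"
        then show ?thesis using L by auto
      next
        assume *: "h ` L = B'"
        have "x \<in> L" if x: "x \<in> A" "h x \<in> B'" for x
        proof -
          from * x obtain l where l: "l \<in> L" "h x = h l" by auto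
          then have lA: "l \<in> A" using L(3) by auto
          then have c: "x \<in> carrier M" "l \<in> carrier M" using x Ac by auto
          have "h (x \<ominus>\<^bsub>M\<^esub> l) = \<zero>\<^bsub>N\<^esub>"
            using mod_hom_minus[OF assms(1-3) c] l h(1) c by (simp add: a_minus_def N.M.r_neg)
          then have "x \<ominus>\<^bsub>M\<^esub> l \<in> ?B"
            using M.minus_closed[OF assms(4) x(1) lA] N.submodD(2)[OF B] by auto
          then have "(x \<ominus>\<^bsub>M\<^esub> l) \<oplus>\<^bsub>M\<^esub> l \<in> L" using L(2) l(1) M.submodD(3)[OF L(1)] by auto
          then show ?thesis using c by (simp add: a_minus_def M.M.a_assoc M.M.l_neg)
        qed
        then show ?thesis using L(3) by auto
      qed
    qed
    show ?case
    proof (cases "?B = ?B'")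
      case False
      then have "submodule_cover R M ?B ?B'"
        using mx vim[OF B] vim[OF B'] BB' by (auto simp: submodule_cover_def)
      then show ?thesis using finite_length_cover cover BB' by blast
    next
      case True
      then show ?thesis using cover.IH cover.prems BB' by auto
    qed
  qed
  from this[OF assms(5)] show ?thesis by (simp cong: conj_cong)
qed

lemma finite_length_inj:
  assumes "left_module R M" "left_module R N" "h \<in> mod_hom R M N" "inj_on h (carrier M)"
    and "finite_length R N (carrier N)"
  shows "finite_length R M (carrier M)"
proof (rule finite_length_extension[OF assms(1-3)])
  interpret M: left_module R M by fact
  interpret N: left_module R N by fact
  show "submodule (carrier M) R M" by (rule M.submodule_carrier)
  show "finite_length R N (h ` carrier M)"
    by (rule N.finite_length_mono[OF assms(5) submodule_image[OF assms(1-3)]])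
      (use mod_homD[OF assms(3)] in auto)
  have "{x \<in> carrier M. h x = \<zero>\<^bsub>N\<^esub>} = {\<zero>\<^bsub>M\<^esub>}"
  proof (intro equalityI subsetI)
    fix x assume "x \<in> {x \<in> carrier M. h x = \<zero>\<^bsub>N\<^esub>}"
    then have "h x = h \<zero>\<^bsub>M\<^esub>" "x \<in> carrier M" using mod_hom_zero[OF assms(1-3)] by auto
    then show "x \<in> {\<zero>\<^bsub>M\<^esub>}" using inj_onD[OF assms(4)] by simp
  qed (use mod_hom_zero[OF assms(1-3)] in simp)
  then show "finite_length R M {x \<in> carrier M. h x = \<zero>\<^bsub>N\<^esub>}" by simp
qed

text \<open>The inclusion of \<open>N\<close> has zero kernel and image \<open>N\<close>, so
  \<open>finite_length_extension\<close> changes the ambient module from \<open>M\<close> to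
  \<open>N\<close> itself.\<close>

lemma finite_length_submod:
  assumes "left_module R M" "finite_length R M N"
  shows "finite_length R (submod M N) N"
proof -
  interpret M: left_module R M by fact
  note N = M.finite_length_submodule[OF assms(2)]
  have id: "(\<lambda>x. x) \<in> mod_hom R (submod M N) M"
    by (rule mod_homI) (use M.submodD(1)[OF N] in auto)
  show ?thesis
    by (rule finite_length_extension[OF M.left_module_submod[OF N] assms(1) id
          left_module.submodule_carrier[OF M.left_module_submod[OF N], simplified]])
      (use assms(2) M.submodD(2)[OF N] finite_length_zero[of R "submod M N"] in
        \<open>auto simp: Collect_conv_if\<close>)
qed

lemma finite_length_direct_sum:
  assumes "left_module R M" "left_module R N"
    and "finite_length R M (carrier M)" "finite_length R N (carrier N)"
  shows "finite_length R (direct_sum M N) (carrier M \<times> carrier N)"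
proof -
  interpret M: left_module R M by fact
  interpret N: left_module R N by fact
  note S = left_module_direct_sum[OF assms(1,2)]
  have fst: "fst \<in> mod_hom R (direct_sum M N) M" by (rule mod_homI) auto
  have inr: "Pair \<zero>\<^bsub>M\<^esub> \<in> mod_hom R N (direct_sum M N)" by (rule mod_homI) auto
  have 1: "fst ` (carrier M \<times> carrier N) = carrier M" using N.M.zero_closed by auto
  have 2: "{x \<in> carrier M \<times> carrier N. fst x = \<zero>\<^bsub>M\<^esub>} = Pair \<zero>\<^bsub>M\<^esub> ` carrier N" by auto
  show ?thesis
    by (rule finite_length_extension[OF S assms(1) fst left_module.submodule_carrier[OF S, simplified]])
      (unfold 1 2, rule assms(3), rule finite_length_image[OF assms(2) S inr assms(4)])
qed

lemma finite_length_fg_module: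
  assumes "left_module R M" "finite_length R M (carrier M)"
  shows "fg_module R M"
  using left_module.finite_length_fg[OF assms] assms(1) by (auto simp: fg_module_def)

lemma fg_module_finite_length:
  assumes "fg_module R M" "finite_length R (regular_module R) (carrier R)"
  shows "finite_length R M (carrier M)"
proof -
  from assms(1) obtain S where M: "left_module R M"
    and S: "finite S" "S \<subseteq> carrier M" "module_span R M S = carrier M"
    by (auto simp: fg_module_def)
  interpret left_module R M by fact
  have "finite_length R M ((\<lambda>c. c \<odot>\<^bsub>M\<^esub> x) ` carrier R)" if "x \<in> carrier M" for x
  proof (rule finite_length_image[OF left_module_regular_module M _ assms(2)])
    show "(\<lambda>c. c \<odot>\<^bsub>M\<^esub> x) \<in> mod_hom R (regular_module R) M"
      by (rule mod_homI) (use that in \<open>auto simp: smult_l_distr smult_assoc\<close>)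
  qed (rule R.ring_axioms)
  then have "finite_length R M (module_span R M S)"
    by (intro finite_length_span) (use S in auto)
  then show ?thesis using S by simp
qed

section \<open>Artinian commutative rings\<close>

lemma ideal_of_submodule_regular:
  assumes "cring k" "submodule I k (regular_module k)"
  shows "ideal I k"
proof -
  interpret cring k by fact
  interpret V: left_module k "regular_module k" by (rule left_module_regular_module) (rule ring_axioms)
  note I = V.submodD[OF assms(2), simplified]
  have m: "\<ominus>\<^bsub>k\<^esub> x \<in> I" if "x \<in> I" for x
    using I(4)[of "\<ominus>\<^bsub>k\<^esub> \<one>\<^bsub>k\<^esub>" x] that I(1) by (auto simp: l_minus subset_iff)
  show ?thesis
  proof (rule idealI[OF ring_axioms])
    show "subgroup I (add_monoid k)"
      by (rule add.subgroupI) (use I m in \<open>auto simp: a_inv_def\<close>)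
    fix a x assume "a \<in> I" "x \<in> carrier k"
    then show "x \<otimes>\<^bsub>k\<^esub> a \<in> I" "a \<otimes>\<^bsub>k\<^esub> x \<in> I" using I(1,4) m_comm[of a x] by auto
  qed
qed

lemma submodule_regular_of_ideal:
  assumes "cring k" "ideal I k"
  shows "submodule I k (regular_module k)"
proof -
  interpret cring k by fact
  interpret V: left_module k "regular_module k" by (rule left_module_regular_module) (rule ring_axioms)
  interpret ideal I k by fact
  show ?thesis
    by (rule V.submodI) (use a_subset in \<open>auto simp: I_l_closed\<close>)
qed

text \<open>Dependent choice turns the descending chain condition into the minimum condition. It is
  applied to three families: the ideals of infinite length, certain principal ideals, and the ideals
  not contained in a given maximal ideal.\<close>

lemma artinian_minimal:
  assumes "artinian_cring k" "I0 \<in> F" "\<And>I. I \<in> F \<Longrightarrow> submodule I k (regular_module k)"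
  shows "\<exists>I\<in>F. \<forall>L\<in>F. L \<subseteq> I \<longrightarrow> L = I"
proof (rule ccontr)
  assume "\<not> ?thesis"
  then have "\<exists>L. L \<in> F \<and> L \<subset> I" if "I \<in> F" for I using that by blast
  then have "\<exists>s. \<forall>n. s n \<in> F \<and> s (Suc n) \<subset> s n"
    using assms(2) by (intro dependent_nat_choice) auto
  then obtain s where "\<forall>n. s n \<in> F \<and> s (Suc n) \<subset> s n" ..
  then have s: "s n \<in> F" "s (Suc n) \<subset> s n" for n by auto
  have "ideal (s n) k" for n
    using ideal_of_submodule_regular[OF _ assms(3)[OF s(1)]] assms(1)
    by (simp add: artinian_cring_def)
  moreover have "s (Suc n) \<subseteq> s n" for n using s(2) by auto
  ultimately have "\<exists>n. \<forall>m\<ge>n. s m = s n"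
    using assms(1) by (simp add: artinian_cring_def)
  then obtain n where "\<forall>m\<ge>n. s m = s n" ..
  then have "s (Suc n) = s n" by (rule allE[of _ "Suc n"]) (erule mp, simp)
  moreover have "s (Suc n) \<subset> s n" by (rule s(2))
  ultimately show False by simp
qed

text \<open>
  A scalar acts on a minimal ideal \<open>I\<close> of infinite length either as zero or bijectively, since otherwise
  its kernel and its image would be of finite length.  So every nonzero element of \<open>I\<close> generates a simple
  ideal, and \<open>I\<close> is the sum of such an ideal and of a proper subideal, which has finite length.
\<close>

lemma artinian_finite_length:
  assumes "artinian_cring k"
  shows "finite_length k (regular_module k) (carrier k)"
proof (rule ccontr)
  assume bad: "\<not> ?thesis"
  interpret k: cring k using assms by (simp add: artinian_cring_def)
  let ?V = "regular_module k"
  have lm: "left_module k ?V" by (rule left_module_regular_module) (rule k.ring_axioms)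
  interpret V: left_module k ?V by (rule lm)
  let ?F = "{I. submodule I k ?V \<and> \<not> finite_length k ?V I}"
  have "carrier k \<in> ?F" using V.submodule_carrier bad by simp
  from artinian_minimal[OF assms this] obtain I where I: "submodule I k ?V" "\<not> finite_length k ?V I"
    and "\<And>L. L \<in> ?F \<Longrightarrow> L \<subseteq> I \<Longrightarrow> L = I" by auto
  then have min: "finite_length k ?V L" if "submodule L k ?V" "L \<subset> I" for L using that by blast
  note Id = V.submodD[OF I(1), simplified]
  have mul: "(\<lambda>x. a \<otimes>\<^bsub>k\<^esub> x) \<in> mod_hom k ?V ?V" if "a \<in> carrier k" for a
    by (rule mod_homI) (use that in \<open>auto simp: k.r_distr k.m_lcomm\<close>)
  have dich: "(\<lambda>x. a \<otimes>\<^bsub>k\<^esub> x) ` I = I" if a: "a \<in> carrier k" and nz: "x \<in> I" "a \<otimes>\<^bsub>k\<^esub> x \<noteq> \<zero>\<^bsub>k\<^esub>" for a x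
  proof (rule ccontr)
    assume "(\<lambda>x. a \<otimes>\<^bsub>k\<^esub> x) ` I \<noteq> I"
    then have 1: "finite_length k ?V ((\<lambda>x. a \<otimes>\<^bsub>k\<^esub> x) ` I)"
      by (intro min submodule_image_of[OF lm lm mul[OF a] I(1)]) (use Id(4) a in auto)
    have "{x \<in> I. a \<otimes>\<^bsub>k\<^esub> x = \<zero>\<^bsub>k\<^esub>} = I \<inter> {x \<in> carrier ?V. a \<otimes>\<^bsub>k\<^esub> x \<in> {\<zero>\<^bsub>k\<^esub>}}" using Id(1) by auto
    also have "submodule \<dots> k ?V"
      by (rule V.submodule_Int[OF I(1) submodule_vimage[OF lm lm mul[OF a]]])
        (use V.submodule_zero in simp)
    finally have 2: "finite_length k ?V {x \<in> I. a \<otimes>\<^bsub>k\<^esub> x = \<zero>\<^bsub>k\<^esub>}"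
      using nz by (intro min) auto
    show False using finite_length_extension[OF lm lm mul[OF a] I(1) 1] 2 I(2) by simp
  qed
  \<comment> \<open>\<open>dich\<close> only gives a I = I. The inverse scalar comes from a
    principal ideal kb that is minimal among those with b I = I: as a b I = I too, kab = kb, so b =
    d a b for some \<open>d\<close>, and d a fixes every element of b I = I.\<close>
  have invert: "\<exists>d\<in>carrier k. \<forall>z\<in>I. d \<otimes>\<^bsub>k\<^esub> (a \<otimes>\<^bsub>k\<^esub> z) = z"
    if a: "a \<in> carrier k" and nz: "x \<in> I" "a \<otimes>\<^bsub>k\<^esub> x \<noteq> \<zero>\<^bsub>k\<^esub>" for a x
  proof -
    let ?G = "{(\<lambda>c. c \<otimes>\<^bsub>k\<^esub> b) ` carrier k | b. b \<in> carrier k \<and> (\<lambda>x. b \<otimes>\<^bsub>k\<^esub> x) ` I = I}"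
    have aI: "(\<lambda>x. a \<otimes>\<^bsub>k\<^esub> x) ` I = I" using dich[OF a nz] .
    then have "(\<lambda>c. c \<otimes>\<^bsub>k\<^esub> a) ` carrier k \<in> ?G" using a by blast
    moreover have "submodule L k ?V" if "L \<in> ?G" for L
      using that V.submodule_cyclic by auto
    ultimately have "\<exists>B\<in>?G. \<forall>L\<in>?G. L \<subseteq> B \<longrightarrow> L = B"
      by (rule artinian_minimal[OF assms])
    then obtain B where B: "B \<in> ?G" and Bmin: "\<And>L. L \<in> ?G \<Longrightarrow> L \<subseteq> B \<Longrightarrow> L = B"
      by (elim bexE) (rule that, assumption, drule bspec, assumption, erule mp)
    from B obtain b where b: "b \<in> carrier k" "(\<lambda>x. b \<otimes>\<^bsub>k\<^esub> x) ` I = I"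
      and Bb: "B = (\<lambda>c. c \<otimes>\<^bsub>k\<^esub> b) ` carrier k"
      by auto
    note bmin = Bmin[unfolded Bb]
    have "(\<lambda>c. c \<otimes>\<^bsub>k\<^esub> (a \<otimes>\<^bsub>k\<^esub> b)) ` carrier k = (\<lambda>c. c \<otimes>\<^bsub>k\<^esub> b) ` carrier k"
    proof (rule bmin)
      have "(\<lambda>x. (a \<otimes>\<^bsub>k\<^esub> b) \<otimes>\<^bsub>k\<^esub> x) ` I = (\<lambda>x. a \<otimes>\<^bsub>k\<^esub> x) ` ((\<lambda>x. b \<otimes>\<^bsub>k\<^esub> x) ` I)"
        unfolding image_image using Id(1) a b(1) by (intro image_cong) (auto simp: k.m_assoc subset_iff)
      then have "(\<lambda>x. (a \<otimes>\<^bsub>k\<^esub> b) \<otimes>\<^bsub>k\<^esub> x) ` I = I" using aI b(2) by simp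
      then show "(\<lambda>c. c \<otimes>\<^bsub>k\<^esub> (a \<otimes>\<^bsub>k\<^esub> b)) ` carrier k \<in> ?G" using a b(1) by blast
      show "(\<lambda>c. c \<otimes>\<^bsub>k\<^esub> (a \<otimes>\<^bsub>k\<^esub> b)) ` carrier k \<subseteq> (\<lambda>c. c \<otimes>\<^bsub>k\<^esub> b) ` carrier k"
        using a b(1) by (auto simp flip: k.m_assoc)
    qed
    moreover have "b \<in> (\<lambda>c. c \<otimes>\<^bsub>k\<^esub> b) ` carrier k" using V.cyclic_self[of b] b(1) by simp
    ultimately obtain d where d: "d \<in> carrier k" "b = d \<otimes>\<^bsub>k\<^esub> (a \<otimes>\<^bsub>k\<^esub> b)" by blast
    have "d \<otimes>\<^bsub>k\<^esub> (a \<otimes>\<^bsub>k\<^esub> z) = z" if "z \<in> I" for z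
    proof -
      from that b(2) obtain y where y: "y \<in> I" "z = b \<otimes>\<^bsub>k\<^esub> y" by auto
      then have "y \<in> carrier k" using Id(1) by auto
      then have "d \<otimes>\<^bsub>k\<^esub> (a \<otimes>\<^bsub>k\<^esub> z) = (d \<otimes>\<^bsub>k\<^esub> (a \<otimes>\<^bsub>k\<^esub> b)) \<otimes>\<^bsub>k\<^esub> y"
        using y a b(1) d(1) by (simp add: k.m_assoc)
      then show ?thesis using y(2) d(2) by simp
    qed
    then show ?thesis using d(1) by blast
  qed
  have "I \<noteq> {\<zero>\<^bsub>k\<^esub>}" using I(2) finite_length_zero[of k ?V] by auto
  then obtain x where x: "x \<in> I" "x \<noteq> \<zero>\<^bsub>k\<^esub>" using Id(2) by auto
  then have xc: "x \<in> carrier k" using Id(1) by auto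
  obtain H where H: "submodule H k ?V" "H \<subseteq> I" "x \<notin> H"
    and Hmax: "\<And>L. submodule L k ?V \<Longrightarrow> H \<subseteq> L \<Longrightarrow> L \<subseteq> I \<Longrightarrow> x \<notin> L \<Longrightarrow> L = H"
    using V.ex_maximal_avoiding[OF I(1), of x] x(2) by auto
  note Hd = V.submodD[OF H(1), simplified]
  let ?X = "(\<lambda>c. c \<odot>\<^bsub>?V\<^esub> x) ` carrier k"
  have X: "submodule ?X k ?V" using V.submodule_cyclic[of x] xc by simp
  have "submodule_cover k ?V {\<zero>\<^bsub>?V\<^esub>} ?X"
  proof -
    have "L = {\<zero>\<^bsub>k\<^esub>} \<or> L = ?X" if L: "submodule L k ?V" "L \<subseteq> ?X" for L
    proof (cases "L = {\<zero>\<^bsub>k\<^esub>}")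
      case False
      then obtain l where l: "l \<in> L" "l \<noteq> \<zero>\<^bsub>k\<^esub>" using V.submodD(2)[OF L(1)] by auto
      then obtain c where c: "c \<in> carrier k" "l = c \<otimes>\<^bsub>k\<^esub> x" using L(2) by auto
      obtain d where "d \<in> carrier k" "d \<otimes>\<^bsub>k\<^esub> (c \<otimes>\<^bsub>k\<^esub> x) = x"
        using invert[OF c(1) x(1)] l(2) c(2) x(1) by auto
      then have "x \<in> L" using V.submodD(4)[OF L(1), of d l] l(1) c(2) by simp
      then show ?thesis using V.cyclic_least[OF L(1)] L(2) by auto
    qed auto
    moreover have "{\<zero>\<^bsub>k\<^esub>} \<noteq> ?X" using V.cyclic_self[of x] x(2) xc by auto
    moreover have "\<zero>\<^bsub>k\<^esub> \<in> ?X" using V.submodD(2)[OF X] by simp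
    ultimately show ?thesis using X V.submodule_zero by (auto simp: submodule_cover_def)
  qed
  then have "finite_length k ?V ?X" using finite_length_cover finite_length_zero by blast
  moreover have "finite_length k ?V H" using min[OF H(1)] H(2,3) x(1) by auto
  ultimately have fin: "finite_length k ?V (H <+>\<^bsub>?V\<^esub> ?X)" by (rule V.finite_length_set_add)
  have "y \<in> H <+>\<^bsub>?V\<^esub> ?X" if y: "y \<in> I" for y
  proof (cases "y \<in> H")
    case True
    then show ?thesis using V.set_add_upper(1)[OF H(1) X] by auto
  next
    case False
    have yc: "y \<in> carrier k" using y Id(1) by auto
    let ?Y = "(\<lambda>c. c \<odot>\<^bsub>?V\<^esub> y) ` carrier k"
    have Y: "submodule ?Y k ?V" using V.submodule_cyclic[of y] yc by simp
    \<comment> \<open>Maximality of \<open>H\<close> forces x = h + c y. Since \<open>x\<close> is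
      outside \<open>H\<close>, c y is nonzero, so \<open>invert\<close> undoes \<open>c\<close> and
      the equation can be solved for \<open>y\<close>.\<close>
    have "x \<in> H <+>\<^bsub>?V\<^esub> ?Y"
    proof (rule ccontr)
      assume "x \<notin> H <+>\<^bsub>?V\<^esub> ?Y"
      then have "H <+>\<^bsub>?V\<^esub> ?Y = H"
        by (intro Hmax V.submodule_set_add[OF H(1) Y] V.set_add_upper(1)[OF H(1) Y]
            V.set_add_least[OF I(1) H(2)] V.cyclic_least[OF I(1) y])
      then show False using V.set_add_upper(2)[OF H(1) Y] V.cyclic_self[of y] yc False by auto
    qed
    then obtain h c where h: "h \<in> H" and c: "c \<in> carrier k" and xe: "x = h \<oplus>\<^bsub>k\<^esub> c \<otimes>\<^bsub>k\<^esub> y"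
      by (auto simp: V.mem_set_add)
    have hc: "h \<in> carrier k" using h Hd(1) by auto
    have "c \<otimes>\<^bsub>k\<^esub> y \<noteq> \<zero>\<^bsub>k\<^esub>" using xe h H(3) hc by auto
    then obtain d where d: "d \<in> carrier k" "d \<otimes>\<^bsub>k\<^esub> (c \<otimes>\<^bsub>k\<^esub> y) = y" using invert[OF c y] y by auto
    have "c \<otimes>\<^bsub>k\<^esub> y = \<ominus>\<^bsub>k\<^esub> h \<oplus>\<^bsub>k\<^esub> x" using xe hc c yc by (simp add: k.r_neg1)
    then have "y = d \<otimes>\<^bsub>k\<^esub> (\<ominus>\<^bsub>k\<^esub> h) \<oplus>\<^bsub>k\<^esub> d \<otimes>\<^bsub>k\<^esub> x"
      using d xc hc by (metis k.add.inv_closed k.r_distr)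
    moreover have "d \<otimes>\<^bsub>k\<^esub> (\<ominus>\<^bsub>k\<^esub> h) \<in> H"
      using Hd(4)[OF d(1), of "\<ominus>\<^bsub>k\<^esub> h"] Hd(4)[of "\<ominus>\<^bsub>k\<^esub> \<one>\<^bsub>k\<^esub>" h] h hc by (simp add: k.l_minus)
    moreover have "d \<otimes>\<^bsub>k\<^esub> x \<in> ?X" using d(1) by auto
    ultimately show ?thesis unfolding V.mem_set_add regular_module_simps(3) by blast
  qed
  then have "I = H <+>\<^bsub>?V\<^esub> ?X" using V.set_add_least[OF I(1) H(2) V.cyclic_least[OF I(1) x(1)]] by auto
  then show False using fin I(2) by simp
qed

section \<open>Factoring, extending and lifting homomorphisms\<close>

lemma (in left_module) minus_zero_iff:
  assumes "x \<in> carrier M" "y \<in> carrier M"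
  shows "x \<ominus> y = \<zero> \<longleftrightarrow> x = y"
proof
  assume "x \<ominus> y = \<zero>"
  then have "(x \<ominus> y) \<oplus> y = \<zero> \<oplus> y" by simp
  then show "x = y" using assms by (simp add: a_minus_def M.a_assoc M.l_neg)
qed (use assms in \<open>simp add: a_minus_def M.r_neg\<close>)

text \<open>Two preimages of an element differ by an element of the kernel of \<open>\<pi>\<close>,
  which \<open>g\<close> kills, so any choice of preimages defines \<open>h\<close>. This also
  yields maps out of sums such as N + k w or H + S, presented as images of direct sums.\<close>

lemma hom_factor_surj:
  assumes "left_module R M" "left_module R Q" "left_module R L"
    and "\<pi> \<in> mod_hom R M Q" "\<pi> ` carrier M = carrier Q" "g \<in> mod_hom R M L"
    and ker: "\<And>x. \<lbrakk> x \<in> carrier M; \<pi> x = \<zero>\<^bsub>Q\<^esub> \<rbrakk> \<Longrightarrow> g x = \<zero>\<^bsub>L\<^esub>"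
  shows "\<exists>h\<in>mod_hom R Q L. \<forall>x\<in>carrier M. h (\<pi> x) = g x"
proof -
  interpret M: left_module R M by fact
  interpret Q: left_module R Q by fact
  interpret L: left_module R L by fact
  note p = mod_homD[OF assms(4)] and g = mod_homD[OF assms(6)]
  have eq: "g x = g y" if "x \<in> carrier M" "y \<in> carrier M" "\<pi> x = \<pi> y" for x y
  proof -
    have "\<pi> (x \<ominus>\<^bsub>M\<^esub> y) = \<zero>\<^bsub>Q\<^esub>"
      using mod_hom_minus[OF assms(1,2,4) that(1,2)] that p(1) by (simp add: a_minus_def Q.M.r_neg)
    then have "g x \<ominus>\<^bsub>L\<^esub> g y = \<zero>\<^bsub>L\<^esub>"
      using mod_hom_minus[OF assms(1,3,6) that(1,2)] ker that by simp
    then show ?thesis using L.minus_zero_iff g(1) that by simp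
  qed
  define h where "h q = g (inv_into (carrier M) \<pi> q)" for q
  have h: "h (\<pi> x) = g x" if "x \<in> carrier M" for x
    unfolding h_def by (rule eq) (use that in \<open>auto intro: inv_into_into f_inv_into_f\<close>)
  have "h \<in> mod_hom R Q L"
  proof (rule mod_homI)
    fix x assume "x \<in> carrier Q"
    then obtain u where u: "u \<in> carrier M" "x = \<pi> u" using assms(5) by auto
    then show "h x \<in> carrier L" using h g(1) by simp
    fix a assume a: "a \<in> carrier R"
    show "h (a \<odot>\<^bsub>Q\<^esub> x) = a \<odot>\<^bsub>L\<^esub> h x"
      using u a h[of "a \<odot>\<^bsub>M\<^esub> u"] h[of u] by (simp add: p g)
  next
    fix x y assume "x \<in> carrier Q" "y \<in> carrier Q"
    then obtain u v where u: "u \<in> carrier M" "x = \<pi> u" "v \<in> carrier M" "y = \<pi> v"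
      using assms(5) by blast
    then show "h (x \<oplus>\<^bsub>Q\<^esub> y) = h x \<oplus>\<^bsub>L\<^esub> h y"
      using h[of "u \<oplus>\<^bsub>M\<^esub> v"] h[of u] h[of v] by (simp add: p g)
  qed
  then show ?thesis using h by blast
qed

context left_module
begin

lemma
  assumes "submodule N R M"
  shows quotient_proj_hom: "(\<lambda>x. N +>\<^bsub>M\<^esub> x) \<in> mod_hom R M (quotient_module M N)"
    and quotient_proj_surj: "(\<lambda>x. N +>\<^bsub>M\<^esub> x) ` carrier M = carrier (quotient_module M N)"
    and quotient_proj_zero: "x \<in> carrier M \<Longrightarrow> N +>\<^bsub>M\<^esub> x = \<zero>\<^bsub>quotient_module M N\<^esub> \<longleftrightarrow> x \<in> N"
proof -
  note N = submodD[OF assms]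
  have sub: "subgroup N (add_monoid M)"
    using assms by (simp add: submodule_def)
  interpret A: abelian_subgroup N M
    by (rule abelian_subgroupI3) (use sub in \<open>auto simp: additive_subgroup_def M.abelian_group_axioms\<close>)
  show car: "(\<lambda>x. N +>\<^bsub>M\<^esub> x) ` carrier M = carrier (quotient_module M N)"
    by (auto simp: quotient_module_def A_RCOSETS_def')
  show "N +>\<^bsub>M\<^esub> x = \<zero>\<^bsub>quotient_module M N\<^esub> \<longleftrightarrow> x \<in> N" if "x \<in> carrier M"
    using A.a_rcos_self[OF that] M.a_coset_join2[OF that sub] by (auto simp: quotient_module_def)
  show "(\<lambda>x. N +>\<^bsub>M\<^esub> x) \<in> mod_hom R M (quotient_module M N)"
  proof (rule mod_homI)
    fix x assume x: "x \<in> carrier M"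
    then show "N +>\<^bsub>M\<^esub> x \<in> carrier (quotient_module M N)" using car by auto
    fix a assume a: "a \<in> carrier R"
    have "N +>\<^bsub>M\<^esub> (a \<odot> y) = N +>\<^bsub>M\<^esub> (a \<odot> x)" if y: "y \<in> N +>\<^bsub>M\<^esub> x" for y
    proof -
      from y obtain n where n: "n \<in> N" "y = n \<oplus> x" by (auto simp: a_r_coset_def')
      then have "a \<odot> y \<in> N +>\<^bsub>M\<^esub> (a \<odot> x)"
        using N(1) N(4)[OF a n(1)] a x by (auto simp: a_r_coset_def' smult_r_distr subset_iff)
      then show ?thesis
        using A.a_repr_independence'[of "a \<odot> y" "a \<odot> x"] smult_closed[OF a x] by simp
    qed
    moreover have "x \<in> N +>\<^bsub>M\<^esub> x" using A.a_rcos_self x by auto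
    ultimately have "(\<Union>y \<in> N +>\<^bsub>M\<^esub> x. N +>\<^bsub>M\<^esub> (a \<odot> y)) = N +>\<^bsub>M\<^esub> (a \<odot> x)" by blast
    then show "N +>\<^bsub>M\<^esub> (a \<odot> x) = a \<odot>\<^bsub>quotient_module M N\<^esub> (N +>\<^bsub>M\<^esub> x)"
      by (simp add: quotient_module_def)
  qed (simp add: quotient_module_def A.a_rcos_sum)
qed

end

text \<open>Injectivity and projectivity are postulated only for test modules whose elements are
  lists. An isomorphism with homomorphisms in both directions lets \<open>injective_extend\<close>
  and \<open>projective_lift\<close> conjugate a problem in arbitrary types into that one.\<close>

lemma fg_module_iso_list_inverse:
  fixes M :: "('r, 'm) module"
  assumes "fg_module R M"
  shows "\<exists>(M' :: ('r, 'r list) module) h g. fg_module R M' \<and> h \<in> mod_hom R M M' \<and> g \<in> mod_hom R M' M \<and>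
    (\<forall>x\<in>carrier M. g (h x) = x) \<and> (\<forall>y\<in>carrier M'. h (g y) = y)"
proof -
  obtain M' :: "('r, 'r list) module" and h where M': "fg_module R M'" and h: "h \<in> mod_hom R M M'"
    and bij: "bij_betw h (carrier M) (carrier M')"
    using fg_module_iso_list[OF assms] by blast
  have lm: "left_module R M" "left_module R M'" using assms M' by (auto simp: fg_module_def)
  interpret M: left_module R M by fact
  have im: "h ` carrier M = carrier M'" and inj: "inj_on h (carrier M)"
    using bij by (auto simp: bij_betw_def)
  have id: "(\<lambda>x. x) \<in> mod_hom R M M" by (rule mod_homI) auto
  have "x = \<zero>\<^bsub>M\<^esub>" if "x \<in> carrier M" "h x = \<zero>\<^bsub>M'\<^esub>" for x
    using inj_onD[OF inj, of x "\<zero>\<^bsub>M\<^esub>"] mod_hom_zero[OF lm h] that by simp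
  from hom_factor_surj[OF lm lm(1) h im id this]
  obtain g where g: "g \<in> mod_hom R M' M" "\<forall>x\<in>carrier M. g (h x) = x" by auto
  moreover from g(2) have "\<forall>y\<in>carrier M'. h (g y) = y" by (auto simp flip: im)
  ultimately show ?thesis using M' h by blast
qed

lemma injective_extend:
  assumes "injective_module R E" "fg_module R A" "fg_module R B"
    and "i \<in> mod_hom R A B" "inj_on i (carrier A)" "g \<in> mod_hom R A E"
  shows "\<exists>h\<in>mod_hom R B E. \<forall>x\<in>carrier A. h (i x) = g x"
proof -
  obtain A' :: "('a, 'a list) module" and a a' where A': "fg_module R A'" "a \<in> mod_hom R A A'" "a' \<in> mod_hom R A' A"
    "\<forall>x\<in>carrier A. a' (a x) = x" "\<forall>y\<in>carrier A'. a (a' y) = y"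
    using fg_module_iso_list_inverse[OF assms(2)] by blast
  obtain B' :: "('a, 'a list) module" and b b' where B': "fg_module R B'" "b \<in> mod_hom R B B'" "b' \<in> mod_hom R B' B"
    "\<forall>x\<in>carrier B. b' (b x) = x" "\<forall>y\<in>carrier B'. b (b' y) = y"
    using fg_module_iso_list_inverse[OF assms(3)] by blast
  have i': "(\<lambda>x. b (i (a' x))) \<in> mod_hom R A' B'"
    by (rule mod_hom_compose[OF mod_hom_compose[OF A'(3) assms(4)] B'(2)])
  have "inj_on (\<lambda>x. b (i (a' x))) (carrier A')"
  proof (rule inj_onI)
    fix x y assume *: "x \<in> carrier A'" "y \<in> carrier A'" "b (i (a' x)) = b (i (a' y))"
    then have "i (a' x) = i (a' y)"
      using B'(4) mod_homD(1)[OF A'(3)] mod_homD(1)[OF assms(4)] by metis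
    then have "a' x = a' y" using inj_onD[OF assms(5)] * mod_homD(1)[OF A'(3)] by simp
    then show "x = y" using A'(5) * by metis
  qed
  moreover have "(\<lambda>x. g (a' x)) \<in> mod_hom R A' E" by (rule mod_hom_compose[OF A'(3) assms(6)])
  ultimately obtain h where h: "h \<in> mod_hom R B' E" "\<forall>x\<in>carrier A'. h (b (i (a' x))) = g (a' x)"
    using assms(1) A'(1) B'(1) i' unfolding injective_module_def by blast
  show ?thesis
  proof (rule bexI)
    show "(\<lambda>x. h (b x)) \<in> mod_hom R B E" by (rule mod_hom_compose[OF B'(2) h(1)])
    show "\<forall>x\<in>carrier A. h (b (i x)) = g x"
    proof
      fix x assume x: "x \<in> carrier A"
      then have "h (b (i (a' (a x)))) = g (a' (a x))" using h(2) mod_homD(1)[OF A'(2)] by blast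
      then show "h (b (i x)) = g x" using A'(4) x by simp
    qed
  qed
qed

lemma projective_lift:
  assumes "projective_module R P" "fg_module R A" "fg_module R B"
    and "e \<in> mod_hom R A B" "e ` carrier A = carrier B" "g \<in> mod_hom R P B"
  shows "\<exists>h\<in>mod_hom R P A. \<forall>x\<in>carrier P. e (h x) = g x"
proof -
  obtain A' :: "('a, 'a list) module" and a a' where A': "fg_module R A'" "a \<in> mod_hom R A A'" "a' \<in> mod_hom R A' A"
    "\<forall>x\<in>carrier A. a' (a x) = x" "\<forall>y\<in>carrier A'. a (a' y) = y"
    using fg_module_iso_list_inverse[OF assms(2)] by blast
  obtain B' :: "('a, 'a list) module" and b b' where B': "fg_module R B'" "b \<in> mod_hom R B B'" "b' \<in> mod_hom R B' B"
    "\<forall>x\<in>carrier B. b' (b x) = x" "\<forall>y\<in>carrier B'. b (b' y) = y"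
    using fg_module_iso_list_inverse[OF assms(3)] by blast
  note c = mod_homD(1)[OF A'(2)] mod_homD(1)[OF A'(3)] mod_homD(1)[OF B'(2)] mod_homD(1)[OF B'(3)]
    mod_homD(1)[OF assms(4)] mod_homD(1)[OF assms(6)]
  have e': "(\<lambda>x. b (e (a' x))) \<in> mod_hom R A' B'"
    by (rule mod_hom_compose[OF mod_hom_compose[OF A'(3) assms(4)] B'(2)])
  have "(\<lambda>x. b (e (a' x))) ` carrier A' = carrier B'"
  proof (intro equalityI subsetI)
    fix y assume y: "y \<in> carrier B'"
    then have "b' y \<in> e ` carrier A" using c assms(5) by simp
    then obtain x where x: "x \<in> carrier A" "b' y = e x" by auto
    have "b (e (a' (a x))) = y" using x A'(4) B'(5) y by auto
    then show "y \<in> (\<lambda>x. b (e (a' x))) ` carrier A'" using c(1)[OF x(1)] by blast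
  qed (use c in auto)
  moreover have "(\<lambda>x. b (g x)) \<in> mod_hom R P B'" by (rule mod_hom_compose[OF assms(6) B'(2)])
  ultimately obtain h where h: "h \<in> mod_hom R P A'" "\<forall>x\<in>carrier P. b (e (a' (h x))) = b (g x)"
    using assms(1) A'(1) B'(1) e' unfolding projective_module_def by blast
  show ?thesis
  proof (rule bexI)
    show "(\<lambda>x. a' (h x)) \<in> mod_hom R P A" by (rule mod_hom_compose[OF h(1) A'(3)])
    show "\<forall>x\<in>carrier P. e (a' (h x)) = g x"
    proof
      fix x assume x: "x \<in> carrier P"
      then have "b' (b (e (a' (h x)))) = b' (b (g x))" using h(2) by simp
      then show "e (a' (h x)) = g x" using B'(4) c mod_homD(1)[OF h(1)] x by simp
    qed
  qed
qed

text \<open>Finite length passes from \<open>B\<close> to \<open>A\<close> and so makes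
  \<open>A\<close> finitely generated, as the extension property of \<open>E\<close> demands of both
  modules.\<close>

lemma injective_extend_submodule:
  assumes "injective_module R E" "left_module R B" "finite_length R B (carrier B)"
    and "submodule A R B" "g \<in> mod_hom R (submod B A) E"
  shows "\<exists>h\<in>mod_hom R B E. \<forall>x\<in>A. h x = g x"
proof -
  interpret B: left_module R B by fact
  note A = B.submodD(1)[OF assms(4)]
  have "finite_length R B A" by (rule B.finite_length_mono[OF assms(3,4) A])
  then have fg: "fg_module R (submod B A)"
    using finite_length_fg_module[OF B.left_module_submod[OF assms(4)]] finite_length_submod[OF assms(2)]
    by simp
  have id: "(\<lambda>x. x) \<in> mod_hom R (submod B A) B" by (rule mod_homI) (use A in auto)
  show ?thesis
    using injective_extend[OF assms(1) fg finite_length_fg_module[OF assms(2,3)] id _ assms(5)]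
    by (simp add: inj_on_def)
qed


section \<open>Matlis duality\<close>

text \<open>\<open>c\<close> is invertible in the field k/m: the ideal m + kc is strictly larger
  than \<open>m\<close> and so contains 1. The error term \<open>u\<close> is harmless wherever
  \<open>m\<close> acts as zero.\<close>

lemma maximalideal_inverse:
  fixes k :: "'k ring"
  assumes "cring k" "maximalideal m k" "c \<in> carrier k" "c \<notin> m"
  shows "\<exists>d\<in>carrier k. \<exists>u\<in>m. \<one>\<^bsub>k\<^esub> = u \<oplus>\<^bsub>k\<^esub> d \<otimes>\<^bsub>k\<^esub> c"
proof -
  interpret cring k by fact
  interpret V: left_module k "regular_module k" by (rule left_module_regular_module) (rule ring_axioms)
  interpret m: maximalideal m k by fact
  let ?C = "(\<lambda>d. d \<odot>\<^bsub>regular_module k\<^esub> c) ` carrier k"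
  have M: "submodule m k (regular_module k)"
    by (rule submodule_regular_of_ideal[OF assms(1)]) (rule m.is_ideal)
  have C: "submodule ?C k (regular_module k)" using V.submodule_cyclic[of c] assms(3) by simp
  note MC = V.submodule_set_add[OF M C]
  let ?S = "m <+>\<^bsub>regular_module k\<^esub> ?C"
  have "?S = m \<or> ?S = carrier k"
    by (rule m.I_maximal[OF ideal_of_submodule_regular[OF assms(1) MC]])
      (use V.set_add_upper(1)[OF M C] V.submodD(1)[OF MC] in auto)
  moreover have "c \<in> ?S" using V.set_add_upper(2)[OF M C] V.cyclic_self[of c] assms(3) by auto
  ultimately have "\<one>\<^bsub>k\<^esub> \<in> ?S" using assms(4) by auto
  then show ?thesis by (auto simp: V.mem_set_add)
qed

locale matlis_dual =
  fixes k :: "'k ring" and \<iota> :: "'k set \<Rightarrow> 'j" and J :: "('k, 'j) module"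
  assumes artinian: "artinian_cring k"
    and envelope: "injective_envelope k (quotient_module (regular_module k) (jacobson_radical k)) \<iota> J"
begin

lemma cring_k: "cring k"
  using artinian by (simp add: artinian_cring_def)

sublocale k: cring k
  by (rule cring_k)

abbreviation "V \<equiv> regular_module k"
abbreviation "rad \<equiv> jacobson_radical k"
abbreviation "top_k \<equiv> quotient_module V rad"

lemma left_module_V: "left_module k V"
  by (rule left_module_regular_module) (rule k.ring_axioms)

lemma injective_J: "injective_module k J"
  using envelope by (simp add: injective_envelope_def)

lemma left_module_J: "left_module k J"
  using injective_J by (simp add: injective_module_def)

sublocale V: left_module k V
  by (rule left_module_V)

sublocale J: left_module k J
  by (rule left_module_J)

section \<open>Maximal ideals of \<open>k\<close> and their annihilators in \<open>J\<close>\<close>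

lemma rad_iff: "x \<in> rad \<longleftrightarrow> x \<in> carrier k \<and> (\<forall>I. maximalideal I k \<longrightarrow> x \<in> I)"
  by (auto simp: jacobson_radical_def)

lemma maximalD:
  assumes "maximalideal m k"
  shows "submodule m k V" "m \<subseteq> carrier k" "\<one>\<^bsub>k\<^esub> \<notin> m"
    and "\<And>x y. \<lbrakk> x \<in> m; y \<in> carrier k \<rbrakk> \<Longrightarrow> y \<otimes>\<^bsub>k\<^esub> x \<in> m"
    and "\<And>x y. \<lbrakk> x \<in> m; y \<in> carrier k \<rbrakk> \<Longrightarrow> x \<otimes>\<^bsub>k\<^esub> y \<in> m"
    and "\<And>x y. \<lbrakk> x \<in> carrier k; y \<in> carrier k; x \<otimes>\<^bsub>k\<^esub> y \<in> m \<rbrakk> \<Longrightarrow> x \<in> m \<or> y \<in> m"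
proof -
  interpret m: maximalideal m k by fact
  interpret p: primeideal m k by (rule k.maximalideal_prime[OF assms])
  show "submodule m k V" by (rule submodule_regular_of_ideal[OF cring_k m.is_ideal])
  show "m \<subseteq> carrier k" by (rule m.a_subset)
  show "\<one>\<^bsub>k\<^esub> \<notin> m" using m.one_imp_carrier m.I_notcarr by auto
  show "x \<in> m \<or> y \<in> m" if "x \<in> carrier k" "y \<in> carrier k" "x \<otimes>\<^bsub>k\<^esub> y \<in> m" for x y
    using p.I_prime that by blast
qed (use assms in \<open>auto simp: maximalideal_def ideal.I_l_closed ideal.I_r_closed\<close>)

lemma maximalideal_not_subset:
  assumes "maximalideal m k" "maximalideal m' k" "m \<noteq> m'"
  shows "\<exists>u\<in>m. u \<notin> m'"
proof (rule ccontr)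
  assume "\<not> ?thesis"
  then have "m \<subseteq> m'" by auto
  then have "m' = m \<or> m' = carrier k"
    using maximalideal.I_maximal[OF assms(1)] maximalD(2)[OF assms(2)] assms(2)
    by (auto simp: maximalideal_def)
  then show False using assms(3) maximalD(3)[OF assms(2)] by auto
qed

lemma submodule_rad: "submodule rad k V"
  by (rule V.submodI)
    (use maximalD(1,4) V.submodD(2,3) in \<open>auto simp: rad_iff maximalD(4)\<close>)

lemma left_module_top: "left_module k top_k"
  by (rule V.left_module_quotient[OF submodule_rad])

text \<open>The composite k \<rightarrow> k / rad k \<rightarrow> J. It replaces cosets by scalars:
  its kernel is \<open>rad\<close>, and its image is the submodule over which \<open>J\<close> is
  essential.\<close>

definition emb :: "'k \<Rightarrow> 'j" where
  "emb x = \<iota> (rad +>\<^bsub>V\<^esub> x)"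

lemma emb_hom: "emb \<in> mod_hom k V J"
  unfolding emb_def
  by (rule mod_hom_compose[OF V.quotient_proj_hom[OF submodule_rad]])
    (use envelope in \<open>simp add: injective_envelope_def\<close>)

lemma emb_closed [simp]: "x \<in> carrier k \<Longrightarrow> emb x \<in> carrier J"
  using mod_homD(1)[OF emb_hom] by simp

lemma emb_smult: "c \<in> carrier k \<Longrightarrow> x \<in> carrier k \<Longrightarrow> emb (c \<otimes>\<^bsub>k\<^esub> x) = c \<odot>\<^bsub>J\<^esub> emb x"
  using mod_homD(3)[OF emb_hom] by simp

lemma emb_add: "x \<in> carrier k \<Longrightarrow> y \<in> carrier k \<Longrightarrow> emb (x \<oplus>\<^bsub>k\<^esub> y) = emb x \<oplus>\<^bsub>J\<^esub> emb y"
  using mod_homD(2)[OF emb_hom] by simp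

lemma emb_zero_iff: "x \<in> carrier k \<Longrightarrow> emb x = \<zero>\<^bsub>J\<^esub> \<longleftrightarrow> x \<in> rad"
proof -
  assume x: "x \<in> carrier k"
  interpret T: left_module k top_k by (rule left_module_top)
  have i: "\<iota> \<in> mod_hom k top_k J" "inj_on \<iota> (carrier top_k)"
    using envelope by (auto simp: injective_envelope_def)
  have q: "rad +>\<^bsub>V\<^esub> x \<in> carrier top_k"
    using mod_homD(1)[OF V.quotient_proj_hom[OF submodule_rad]] x by simp
  have "emb x = \<zero>\<^bsub>J\<^esub> \<longleftrightarrow> \<iota> (rad +>\<^bsub>V\<^esub> x) = \<iota> \<zero>\<^bsub>top_k\<^esub>"
    using mod_hom_zero[OF left_module_top left_module_J i(1)] by (simp add: emb_def)
  also have "\<dots> \<longleftrightarrow> rad +>\<^bsub>V\<^esub> x = \<zero>\<^bsub>top_k\<^esub>"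
    using inj_on_eq_iff[OF i(2) q T.M.zero_closed] .
  also have "\<dots> \<longleftrightarrow> x \<in> rad"
    using V.quotient_proj_zero[OF submodule_rad] x by simp
  finally show ?thesis .
qed

lemma essential:
  assumes "submodule N k J" "N \<inter> emb ` carrier k = {\<zero>\<^bsub>J\<^esub>}"
  shows "N = {\<zero>\<^bsub>J\<^esub>}"
proof -
  have "\<iota> ` carrier top_k = emb ` carrier k"
    using V.quotient_proj_surj[OF submodule_rad] by (auto simp: emb_def image_image simp flip: V.quotient_proj_surj[OF submodule_rad])
  then show ?thesis using envelope assms by (simp add: injective_envelope_def)
qed

text \<open>Some scalar \<open>e\<close> outside \<open>m\<close> lies in all other maximal ideals,
  so m e \<subseteq> rad and \<open>emb e\<close> is nonzero and killed by \<open>m\<close>. To find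
  \<open>e\<close>, take \<open>L\<close> minimal among the ideals not contained in
  \<open>m\<close>: by primality of \<open>m\<close>, L \<inter> m' is again such an ideal for every
  other m', hence equals \<open>L\<close>. This avoids counting the maximal ideals.\<close>

lemma ex_annihilated:
  assumes m: "maximalideal m k"
  shows "\<exists>j\<in>carrier J. j \<noteq> \<zero>\<^bsub>J\<^esub> \<and> (\<forall>c\<in>m. c \<odot>\<^bsub>J\<^esub> j = \<zero>\<^bsub>J\<^esub>)"
proof -
  let ?F = "{L. submodule L k V \<and> \<not> L \<subseteq> m}"
  have "carrier k \<in> ?F" using V.submodule_carrier maximalD(2,3)[OF m] by auto
  from artinian_minimal[OF artinian this] obtain L where L: "submodule L k V" "\<not> L \<subseteq> m"
    and Lmin: "\<And>L'. L' \<in> ?F \<Longrightarrow> L' \<subseteq> L \<Longrightarrow> L' = L" by auto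
  obtain e where e: "e \<in> L" "e \<notin> m" using L(2) by auto
  then have ec: "e \<in> carrier k" using V.submodD(1)[OF L(1)] by auto
  have other: "e \<in> m'" if m': "maximalideal m' k" "m' \<noteq> m" for m'
  proof -
    obtain c where c: "c \<in> m'" "c \<notin> m" using maximalideal_not_subset[OF m'(1) m m'(2)] by auto
    then have cc: "c \<in> carrier k" using maximalD(2)[OF m'(1)] by auto
    have "c \<otimes>\<^bsub>k\<^esub> e \<in> L \<inter> m'"
      using V.submodD(4)[OF L(1) _ e(1), of c] maximalD(5)[OF m'(1) c(1) ec] cc by simp
    moreover have "c \<otimes>\<^bsub>k\<^esub> e \<notin> m" using maximalD(6)[OF m cc ec] c e by auto
    ultimately have "L \<inter> m' = L"
      by (intro Lmin) (use V.submodule_Int[OF L(1) maximalD(1)[OF m'(1)]] in auto)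
    then show ?thesis using e(1) by auto
  qed
  have "c \<otimes>\<^bsub>k\<^esub> e \<in> rad" if "c \<in> m" for c
    unfolding rad_iff
  proof (intro conjI allI impI)
    have cc: "c \<in> carrier k" using that maximalD(2)[OF m] by auto
    then show "c \<otimes>\<^bsub>k\<^esub> e \<in> carrier k" using ec by simp
    fix m' assume m': "maximalideal m' k"
    then show "c \<otimes>\<^bsub>k\<^esub> e \<in> m'"
      using maximalD(5)[OF m that ec] maximalD(4)[OF m' other[OF m'] cc] by (cases "m' = m") auto
  qed
  then have "c \<odot>\<^bsub>J\<^esub> emb e = \<zero>\<^bsub>J\<^esub>" if "c \<in> m" for c
    using that maximalD(2)[OF m] ec by (simp add: emb_zero_iff subset_iff flip: emb_smult)
  moreover have "emb e \<noteq> \<zero>\<^bsub>J\<^esub>" using e m by (simp add: emb_zero_iff ec) (auto simp: rad_iff)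
  ultimately show ?thesis using ec by (intro bexI[of _ "emb e"]) auto
qed

text \<open>If j \<noteq> 0, essentiality gives a nonzero c j = emb x. As \<open>m\<close> kills
  \<open>j\<close>, \<open>c\<close> is not in \<open>m\<close> and is invertible modulo
  \<open>m\<close>, so j = d c j = emb (d x).\<close>

lemma annihilated_in_emb:
  assumes m: "maximalideal m k" and j: "j \<in> carrier J" "\<And>c. c \<in> m \<Longrightarrow> c \<odot>\<^bsub>J\<^esub> j = \<zero>\<^bsub>J\<^esub>"
  shows "\<exists>x\<in>carrier k. j = emb x"
proof (cases "j = \<zero>\<^bsub>J\<^esub>")
  case True
  then show ?thesis using mod_hom_zero[OF left_module_V left_module_J emb_hom]
    by (intro bexI[of _ "\<zero>\<^bsub>k\<^esub>"]) auto
next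
  case False
  let ?N = "(\<lambda>c. c \<odot>\<^bsub>J\<^esub> j) ` carrier k"
  have N: "submodule ?N k J" by (rule J.submodule_cyclic[OF j(1)])
  have "?N \<noteq> {\<zero>\<^bsub>J\<^esub>}" using J.cyclic_self[OF j(1)] False by auto
  then have "?N \<inter> emb ` carrier k \<noteq> {\<zero>\<^bsub>J\<^esub>}" using essential[OF N] by auto
  moreover have "\<zero>\<^bsub>J\<^esub> \<in> ?N" using J.submodD(2)[OF N] .
  moreover have "\<zero>\<^bsub>J\<^esub> \<in> emb ` carrier k"
    using mod_hom_zero[OF left_module_V left_module_J emb_hom] by (metis imageI k.zero_closed regular_module_simps(2))
  ultimately obtain c x where c: "c \<in> carrier k" "c \<odot>\<^bsub>J\<^esub> j \<noteq> \<zero>\<^bsub>J\<^esub>" "x \<in> carrier k" "c \<odot>\<^bsub>J\<^esub> j = emb x"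
    by blast
  then have "c \<notin> m" using j(2) by auto
  from maximalideal_inverse[OF cring_k m c(1) this]
  obtain d u where d: "d \<in> carrier k" "u \<in> m" "\<one>\<^bsub>k\<^esub> = u \<oplus>\<^bsub>k\<^esub> d \<otimes>\<^bsub>k\<^esub> c" by auto
  have u: "u \<in> carrier k" using d(2) maximalD(2)[OF m] by auto
  have "j = \<one>\<^bsub>k\<^esub> \<odot>\<^bsub>J\<^esub> j" using j(1) by simp
  also have "\<dots> = u \<odot>\<^bsub>J\<^esub> j \<oplus>\<^bsub>J\<^esub> d \<odot>\<^bsub>J\<^esub> (c \<odot>\<^bsub>J\<^esub> j)"
    unfolding d(3) using u d(1) c(1) j(1) by (simp add: J.smult_l_distr J.smult_assoc)
  also have "\<dots> = emb (d \<otimes>\<^bsub>k\<^esub> x)"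
    using j(2)[OF d(2)] c(3,4) d(1) by (simp add: emb_smult)
  finally show ?thesis using d(1) c(3) by blast
qed

text \<open>The property of \<open>J\<close> behind the double dual. Both elements come from
  scalars, j = emb x and i = emb y, and \<open>y\<close> turns out to be invertible modulo
  \<open>m\<close>. From 1 = u + d y follows x = u x + (d x) y, where u x is in \<open>rad\<close>
  because \<open>m\<close> kills \<open>j\<close>.\<close>

lemma annihilated_one_dimensional:
  assumes m: "maximalideal m k"
    and j: "j \<in> carrier J" "\<And>c. c \<in> m \<Longrightarrow> c \<odot>\<^bsub>J\<^esub> j = \<zero>\<^bsub>J\<^esub>"
    and i: "i \<in> carrier J" "\<And>c. c \<in> m \<Longrightarrow> c \<odot>\<^bsub>J\<^esub> i = \<zero>\<^bsub>J\<^esub>" "i \<noteq> \<zero>\<^bsub>J\<^esub>"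
  shows "\<exists>c\<in>carrier k. j = c \<odot>\<^bsub>J\<^esub> i"
proof -
  obtain x where x: "x \<in> carrier k" "j = emb x" using annihilated_in_emb[OF m j] by auto
  obtain y where y: "y \<in> carrier k" "i = emb y" using annihilated_in_emb[OF m i(1,2)] by auto
  have mx: "c \<otimes>\<^bsub>k\<^esub> x \<in> rad" if "c \<in> m" for c
    using j(2)[OF that] that maximalD(2)[OF m] x by (auto simp flip: emb_smult emb_zero_iff)
  have my: "c \<otimes>\<^bsub>k\<^esub> y \<in> rad" if "c \<in> m" for c
    using i(2)[OF that] that maximalD(2)[OF m] y by (auto simp flip: emb_smult emb_zero_iff)
  \<comment> \<open>If \<open>y\<close> were in \<open>m\<close>, it would lie in any other m' as
    well: some \<open>u\<close> in \<open>m\<close> avoids m', while u y \<in> rad \<subseteq> m'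
    and m' is prime. Then \<open>y\<close> would be in \<open>rad\<close> and \<open>i\<close> would
    be zero.\<close>
  have "y \<notin> m"
  proof
    assume "y \<in> m"
    have "y \<in> m'" if m': "maximalideal m' k" for m'
    proof (cases "m = m'")
      case False
      obtain u where u: "u \<in> m" "u \<notin> m'" using maximalideal_not_subset[OF m m' False] by auto
      have "u \<otimes>\<^bsub>k\<^esub> y \<in> m'" using my[OF u(1)] m' by (auto simp: rad_iff)
      then show ?thesis using maximalD(6)[OF m' _ y(1), of u] u maximalD(2)[OF m] by auto
    qed (use \<open>y \<in> m\<close> in simp)
    then have "y \<in> rad" using y(1) by (simp add: rad_iff)
    then show False using i(3) y by (simp add: emb_zero_iff)
  qed
  from maximalideal_inverse[OF cring_k m y(1) this]
  obtain d u where d: "d \<in> carrier k" "u \<in> m" "\<one>\<^bsub>k\<^esub> = u \<oplus>\<^bsub>k\<^esub> d \<otimes>\<^bsub>k\<^esub> y" by auto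
  have u: "u \<in> carrier k" using d(2) maximalD(2)[OF m] by auto
  have "x = (u \<oplus>\<^bsub>k\<^esub> d \<otimes>\<^bsub>k\<^esub> y) \<otimes>\<^bsub>k\<^esub> x"
    unfolding d(3)[symmetric] using x(1) by simp
  also have "\<dots> = u \<otimes>\<^bsub>k\<^esub> x \<oplus>\<^bsub>k\<^esub> (d \<otimes>\<^bsub>k\<^esub> x) \<otimes>\<^bsub>k\<^esub> y"
    using u x(1) y(1) d(1) by (simp add: k.l_distr k.m_assoc k.m_comm[of x y])
  finally have "emb x = emb (u \<otimes>\<^bsub>k\<^esub> x \<oplus>\<^bsub>k\<^esub> (d \<otimes>\<^bsub>k\<^esub> x) \<otimes>\<^bsub>k\<^esub> y)" by (rule arg_cong)
  also have "\<dots> = emb (u \<otimes>\<^bsub>k\<^esub> x) \<oplus>\<^bsub>J\<^esub> emb ((d \<otimes>\<^bsub>k\<^esub> x) \<otimes>\<^bsub>k\<^esub> y)"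
    by (rule emb_add) (use u x(1) y(1) d(1) in simp_all)
  finally have "emb x = emb (u \<otimes>\<^bsub>k\<^esub> x) \<oplus>\<^bsub>J\<^esub> emb ((d \<otimes>\<^bsub>k\<^esub> x) \<otimes>\<^bsub>k\<^esub> y)" .
  moreover have "emb (u \<otimes>\<^bsub>k\<^esub> x) = \<zero>\<^bsub>J\<^esub>" using mx[OF d(2)] u x(1) by (simp add: emb_zero_iff)
  ultimately have "j = (d \<otimes>\<^bsub>k\<^esub> x) \<odot>\<^bsub>J\<^esub> i"
    using x y d(1) by (simp add: emb_smult[symmetric])
  then show ?thesis using d(1) x(1) by blast
qed

section \<open>Functionals on modules of finite length\<close>

text \<open>This is the annihilator of the class of \<open>w\<close> in the simple module N'/N. An
  ideal \<open>I\<close> strictly above it contains some \<open>c\<close> with c w outside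
  \<open>N\<close>. Then c w generates \<open>N'\<close> over \<open>N\<close>, so w = n + d c w;
  thus 1 - d c annihilates the class, and 1 lies in \<open>I\<close>.\<close>

lemma cover_maximalideal:
  assumes "left_module k W" "submodule_cover k W N N'" "w \<in> N'" "w \<notin> N"
  shows "maximalideal {c \<in> carrier k. c \<odot>\<^bsub>W\<^esub> w \<in> N} k"
proof -
  interpret W: left_module k W by fact
  let ?m = "{c \<in> carrier k. c \<odot>\<^bsub>W\<^esub> w \<in> N}"
  have N: "submodule N k W" and N': "submodule N' k W" using assms(2) by (auto simp: submodule_cover_def)
  have w: "w \<in> carrier W" using W.submodD(1)[OF N'] assms(3) by auto
  have hom: "(\<lambda>c. c \<odot>\<^bsub>W\<^esub> w) \<in> mod_hom k V W"
    by (rule mod_homI) (use w in \<open>auto simp: W.smult_l_distr W.smult_assoc\<close>)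
  have "submodule ?m k V" using submodule_vimage[OF left_module_V assms(1) hom N] by simp
  note m = V.submodD[OF this] and mi = ideal_of_submodule_regular[OF cring_k this]
  show ?thesis
  proof (rule maximalidealI[OF mi])
    have "\<one>\<^bsub>k\<^esub> \<notin> ?m" using assms(4) w by simp
    then show "carrier k \<noteq> ?m" by (metis k.one_closed)
    fix I assume I: "ideal I k" "?m \<subseteq> I" "I \<subseteq> carrier k"
    interpret I: ideal I k by fact
    show "I = ?m \<or> I = carrier k"
    proof (cases "I = ?m")
      case False
      then obtain c where c: "c \<in> I" "c \<in> carrier k" "c \<odot>\<^bsub>W\<^esub> w \<notin> N" using I by auto
      have cw: "c \<odot>\<^bsub>W\<^esub> w \<in> N'" using W.submodD(4)[OF N' c(2) assms(3)] .
      have "w \<in> N <+>\<^bsub>W\<^esub> (\<lambda>d. d \<odot>\<^bsub>W\<^esub> (c \<odot>\<^bsub>W\<^esub> w)) ` carrier k"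
        using W.cover_generated[OF assms(2) cw c(3)] assms(3) by simp
      then obtain n d where n: "n \<in> N" "d \<in> carrier k" "w = n \<oplus>\<^bsub>W\<^esub> d \<odot>\<^bsub>W\<^esub> (c \<odot>\<^bsub>W\<^esub> w)"
        by (auto simp: W.mem_set_add)
      have nc: "n \<in> carrier W" using n(1) W.submodD(1)[OF N] by auto
      have "(\<one>\<^bsub>k\<^esub> \<ominus>\<^bsub>k\<^esub> d \<otimes>\<^bsub>k\<^esub> c) \<odot>\<^bsub>W\<^esub> w = w \<ominus>\<^bsub>W\<^esub> d \<odot>\<^bsub>W\<^esub> (c \<odot>\<^bsub>W\<^esub> w)"
        using c(2) n(2) w by (simp add: a_minus_def W.smult_l_distr W.smult_l_minus W.smult_assoc)
      also have "\<dots> = n"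
      proof -
        have "n = (d \<odot>\<^bsub>W\<^esub> (c \<odot>\<^bsub>W\<^esub> w) \<oplus>\<^bsub>W\<^esub> n) \<ominus>\<^bsub>W\<^esub> d \<odot>\<^bsub>W\<^esub> (c \<odot>\<^bsub>W\<^esub> w)"
          using nc n(2) c(2) w by (simp add: W.add_minus_cancel)
        moreover have "d \<odot>\<^bsub>W\<^esub> (c \<odot>\<^bsub>W\<^esub> w) \<oplus>\<^bsub>W\<^esub> n = w"
          using n(3) nc n(2) c(2) w W.M.a_comm W.smult_closed by metis
        ultimately show ?thesis by simp
      qed
      finally have "\<one>\<^bsub>k\<^esub> \<ominus>\<^bsub>k\<^esub> d \<otimes>\<^bsub>k\<^esub> c \<in> ?m" using n(1,2) c(2) by simp
      then have "\<one>\<^bsub>k\<^esub> \<ominus>\<^bsub>k\<^esub> d \<otimes>\<^bsub>k\<^esub> c \<in> I" using I(2) by auto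
      moreover have "d \<otimes>\<^bsub>k\<^esub> c \<in> I" using I.I_l_closed[OF c(1) n(2)] .
      ultimately have "(\<one>\<^bsub>k\<^esub> \<ominus>\<^bsub>k\<^esub> d \<otimes>\<^bsub>k\<^esub> c) \<oplus>\<^bsub>k\<^esub> d \<otimes>\<^bsub>k\<^esub> c \<in> I" by (rule I.a_closed)
      then have "\<one>\<^bsub>k\<^esub> \<in> I" using n(2) c(2) by (simp add: a_minus_def k.a_assoc k.l_neg)
      then show ?thesis using I.one_imp_carrier by simp
    qed (rule disjI1)
  qed
qed

text \<open>N'/N is k/m for the annihilator m of the class of \<open>w\<close>, and k/m maps to
  \<open>J\<close> because m kills some nonzero \<open>j\<close>. Injectivity carries the resulting
  functional from \<open>N'\<close> to \<open>W\<close>.\<close>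

lemma cover_functional:
  assumes "left_module k W" "finite_length k W (carrier W)" "submodule_cover k W N N'"
    and w: "w \<in> N'" "w \<notin> N"
  shows "\<exists>g\<in>mod_hom k W J. (\<forall>x\<in>N. g x = \<zero>\<^bsub>J\<^esub>) \<and> g w \<noteq> \<zero>\<^bsub>J\<^esub>"
proof -
  interpret W: left_module k W by fact
  have N: "submodule N k W" and N': "submodule N' k W" and NN': "N \<subset> N'"
    using assms(3) by (auto simp: submodule_cover_def)
  note Nc = W.submodD(1)[OF N]
  have wc: "w \<in> carrier W" using W.submodD(1)[OF N'] w by auto
  obtain j where j: "j \<in> carrier J" "j \<noteq> \<zero>\<^bsub>J\<^esub>"
    and ann: "\<And>c. \<lbrakk> c \<in> carrier k; c \<odot>\<^bsub>W\<^esub> w \<in> N \<rbrakk> \<Longrightarrow> c \<odot>\<^bsub>J\<^esub> j = \<zero>\<^bsub>J\<^esub>"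
    using ex_annihilated[OF cover_maximalideal[OF assms(1,3) w]] by auto
  \<comment> \<open>The functional on \<open>N'\<close> is to send n + c w to c j. It is set up on N
    \<oplus> k first: if n + c w = 0, then c w = -n lies in \<open>N\<close>, so \<open>c\<close> is
    in the annihilator and c j = 0.\<close>
  let ?S = "direct_sum (submod W N) V"
  have S: "left_module k ?S"
    by (rule left_module_direct_sum[OF W.left_module_submod[OF N] left_module_V])
  let ?\<pi> = "\<lambda>(n, c). n \<oplus>\<^bsub>W\<^esub> c \<odot>\<^bsub>W\<^esub> w" and ?g = "\<lambda>(n, c). c \<odot>\<^bsub>J\<^esub> j"
  have gen: "N' = N <+>\<^bsub>W\<^esub> (\<lambda>c. c \<odot>\<^bsub>W\<^esub> w) ` carrier k" by (rule W.cover_generated[OF assms(3) w])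
  have p: "?\<pi> \<in> mod_hom k ?S (submod W N')"
  proof (rule mod_homI)
    fix x assume "x \<in> carrier ?S"
    then show "?\<pi> x \<in> carrier (submod W N')" by (auto simp: gen W.mem_set_add)
  next
    fix x y assume "x \<in> carrier ?S" "y \<in> carrier ?S"
    then show "?\<pi> (x \<oplus>\<^bsub>?S\<^esub> y) = ?\<pi> x \<oplus>\<^bsub>submod W N'\<^esub> ?\<pi> y"
      using Nc wc by (auto simp: subset_iff W.smult_l_distr W.M.a_ac)
  next
    fix a x assume "a \<in> carrier k" "x \<in> carrier ?S"
    then show "?\<pi> (a \<odot>\<^bsub>?S\<^esub> x) = a \<odot>\<^bsub>submod W N'\<^esub> ?\<pi> x"
      using Nc wc by (auto simp: subset_iff W.smult_r_distr W.smult_assoc)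
  qed
  have ps: "?\<pi> ` carrier ?S = carrier (submod W N')"
    by (force simp: gen W.mem_set_add image_iff)
  have g: "?g \<in> mod_hom k ?S J"
    by (rule mod_homI) (use j(1) in \<open>auto simp: J.smult_l_distr J.smult_assoc\<close>)
  have ker: "?g x = \<zero>\<^bsub>J\<^esub>" if x: "x \<in> carrier ?S" "?\<pi> x = \<zero>\<^bsub>submod W N'\<^esub>" for x
  proof -
    obtain n c where nc: "x = (n, c)" "n \<in> N" "c \<in> carrier k" using x(1) by auto
    have n: "n \<in> carrier W" using nc(2) Nc by auto
    have "c \<odot>\<^bsub>W\<^esub> w = \<ominus>\<^bsub>W\<^esub> n"
      using x(2) nc n wc by (metis (no_types, lifting) W.M.a_comm W.M.minus_equality W.smult_closed case_prod_conv submod_simps(2))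
    then show ?thesis using ann[OF nc(3)] W.submodD(5)[OF N nc(2)] nc(1) by simp
  qed
  from hom_factor_surj[OF S W.left_module_submod[OF N'] left_module_J p ps g ker]
  obtain h where h: "h \<in> mod_hom k (submod W N') J" "\<And>n c. n \<in> N \<Longrightarrow> c \<in> carrier k \<Longrightarrow>
      h (n \<oplus>\<^bsub>W\<^esub> c \<odot>\<^bsub>W\<^esub> w) = c \<odot>\<^bsub>J\<^esub> j" by auto
  from injective_extend_submodule[OF injective_J assms(1,2) N' h(1)]
  obtain g' where g': "g' \<in> mod_hom k W J" "\<And>x. x \<in> N' \<Longrightarrow> g' x = h x" by auto
  have "g' x = \<zero>\<^bsub>J\<^esub>" if "x \<in> N" for x
  proof -
    have "x \<in> N'" "x \<in> carrier W" using that NN' Nc by auto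
    then show ?thesis using g'(2)[of x] h(2)[OF that k.zero_closed] j(1) wc by simp
  qed
  moreover have "g' w = j"
    using g'(2)[OF w(1)] h(2)[OF W.submodD(2)[OF N] k.one_closed] wc j(1) by simp
  ultimately show ?thesis using g'(1) j(2) by blast
qed

text \<open>The last cover in a composition series of k v provides a functional that is nonzero at
  some w = c v, and such a functional cannot vanish at \<open>v\<close>.\<close>

lemma dual_separates:
  assumes "left_module k W" "finite_length k W (carrier W)" "v \<in> carrier W" "v \<noteq> \<zero>\<^bsub>W\<^esub>"
  shows "\<exists>g\<in>mod_hom k W J. g v \<noteq> \<zero>\<^bsub>J\<^esub>"
proof -
  interpret W: left_module k W by fact
  let ?C = "(\<lambda>c. c \<odot>\<^bsub>W\<^esub> v) ` carrier k"
  have C: "submodule ?C k W" by (rule W.submodule_cyclic[OF assms(3)])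
  have "finite_length k W ?C"
    by (rule W.finite_length_mono[OF assms(2) C W.submodD(1)[OF C]])
  then obtain n where "has_length k W n ?C" by (auto simp: finite_length_def)
  moreover have "?C \<noteq> {\<zero>\<^bsub>W\<^esub>}" using W.cyclic_self[OF assms(3)] assms(4) by auto
  ultimately obtain N where N: "submodule_cover k W N ?C" by (cases rule: has_length.cases) auto
  then obtain w where w: "w \<in> ?C" "w \<notin> N" by (auto simp: submodule_cover_def)
  from cover_functional[OF assms(1,2) N w] obtain g where g: "g \<in> mod_hom k W J" "g w \<noteq> \<zero>\<^bsub>J\<^esub>" by auto
  obtain c where c: "c \<in> carrier k" "w = c \<odot>\<^bsub>W\<^esub> v" using w(1) by auto
  then have "g v \<noteq> \<zero>\<^bsub>J\<^esub>" using g mod_homD(3)[OF g(1) c(1) assms(3)] by auto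
  then show ?thesis using g(1) by blast
qed

end

section \<open>The double dual\<close>

context matlis_dual
begin

abbreviation dual :: "('k, 'w) module \<Rightarrow> ('k, 'w \<Rightarrow> 'j) module" where
  "dual W \<equiv> hom_module k W J (\<lambda>c g x. g (c \<odot>\<^bsub>W\<^esub> x))"

lemma left_module_dual:
  assumes "left_module k W"
  shows "left_module k (dual W)"
proof -
  interpret W: left_module k W by fact
  have D1: "f x \<in> carrier J" if "f \<in> mod_hom k W J" "x \<in> carrier W" for f x
    using mod_homD(1)[OF that] .
  show ?thesis
  proof (rule left_module_hom_module)
    show "(\<lambda>x. f (a \<odot>\<^bsub>W\<^esub> x)) \<in> mod_hom k W J" if "a \<in> carrier k" "f \<in> mod_hom k W J" for a f
    proof (rule mod_homI)
      fix b x assume b: "b \<in> carrier k" "x \<in> carrier W"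
      have "a \<odot>\<^bsub>W\<^esub> (b \<odot>\<^bsub>W\<^esub> x) = b \<odot>\<^bsub>W\<^esub> (a \<odot>\<^bsub>W\<^esub> x)"
        using that(1) b by (simp add: k.m_comm[of a b] flip: W.smult_assoc)
      then show "f (a \<odot>\<^bsub>W\<^esub> (b \<odot>\<^bsub>W\<^esub> x)) = b \<odot>\<^bsub>J\<^esub> f (a \<odot>\<^bsub>W\<^esub> x)"
        using mod_homD(3)[OF that(2)] that(1) b by simp
    qed (use that mod_homD[OF that(2)] in \<open>simp_all add: W.smult_r_distr\<close>)
  next
    fix a b f x assume "a \<in> carrier k" "b \<in> carrier k" "f \<in> mod_hom k W J" "x \<in> carrier W"
    then show "f ((a \<otimes>\<^bsub>k\<^esub> b) \<odot>\<^bsub>W\<^esub> x) = f (b \<odot>\<^bsub>W\<^esub> (a \<odot>\<^bsub>W\<^esub> x))"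
      by (simp add: k.m_comm[of a b] W.smult_assoc)
  qed (simp_all add: assms left_module_J k.ring_axioms W.smult_l_distr mod_homD(2))
qed

text \<open>
  Going down a composition series, \<open>\<xi>\<close> is made to agree with an evaluation on the functionals that
  vanish on smaller and smaller submodules; each step uses that the annihilator in \<open>J\<close> of a maximal
  ideal is one-dimensional.
\<close>

lemma double_dual_evaluation:
  assumes W: "left_module k W" "finite_length k W (carrier W)"
    and \<xi>: "\<xi> \<in> mod_hom k (dual W) J"
  shows "\<exists>v\<in>carrier W. \<forall>g\<in>carrier (dual W). \<xi> g = g v"
proof -
  interpret W: left_module k W by fact
  interpret D: left_module k "dual W" by (rule left_module_dual[OF W(1)])
  note X = mod_homD[OF \<xi>]
  have carD: "g \<in> carrier (dual W) \<longleftrightarrow> g \<in> mod_hom k W J \<and> g \<in> extensional (carrier W)" for g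
    by (simp add: hom_module_def)
  have addD: "(g \<oplus>\<^bsub>dual W\<^esub> h) x = g x \<oplus>\<^bsub>J\<^esub> h x" if "x \<in> carrier W" for g h x
    using that by (simp add: hom_module_def)
  have smD: "(c \<odot>\<^bsub>dual W\<^esub> g) x = c \<odot>\<^bsub>J\<^esub> g x" if "c \<in> carrier k" "g \<in> carrier (dual W)" "x \<in> carrier W" for c g x
    using that mod_homD(3)[of g k W J c x] by (simp add: hom_module_def)
  have cl: "g x \<in> carrier J" if "g \<in> carrier (dual W)" "x \<in> carrier W" for g x
    using that mod_homD(1)[of g k W J x] by (simp add: carD)
  \<comment> \<open>The form of an implication reverses the induction: for N = W the premise holds
    with v = 0, and each cover lets \<open>N\<close> shrink until it is zero and the premise
    concerns all functionals.\<close>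
  have "(\<exists>v\<in>carrier W. \<forall>g\<in>carrier (dual W). (\<forall>x\<in>N. g x = \<zero>\<^bsub>J\<^esub>) \<longrightarrow> \<xi> g = g v) \<Longrightarrow> ?thesis"
    if "finite_length k W N" for N
    using that
  proof (induction rule: finite_length_induct)
    case zero
    have "g \<zero>\<^bsub>W\<^esub> = \<zero>\<^bsub>J\<^esub>" if "g \<in> carrier (dual W)" for g
      using mod_hom_zero[OF W(1) left_module_J] that by (simp add: carD)
    then show ?case using zero by auto
  next
    case (cover N N')
    have N: "submodule N k W" and N': "submodule N' k W" and NN': "N \<subset> N'"
      using cover(2) by (auto simp: submodule_cover_def)
    note Nc = W.submodD(1)[OF N]
    from cover.prems obtain v where v: "v \<in> carrier W"
      and ev: "\<And>g. \<lbrakk> g \<in> carrier (dual W); \<And>x. x \<in> N' \<Longrightarrow> g x = \<zero>\<^bsub>J\<^esub> \<rbrakk> \<Longrightarrow> \<xi> g = g v" by blast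
    obtain w where w: "w \<in> N'" "w \<notin> N" using NN' by auto
    have wc: "w \<in> carrier W" using W.submodD(1)[OF N'] w by auto
    have gen: "N' = N <+>\<^bsub>W\<^esub> (\<lambda>c. c \<odot>\<^bsub>W\<^esub> w) ` carrier k" by (rule W.cover_generated[OF cover(2) w])
    have vanish: "g x = \<zero>\<^bsub>J\<^esub>"
      if "g \<in> carrier (dual W)" "\<And>y. y \<in> N \<Longrightarrow> g y = \<zero>\<^bsub>J\<^esub>" "g w = \<zero>\<^bsub>J\<^esub>" "x \<in> N'" for g x
    proof -
      from that(4) obtain n c where n: "n \<in> N" "c \<in> carrier k" "x = n \<oplus>\<^bsub>W\<^esub> c \<odot>\<^bsub>W\<^esub> w"
        by (auto simp: gen W.mem_set_add)
      have "n \<in> carrier W" using n(1) Nc by auto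
      then show ?thesis using n that(1-3) wc mod_homD(2,3)[of g k W J] by (simp add: carD)
    qed
    let ?m = "{c \<in> carrier k. c \<odot>\<^bsub>W\<^esub> w \<in> N}"
    have m: "maximalideal ?m k" by (rule cover_maximalideal[OF W(1) cover(2) w])
    obtain g1 where g1: "g1 \<in> mod_hom k W J" "\<And>x. x \<in> N \<Longrightarrow> g1 x = \<zero>\<^bsub>J\<^esub>" "g1 w \<noteq> \<zero>\<^bsub>J\<^esub>"
      using cover_functional[OF W cover(2) w] by auto
    define g0 where "g0 = restrict g1 (carrier W)"
    have g0: "g0 \<in> carrier (dual W)"
      unfolding carD g0_def using mod_hom_cong[OF g1(1) _ W(1)] by auto
    have g0N: "g0 x = \<zero>\<^bsub>J\<^esub>" if "x \<in> N" for x using g1(2)[OF that] that Nc by (auto simp: g0_def)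
    have g0w: "g0 w \<noteq> \<zero>\<^bsub>J\<^esub>" using g1(3) wc by (simp add: g0_def)
    have killed: "c \<odot>\<^bsub>J\<^esub> g w = \<zero>\<^bsub>J\<^esub>"
      if "g \<in> carrier (dual W)" "\<And>y. y \<in> N \<Longrightarrow> g y = \<zero>\<^bsub>J\<^esub>" "c \<in> ?m" for g c
      using that(1,3) that(2)[of "c \<odot>\<^bsub>W\<^esub> w"] wc mod_homD(3)[of g k W J c w] by (simp add: carD)
    \<comment> \<open>For \<open>c\<close> in the maximal ideal, c g0 vanishes on all of
      \<open>N'\<close>, where \<open>\<xi>\<close> already is evaluation at \<open>v\<close>. So
      the defect of \<open>\<xi>\<close> at \<open>g0\<close> is killed by that ideal, just as
      \<open>g0 w\<close> is, and must be a multiple of it.\<close>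
    have "\<exists>d\<in>carrier k. \<xi> g0 \<ominus>\<^bsub>J\<^esub> g0 v = d \<odot>\<^bsub>J\<^esub> g0 w"
    proof (rule annihilated_one_dimensional[OF m])
      show "\<xi> g0 \<ominus>\<^bsub>J\<^esub> g0 v \<in> carrier J" using X(1)[OF g0] cl[OF g0 v] by simp
      fix c assume c: "c \<in> ?m"
      have cg: "c \<odot>\<^bsub>dual W\<^esub> g0 \<in> carrier (dual W)" using g0 c by simp
      have "\<xi> (c \<odot>\<^bsub>dual W\<^esub> g0) = (c \<odot>\<^bsub>dual W\<^esub> g0) v"
      proof (rule ev[OF cg], rule vanish[OF cg])
        show "(c \<odot>\<^bsub>dual W\<^esub> g0) y = \<zero>\<^bsub>J\<^esub>" if "y \<in> N" for y
          using smD[OF _ g0, of c y] that Nc g0N[OF that] c by auto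
        show "(c \<odot>\<^bsub>dual W\<^esub> g0) w = \<zero>\<^bsub>J\<^esub>"
          using smD[OF _ g0 wc, of c] killed[OF g0 g0N c] c by auto
      qed
      then have "c \<odot>\<^bsub>J\<^esub> \<xi> g0 = c \<odot>\<^bsub>J\<^esub> g0 v" using X(3)[OF _ g0] smD[OF _ g0 v] c by simp
      then show "c \<odot>\<^bsub>J\<^esub> (\<xi> g0 \<ominus>\<^bsub>J\<^esub> g0 v) = \<zero>\<^bsub>J\<^esub>"
        using X(1)[OF g0] cl[OF g0 v] c
        by (simp add: a_minus_def J.smult_r_distr J.smult_r_minus J.M.r_neg)
    qed (use cl[OF g0 wc] killed[OF g0 g0N] g0w in auto)
    then obtain d where d: "d \<in> carrier k" "\<xi> g0 \<ominus>\<^bsub>J\<^esub> g0 v = d \<odot>\<^bsub>J\<^esub> g0 w" by auto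
    have \<xi>0: "\<xi> g0 = g0 v \<oplus>\<^bsub>J\<^esub> d \<odot>\<^bsub>J\<^esub> g0 w"
      using d(2)[symmetric] X(1)[OF g0] cl[OF g0 v]
      by (simp add: a_minus_def J.M.a_comm[of "\<xi> g0"] J.M.r_neg2)
    let ?v = "v \<oplus>\<^bsub>W\<^esub> d \<odot>\<^bsub>W\<^esub> w"
    have "\<xi> g = g ?v" if g: "g \<in> carrier (dual W)" and gN: "\<And>x. x \<in> N \<Longrightarrow> g x = \<zero>\<^bsub>J\<^esub>" for g
    proof -
      obtain c where c: "c \<in> carrier k" "g w = c \<odot>\<^bsub>J\<^esub> g0 w"
        using annihilated_one_dimensional[OF m cl[OF g wc] killed[OF g gN] cl[OF g0 wc] killed[OF g0 g0N] g0w]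
        by auto
      let ?cg = "c \<odot>\<^bsub>dual W\<^esub> g0"
      have cg: "?cg \<in> carrier (dual W)" using g0 c(1) by simp
      \<comment> \<open>\<open>c\<close> is chosen so that \<open>g\<close> and c g0 agree at
        \<open>w\<close>, hence on \<open>N'\<close>. Their difference falls under the previous
        stage, where \<open>\<xi>\<close> is evaluation at \<open>v\<close>, and h w = 0 makes the
        correction d w invisible to it.\<close>
      define h where "h = g \<ominus>\<^bsub>dual W\<^esub> ?cg"
      have h: "h \<in> carrier (dual W)" using g cg by (simp add: h_def)
      have gh: "g = h \<oplus>\<^bsub>dual W\<^esub> ?cg"
        using g cg by (simp add: h_def a_minus_def D.M.a_assoc D.M.l_neg)
      have gx: "g x = h x \<oplus>\<^bsub>J\<^esub> c \<odot>\<^bsub>J\<^esub> g0 x" if "x \<in> carrier W" for x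
        using addD[OF that, of h ?cg] smD[OF c(1) g0 that] by (simp flip: gh)
      have hx: "h x = g x \<ominus>\<^bsub>J\<^esub> c \<odot>\<^bsub>J\<^esub> g0 x" if "x \<in> carrier W" for x
        unfolding gx[OF that] using cl[OF h that] cl[OF g0 that] c(1)
        by (simp add: a_minus_def J.M.a_assoc J.M.r_neg)
      have "\<xi> h = h v"
      proof (rule ev[OF h], rule vanish[OF h])
        show "h y = \<zero>\<^bsub>J\<^esub>" if "y \<in> N" for y
          using hx[of y] gN[OF that] g0N[OF that] that Nc c(1) by (auto simp: a_minus_def)
        show "h w = \<zero>\<^bsub>J\<^esub>"
          using hx[OF wc] c cl[OF g0 wc] by (simp add: a_minus_def J.M.r_neg)
      qed
      then have "\<xi> g = h v \<oplus>\<^bsub>J\<^esub> c \<odot>\<^bsub>J\<^esub> (g0 v \<oplus>\<^bsub>J\<^esub> d \<odot>\<^bsub>J\<^esub> g0 w)"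
        using X(2)[OF h cg] X(3)[OF c(1) g0] \<xi>0 by (simp flip: gh)
      also have "\<dots> = (h v \<oplus>\<^bsub>J\<^esub> c \<odot>\<^bsub>J\<^esub> g0 v) \<oplus>\<^bsub>J\<^esub> (d \<otimes>\<^bsub>k\<^esub> c) \<odot>\<^bsub>J\<^esub> g0 w"
        using cl[OF h v] cl[OF g0 v] cl[OF g0 wc] c(1) d(1)
        by (simp add: J.smult_r_distr J.M.a_assoc k.m_comm[of d c] J.smult_assoc)
      also have "\<dots> = g v \<oplus>\<^bsub>J\<^esub> d \<odot>\<^bsub>J\<^esub> g w"
        using gx[OF v] c d(1) cl[OF g0 wc] by (simp add: J.smult_assoc)
      also have "\<dots> = g ?v"
        using g mod_homD(2,3)[of g k W J] v wc d(1) by (simp add: carD)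
      finally show ?thesis .
    qed
    moreover have "?v \<in> carrier W" using v wc d(1) by simp
    ultimately show ?case by (intro cover.IH bexI[of _ ?v]) simp_all
  qed
  note step = this[OF W(2)]
  show ?thesis
  proof (rule step)
    have "\<xi> g = g \<zero>\<^bsub>W\<^esub>" if g: "g \<in> carrier (dual W)" "\<forall>x\<in>carrier W. g x = \<zero>\<^bsub>J\<^esub>" for g
    proof -
      have "g = \<zero>\<^bsub>dual W\<^esub>" using g by (auto simp: carD hom_module_def fun_eq_iff extensional_def)
      then show ?thesis using mod_hom_zero[OF left_module_dual[OF W(1)] left_module_J \<xi>] g(2) by simp
    qed
    then show "\<exists>v\<in>carrier W. \<forall>g\<in>carrier (dual W). (\<forall>x\<in>carrier W. g x = \<zero>\<^bsub>J\<^esub>) \<longrightarrow> \<xi> g = g v"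
      using W.M.zero_closed by blast
  qed
qed

end

section \<open>Finite sums, free modules and dual bases\<close>

text \<open>Stated for additive maps because it also serves maps between modules over different
  rings, such as a \<mapsto> p a v from \<open>P0\<close> to \<open>J\<close>, or the evaluation of
  tensors at a functional.\<close>

lemma hom_finsum:
  assumes "abelian_group M" "abelian_group N"
    and "\<And>x. x \<in> carrier M \<Longrightarrow> h x \<in> carrier N"
    and "\<And>x y. \<lbrakk> x \<in> carrier M; y \<in> carrier M \<rbrakk> \<Longrightarrow> h (x \<oplus>\<^bsub>M\<^esub> y) = h x \<oplus>\<^bsub>N\<^esub> h y"
    and "finite S" "u \<in> S \<rightarrow> carrier M"
  shows "h (finsum M u S) = finsum N (\<lambda>s. h (u s)) S"
proof -
  interpret M: abelian_group M by fact
  interpret N: abelian_group N by fact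
  have "h \<zero>\<^bsub>M\<^esub> \<oplus>\<^bsub>N\<^esub> h \<zero>\<^bsub>M\<^esub> = h \<zero>\<^bsub>M\<^esub>" using assms(4)[of "\<zero>\<^bsub>M\<^esub>" "\<zero>\<^bsub>M\<^esub>"] by simp
  then have zero: "h \<zero>\<^bsub>M\<^esub> = \<zero>\<^bsub>N\<^esub>" using assms(3)[OF M.zero_closed] N.add.l_cancel_one by metis
  show ?thesis using assms(5,6)
  proof (induction S rule: finite_induct)
    case empty
    then show ?case using zero by simp
  next
    case (insert s S)
    then have "u \<in> S \<rightarrow> carrier M" "u s \<in> carrier M" by auto
    moreover from this have "(\<lambda>s. h (u s)) \<in> S \<rightarrow> carrier N" "h (u s) \<in> carrier N"
      using assms(3) by auto
    ultimately show ?case using insert assms(4)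
      by (simp add: M.finsum_closed)
  qed
qed

lemma mod_hom_finsum:
  assumes "left_module R M" "left_module R N" "h \<in> mod_hom R M N" "finite S" "u \<in> S \<rightarrow> carrier M"
  shows "h (finsum M u S) = finsum N (\<lambda>s. h (u s)) S"
  by (rule hom_finsum) (use assms mod_homD[OF assms(3)] in \<open>auto simp: left_module_def\<close>)

definition free_module :: "'r ring \<Rightarrow> 's set \<Rightarrow> ('r, 's \<Rightarrow> 'r) module" where
  "free_module R S =
     \<lparr> carrier = S \<rightarrow>\<^sub>E carrier R, mult = undefined, one = undefined, zero = (\<lambda>s\<in>S. \<zero>\<^bsub>R\<^esub>),
       add = (\<lambda>u v. \<lambda>s\<in>S. u s \<oplus>\<^bsub>R\<^esub> v s), smult = (\<lambda>a u. \<lambda>s\<in>S. a \<otimes>\<^bsub>R\<^esub> u s) \<rparr>"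

lemma free_module_simps [simp]:
  "carrier (free_module R S) = S \<rightarrow>\<^sub>E carrier R" "\<zero>\<^bsub>free_module R S\<^esub> = (\<lambda>s\<in>S. \<zero>\<^bsub>R\<^esub>)"
  "u \<oplus>\<^bsub>free_module R S\<^esub> v = (\<lambda>s\<in>S. u s \<oplus>\<^bsub>R\<^esub> v s)" "a \<odot>\<^bsub>free_module R S\<^esub> u = (\<lambda>s\<in>S. a \<otimes>\<^bsub>R\<^esub> u s)"
  by (simp_all add: free_module_def)

lemma left_module_free_module:
  assumes "ring R"
  shows "left_module R (free_module R S)"
proof -
  interpret ring R by fact
  have "abelian_group (free_module R S)"
  proof (rule abelian_groupI)
    fix u assume u: "u \<in> carrier (free_module R S)"
    then show "\<zero>\<^bsub>free_module R S\<^esub> \<oplus>\<^bsub>free_module R S\<^esub> u = u"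
      by (auto intro!: extensionalityI[of _ S] simp: PiE_iff)
    show "\<exists>v\<in>carrier (free_module R S). v \<oplus>\<^bsub>free_module R S\<^esub> u = \<zero>\<^bsub>free_module R S\<^esub>"
      using u by (intro bexI[of _ "\<lambda>s\<in>S. \<ominus>\<^bsub>R\<^esub> u s"]) (auto simp: l_neg PiE_iff cong: restrict_cong)
  qed (auto simp: a_ac PiE_iff cong: restrict_cong)
  moreover have "left_module_axioms R (free_module R S)"
    unfolding left_module_axioms_def
  proof (intro conjI allI impI)
    fix u assume "u \<in> carrier (free_module R S)"
    then show "\<one>\<^bsub>R\<^esub> \<odot>\<^bsub>free_module R S\<^esub> u = u"
      by (auto intro!: extensionalityI[of _ S] simp: PiE_iff)
  qed (auto simp: l_distr r_distr m_assoc PiE_iff cong: restrict_cong)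
  ultimately show ?thesis
    using assms by (simp add: left_module_def)
qed

lemma fg_free_module:
  assumes "ring R" "finite S"
  shows "fg_module R (free_module R S)"
proof -
  interpret ring R by fact
  let ?F = "free_module R S"
  interpret F: left_module R ?F by (rule left_module_free_module[OF assms(1)])
  define e where "e s = (\<lambda>t\<in>S. if t = s then \<one>\<^bsub>R\<^esub> else \<zero>\<^bsub>R\<^esub>)" for s
  have e: "e ` S \<subseteq> carrier ?F" by (auto simp: e_def)
  have "u \<in> L" if L: "submodule L R ?F" "e ` S \<subseteq> L" and u: "u \<in> carrier ?F" for L u
  proof -
    note Ld = F.submodD[OF L(1)]
    have "(\<lambda>s\<in>S. if s \<in> T then u s else \<zero>\<^bsub>R\<^esub>) \<in> L" if "finite T" "T \<subseteq> S" for T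
      using that
    proof (induction T rule: finite_induct)
      case empty
      then show ?case using Ld(2) by (simp add: restrict_def)
    next
      case (insert t T)
      let ?u = "\<lambda>s\<in>S. if s \<in> T then u s else \<zero>\<^bsub>R\<^esub>"
      have ut: "u t \<in> carrier R" using u insert.prems by auto
      have "?u \<in> L" by (rule insert.IH) (use insert.prems in simp)
      moreover have "u t \<odot>\<^bsub>?F\<^esub> e t \<in> L" by (rule Ld(4)[OF ut]) (use L(2) insert.prems in auto)
      ultimately have "?u \<oplus>\<^bsub>?F\<^esub> u t \<odot>\<^bsub>?F\<^esub> e t \<in> L" by (rule Ld(3))
      also have "?u \<oplus>\<^bsub>?F\<^esub> u t \<odot>\<^bsub>?F\<^esub> e t = (\<lambda>s\<in>S. if s \<in> insert t T then u s else \<zero>\<^bsub>R\<^esub>)"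
        using insert.hyps(2) ut u by (auto simp: e_def fun_eq_iff restrict_def PiE_iff)
      finally show ?case .
    qed
    from this[OF assms(2) order_refl] have "restrict u S \<in> L" by (simp cong: restrict_cong)
    moreover have "restrict u S = u" using u by (auto simp: PiE_iff extensional_restrict)
    ultimately show ?thesis by simp
  qed
  then have "carrier ?F \<subseteq> module_span R ?F (e ` S)" unfolding module_span_def by blast
  then have "module_span R ?F (e ` S) = carrier ?F"
    using F.span_least[OF F.submodule_carrier e] by blast
  then show ?thesis unfolding fg_module_def
    using F.left_module_axioms assms(2) e by (intro conjI exI[of _ "e ` S"]) auto
qed

text \<open>The identity of \<open>P\<close> lifts through the surjection from the free module on a
  finite generating set. The coordinates of the lift are the functionals \<open>g s\<close>, and the
  basis is indexed by the generators themselves.\<close>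

lemma projective_dual_basis:
  assumes "projective_module R P"
  shows "\<exists>S g. finite S \<and> S \<subseteq> carrier P \<and> (\<forall>s\<in>S. g s \<in> carrier (ring_dual R P)) \<and>
           (\<forall>x\<in>carrier P. finsum P (\<lambda>s. g s x \<odot>\<^bsub>P\<^esub> s) S = x)"
proof -
  have fgP: "fg_module R P" using assms by (simp add: projective_module_def)
  then obtain S where P: "left_module R P"
    and S: "finite S" "S \<subseteq> carrier P" "module_span R P S = carrier P"
    by (auto simp: fg_module_def)
  interpret P: left_module R P by fact
  let ?F = "free_module R S"
  have F: "left_module R ?F" by (rule left_module_free_module[OF P.R.ring_axioms])
  let ?q = "\<lambda>u. finsum P (\<lambda>s. u s \<odot>\<^bsub>P\<^esub> s) S"
  have cl: "(\<lambda>s. u s \<odot>\<^bsub>P\<^esub> s) \<in> S \<rightarrow> carrier P" if "u \<in> carrier ?F" for u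
    using that S(2) by auto
  have q: "?q \<in> mod_hom R ?F P"
  proof (rule mod_homI)
    fix u v assume u: "u \<in> carrier ?F" and v: "v \<in> carrier ?F"
    show "?q u \<in> carrier P" using cl[OF u] by (rule P.M.finsum_closed)
    have "?q (u \<oplus>\<^bsub>?F\<^esub> v) = finsum P (\<lambda>s. u s \<odot>\<^bsub>P\<^esub> s \<oplus>\<^bsub>P\<^esub> v s \<odot>\<^bsub>P\<^esub> s) S"
      by (rule P.M.finsum_cong') (use u v S(2) in \<open>auto simp: P.smult_l_distr PiE_iff Pi_iff subset_iff\<close>)
    then show "?q (u \<oplus>\<^bsub>?F\<^esub> v) = ?q u \<oplus>\<^bsub>P\<^esub> ?q v"
      using P.M.finsum_addf[OF cl[OF u] cl[OF v]] by simp
  next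
    fix a u assume a: "a \<in> carrier R" and u: "u \<in> carrier ?F"
    show "?q (a \<odot>\<^bsub>?F\<^esub> u) = a \<odot>\<^bsub>P\<^esub> ?q u"
    proof -
      have "finite T \<Longrightarrow> T \<subseteq> S \<Longrightarrow>
        finsum P (\<lambda>s. (a \<odot>\<^bsub>?F\<^esub> u) s \<odot>\<^bsub>P\<^esub> s) T = a \<odot>\<^bsub>P\<^esub> finsum P (\<lambda>s. u s \<odot>\<^bsub>P\<^esub> s) T" for T
      proof (induction T rule: finite_induct)
        case (insert t T)
        have us: "u s \<in> carrier R" "s \<in> carrier P" "s \<in> S" if "s \<in> insert t T" for s
          using u insert.prems S(2) that by auto
        have c: "(\<lambda>s. u s \<odot>\<^bsub>P\<^esub> s) \<in> T \<rightarrow> carrier P" "(\<lambda>s. (a \<odot>\<^bsub>?F\<^esub> u) s \<odot>\<^bsub>P\<^esub> s) \<in> T \<rightarrow> carrier P"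
          using us a by auto
        show ?case using insert us[of t] a c P.M.finsum_closed[OF c(1)]
          by (simp add: P.smult_r_distr P.smult_assoc)
      qed (use a in simp)
      then show ?thesis using S(1) by blast
    qed
  qed
  have "?q ` carrier ?F = carrier P"
  proof
    have "S \<subseteq> ?q ` carrier ?F"
    proof
      fix t assume t: "t \<in> S"
      let ?e = "\<lambda>s\<in>S. if s = t then \<one>\<^bsub>R\<^esub> else \<zero>\<^bsub>R\<^esub>"
      have "?q ?e = finsum P (\<lambda>s. if t = s then s else \<zero>\<^bsub>P\<^esub>) S"
        by (rule P.M.finsum_cong') (use S(2) in auto)
      also have "\<dots> = t"
        using P.M.finsum_singleton[OF t S(1), of "\<lambda>s. s"] S(2) by auto
      finally show "t \<in> ?q ` carrier ?F" by (intro image_eqI[of _ _ ?e]) auto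
    qed
    then show "carrier P \<subseteq> ?q ` carrier ?F"
      using P.span_least[OF submodule_image[OF F P q]] S(3) by blast
  qed (use mod_homD(1)[OF q] in auto)
  moreover have "(\<lambda>x. x) \<in> mod_hom R P P" by (rule mod_homI) auto
  ultimately obtain h where h: "h \<in> mod_hom R P ?F" "\<forall>x\<in>carrier P. ?q (h x) = x"
    using projective_lift[OF assms fg_free_module[OF P.R.ring_axioms S(1)] fgP q] by blast
  let ?g = "\<lambda>s. \<lambda>x\<in>carrier P. h x s"
  have "?g s \<in> carrier (ring_dual R P)" if "s \<in> S" for s
  proof -
    have hs: "h x s \<in> carrier R" if "x \<in> carrier P" for x
      using mod_homD(1)[OF h(1) that] \<open>s \<in> S\<close> by auto
    have "?g s \<in> mod_hom R P (regular_module R)"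
      by (rule mod_homI) (use hs mod_homD(2,3)[OF h(1)] that in simp_all)
    then show ?thesis by (simp add: ring_dual_def hom_module_def)
  qed
  moreover have "finsum P (\<lambda>s. ?g s x \<odot>\<^bsub>P\<^esub> s) S = x" if "x \<in> carrier P" for x
    using h(2) that by simp
  ultimately show ?thesis using S(1,2) by (intro exI[of _ S] exI[of _ ?g]) simp
qed


section \<open>Tensor products with projective modules\<close>

text \<open>
  For a projective right module \<open>P\<close> and a left module \<open>N\<close>, the tensor product \<open>P \<otimes> N\<close> is modelled by
  \<open>Hom(P*, N)\<close>, where the pure tensor \<open>a \<otimes> x\<close> becomes \<open>g \<mapsto> g(a) x\<close>.
\<close>

definition tensor :: "('k \<Rightarrow> 'r) \<Rightarrow> 'r ring \<Rightarrow> ('r, 'p) module \<Rightarrow> ('r, 'n) module \<Rightarrow> ('k, ('p \<Rightarrow> 'r) \<Rightarrow> 'n) module" where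
  "tensor \<phi> \<Lambda> P N = hom_module \<Lambda> (ring_dual (op_ring \<Lambda>) P) N (\<lambda>c w g. \<phi> c \<odot>\<^bsub>N\<^esub> w g)"

definition pure_tensor :: "'r ring \<Rightarrow> ('r, 'p) module \<Rightarrow> ('r, 'n) module \<Rightarrow> 'p \<Rightarrow> 'n \<Rightarrow> ('p \<Rightarrow> 'r) \<Rightarrow> 'n" where
  "pure_tensor \<Lambda> P N a x = (\<lambda>g\<in>carrier (ring_dual (op_ring \<Lambda>) P). g a \<odot>\<^bsub>N\<^esub> x)"

lemma finsum_regular_module: "finsum (regular_module R) = finsum R"
  by (simp add: finsum_def finprod_def fun_eq_iff regular_module_def)

lemma finsum_op_ring: "finsum (op_ring R) = finsum R"
  by (simp add: finsum_def finprod_def fun_eq_iff op_ring_def)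

lemma ring_dual_carrier:
  "g \<in> carrier (ring_dual R P) \<longleftrightarrow> g \<in> mod_hom R P (regular_module R) \<and> g \<in> extensional (carrier P)"
  by (simp add: ring_dual_def hom_module_def)

lemma ring_dual_closed: "g \<in> carrier (ring_dual R P) \<Longrightarrow> x \<in> carrier P \<Longrightarrow> g x \<in> carrier R"
  using mod_homD(1)[of g R P "regular_module R" x] by (simp add: ring_dual_carrier)

lemma ring_dual_add_arg:
  "g \<in> carrier (ring_dual R P) \<Longrightarrow> x \<in> carrier P \<Longrightarrow> y \<in> carrier P \<Longrightarrow> g (x \<oplus>\<^bsub>P\<^esub> y) = g x \<oplus>\<^bsub>R\<^esub> g y"
  using mod_homD(2)[of g R P "regular_module R" x] by (simp add: ring_dual_carrier)

lemma ring_dual_smult_arg: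
  "g \<in> carrier (ring_dual R P) \<Longrightarrow> a \<in> carrier R \<Longrightarrow> x \<in> carrier P \<Longrightarrow> g (a \<odot>\<^bsub>P\<^esub> x) = a \<otimes>\<^bsub>R\<^esub> g x"
  using mod_homD(3)[of g R P "regular_module R" a x] by (simp add: ring_dual_carrier)

lemma ring_dual_add: "x \<in> carrier P \<Longrightarrow> (g \<oplus>\<^bsub>ring_dual R P\<^esub> h) x = g x \<oplus>\<^bsub>R\<^esub> h x"
  by (simp add: ring_dual_def hom_module_def)

lemma ring_dual_smult: "x \<in> carrier P \<Longrightarrow> (a \<odot>\<^bsub>ring_dual R P\<^esub> g) x = g x \<otimes>\<^bsub>R\<^esub> a"
  by (simp add: ring_dual_def hom_module_def)

section \<open>Scalars from \<open>k\<close> and pure tensors\<close>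

locale artin_alg =
  fixes k :: "'k ring" and \<phi> :: "'k \<Rightarrow> 'r" and \<Lambda> :: "'r ring"
  assumes artin_algebra: "artin_algebra k \<phi> \<Lambda>"
begin

lemma ring_k: "ring k" and artinian_k: "artinian_cring k"
  using artin_algebra by (auto simp: artin_algebra_def artinian_cring_def cring_def)

lemma ring_\<Lambda>: "ring \<Lambda>"
  using artin_algebra by (simp add: artin_algebra_def)

lemma phi_hom: "\<phi> \<in> ring_hom k \<Lambda>"
  using artin_algebra by (simp add: artin_algebra_def)

lemma phi_closed [simp]: "c \<in> carrier k \<Longrightarrow> \<phi> c \<in> carrier \<Lambda>"
  using ring_hom_closed[OF phi_hom] .

lemma phi_central: "c \<in> carrier k \<Longrightarrow> a \<in> carrier \<Lambda> \<Longrightarrow> \<phi> c \<otimes>\<^bsub>\<Lambda>\<^esub> a = a \<otimes>\<^bsub>\<Lambda>\<^esub> \<phi> c"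
  using artin_algebra by (simp add: artin_algebra_def)

lemma phi_hom_op: "\<phi> \<in> ring_hom k (op_ring \<Lambda>)"
proof (rule ring_hom_memI)
  fix c d assume "c \<in> carrier k" "d \<in> carrier k"
  then show "\<phi> (c \<otimes>\<^bsub>k\<^esub> d) = \<phi> c \<otimes>\<^bsub>op_ring \<Lambda>\<^esub> \<phi> d"
    using phi_central[of d "\<phi> c"] by (simp add: ring_hom_mult[OF phi_hom])
qed (simp_all add: ring_hom_add[OF phi_hom] ring_hom_one[OF phi_hom])

lemma left_module_restrict: "left_module \<Lambda> M \<Longrightarrow> left_module k (restrict_scalars \<phi> M)"
  by (rule left_module_restrict_scalars[OF _ ring_k phi_hom])

lemma mod_hom_restrict:
  "h \<in> mod_hom \<Lambda> M N \<Longrightarrow> h \<in> mod_hom k (restrict_scalars \<phi> M) (restrict_scalars \<phi> N)"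
  by (rule mod_homI) (auto simp: mod_homD)

lemma submodule_restrict:
  assumes "left_module \<Lambda> M" "submodule N \<Lambda> M"
  shows "submodule N k (restrict_scalars \<phi> M)"
proof -
  interpret M: left_module \<Lambda> M by fact
  interpret k: left_module k "restrict_scalars \<phi> M" by (rule left_module_restrict[OF assms(1)])
  show ?thesis
    by (rule k.submodI) (use M.submodD[OF assms(2)] in auto)
qed

lemma left_module_dual_ring: "left_module (op_ring \<Lambda>) P \<Longrightarrow> left_module \<Lambda> (ring_dual (op_ring \<Lambda>) P)"
  using left_module_ring_dual[of "op_ring \<Lambda>" P] by simp

lemma op_dual_closed [simp]:
  "g \<in> carrier (ring_dual (op_ring \<Lambda>) P) \<Longrightarrow> a \<in> carrier P \<Longrightarrow> g a \<in> carrier \<Lambda>"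
  using ring_dual_closed[of g "op_ring \<Lambda>" P a] by simp

lemma tensor_carrier:
  "w \<in> carrier (tensor \<phi> \<Lambda> P N) \<longleftrightarrow>
     w \<in> mod_hom \<Lambda> (ring_dual (op_ring \<Lambda>) P) N \<and> w \<in> extensional (carrier (ring_dual (op_ring \<Lambda>) P))"
  by (simp add: tensor_def hom_module_def)

lemma tensor_hom: "w \<in> carrier (tensor \<phi> \<Lambda> P N) \<Longrightarrow> w \<in> mod_hom \<Lambda> (ring_dual (op_ring \<Lambda>) P) N"
  by (simp add: tensor_carrier)

lemma tensor_closed:
  "w \<in> carrier (tensor \<phi> \<Lambda> P N) \<Longrightarrow> g \<in> carrier (ring_dual (op_ring \<Lambda>) P) \<Longrightarrow> w g \<in> carrier N"
  by (rule mod_homD(1)[OF tensor_hom])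

lemma tensor_eqI:
  assumes "w \<in> carrier (tensor \<phi> \<Lambda> P N)" "v \<in> carrier (tensor \<phi> \<Lambda> P N)"
    and "\<And>g. g \<in> carrier (ring_dual (op_ring \<Lambda>) P) \<Longrightarrow> w g = v g"
  shows "w = v"
  by (rule extensionalityI[of _ "carrier (ring_dual (op_ring \<Lambda>) P)"])
    (use assms in \<open>auto simp: tensor_carrier\<close>)

lemma tensor_add:
  "g \<in> carrier (ring_dual (op_ring \<Lambda>) P) \<Longrightarrow> (w \<oplus>\<^bsub>tensor \<phi> \<Lambda> P N\<^esub> v) g = w g \<oplus>\<^bsub>N\<^esub> v g"
  by (simp add: tensor_def hom_module_def)

lemma tensor_smult:
  "g \<in> carrier (ring_dual (op_ring \<Lambda>) P) \<Longrightarrow> (c \<odot>\<^bsub>tensor \<phi> \<Lambda> P N\<^esub> w) g = \<phi> c \<odot>\<^bsub>N\<^esub> w g"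
  by (simp add: tensor_def hom_module_def)

lemma tensor_zero:
  "g \<in> carrier (ring_dual (op_ring \<Lambda>) P) \<Longrightarrow> \<zero>\<^bsub>tensor \<phi> \<Lambda> P N\<^esub> g = \<zero>\<^bsub>N\<^esub>"
  by (simp add: tensor_def hom_module_def)

text \<open>Centrality of the image of \<open>\<phi>\<close> is what makes a group of
  \<open>\<Lambda>\<close>-homomorphisms a module over \<open>k\<close>.\<close>

lemma phi_smult_commute:
  assumes "left_module \<Lambda> N" "c \<in> carrier k" "a \<in> carrier \<Lambda>" "x \<in> carrier N"
  shows "\<phi> c \<odot>\<^bsub>N\<^esub> (a \<odot>\<^bsub>N\<^esub> x) = a \<odot>\<^bsub>N\<^esub> (\<phi> c \<odot>\<^bsub>N\<^esub> x)"
proof -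
  interpret left_module \<Lambda> N by fact
  show ?thesis using phi_central[OF assms(2,3)] assms by (simp flip: smult_assoc)
qed

lemma left_module_tensor:
  assumes "left_module (op_ring \<Lambda>) P" "left_module \<Lambda> N"
  shows "left_module k (tensor \<phi> \<Lambda> P N)"
proof -
  interpret N: left_module \<Lambda> N by fact
  interpret D: left_module \<Lambda> "ring_dual (op_ring \<Lambda>) P" by (rule left_module_dual_ring[OF assms(1)])
  show ?thesis
    unfolding tensor_def
  proof (rule left_module_hom_module)
    show "(\<lambda>g. \<phi> c \<odot>\<^bsub>N\<^esub> w g) \<in> mod_hom \<Lambda> (ring_dual (op_ring \<Lambda>) P) N"
      if "c \<in> carrier k" "w \<in> mod_hom \<Lambda> (ring_dual (op_ring \<Lambda>) P) N" for c w
      by (rule mod_homI)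
        (use that(1) mod_homD[OF that(2)] in \<open>simp_all add: N.smult_r_distr phi_smult_commute[OF assms(2)]\<close>)
  qed (use D.left_module_axioms in \<open>simp_all add: assms ring_k N.smult_l_distr N.smult_r_distr N.smult_assoc mod_homD(1)
      ring_hom_add[OF phi_hom] ring_hom_mult[OF phi_hom] ring_hom_one[OF phi_hom]\<close>)
qed

lemma pure_tensor_apply:
  "g \<in> carrier (ring_dual (op_ring \<Lambda>) P) \<Longrightarrow> pure_tensor \<Lambda> P N a x g = g a \<odot>\<^bsub>N\<^esub> x"
  by (simp add: pure_tensor_def)

lemma pure_tensor_closed [simp]:
  assumes "left_module (op_ring \<Lambda>) P" "left_module \<Lambda> N" "a \<in> carrier P" "x \<in> carrier N"
  shows "pure_tensor \<Lambda> P N a x \<in> carrier (tensor \<phi> \<Lambda> P N)"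
proof -
  interpret N: left_module \<Lambda> N by fact
  interpret D: left_module \<Lambda> "ring_dual (op_ring \<Lambda>) P" by (rule left_module_dual_ring[OF assms(1)])
  have "pure_tensor \<Lambda> P N a x \<in> mod_hom \<Lambda> (ring_dual (op_ring \<Lambda>) P) N"
    by (rule mod_homI)
      (use assms(3,4) in \<open>auto simp: pure_tensor_apply ring_dual_add ring_dual_smult
        N.smult_l_distr N.smult_assoc\<close>)
  then show ?thesis by (simp add: tensor_carrier pure_tensor_def)
qed

lemma pure_tensor_add_left:
  assumes "left_module (op_ring \<Lambda>) P" "left_module \<Lambda> N" "a \<in> carrier P" "b \<in> carrier P" "x \<in> carrier N"
  shows "pure_tensor \<Lambda> P N (a \<oplus>\<^bsub>P\<^esub> b) x = pure_tensor \<Lambda> P N a x \<oplus>\<^bsub>tensor \<phi> \<Lambda> P N\<^esub> pure_tensor \<Lambda> P N b x"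
proof -
  interpret P: left_module "op_ring \<Lambda>" P by fact
  interpret N: left_module \<Lambda> N by fact
  interpret H: left_module k "tensor \<phi> \<Lambda> P N" by (rule left_module_tensor[OF assms(1,2)])
  show ?thesis
    by (rule tensor_eqI[of _ P N])
      (use assms in \<open>auto simp: tensor_add pure_tensor_apply ring_dual_add_arg N.smult_l_distr\<close>)
qed

lemma pure_tensor_add_right:
  assumes "left_module (op_ring \<Lambda>) P" "left_module \<Lambda> N" "a \<in> carrier P" "x \<in> carrier N" "y \<in> carrier N"
  shows "pure_tensor \<Lambda> P N a (x \<oplus>\<^bsub>N\<^esub> y) = pure_tensor \<Lambda> P N a x \<oplus>\<^bsub>tensor \<phi> \<Lambda> P N\<^esub> pure_tensor \<Lambda> P N a y"
proof -
  interpret P: left_module "op_ring \<Lambda>" P by fact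
  interpret N: left_module \<Lambda> N by fact
  interpret H: left_module k "tensor \<phi> \<Lambda> P N" by (rule left_module_tensor[OF assms(1,2)])
  show ?thesis
    by (rule tensor_eqI[of _ P N])
      (use assms in \<open>auto simp: tensor_add pure_tensor_apply N.smult_r_distr\<close>)
qed

lemma pure_tensor_balanced:
  assumes "left_module (op_ring \<Lambda>) P" "left_module \<Lambda> N" "a \<in> carrier P" "x \<in> carrier N" "l \<in> carrier \<Lambda>"
  shows "pure_tensor \<Lambda> P N (l \<odot>\<^bsub>P\<^esub> a) x = pure_tensor \<Lambda> P N a (l \<odot>\<^bsub>N\<^esub> x)"
proof -
  interpret P: left_module "op_ring \<Lambda>" P by fact
  interpret N: left_module \<Lambda> N by fact
  have "l \<odot>\<^bsub>P\<^esub> a \<in> carrier P" using P.smult_closed[of l a] assms by simp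
  then show ?thesis
    by (intro tensor_eqI[of _ P N] pure_tensor_closed)
      (use assms ring_dual_closed[of _ "op_ring \<Lambda>" P a] in
        \<open>auto simp: pure_tensor_apply ring_dual_smult_arg N.smult_assoc\<close>)
qed

lemma pure_tensor_smult_left:
  assumes "left_module (op_ring \<Lambda>) P" "left_module \<Lambda> N" "a \<in> carrier P" "x \<in> carrier N" "c \<in> carrier k"
  shows "pure_tensor \<Lambda> P N (\<phi> c \<odot>\<^bsub>P\<^esub> a) x = c \<odot>\<^bsub>tensor \<phi> \<Lambda> P N\<^esub> pure_tensor \<Lambda> P N a x"
proof -
  interpret P: left_module "op_ring \<Lambda>" P by fact
  interpret N: left_module \<Lambda> N by fact
  interpret H: left_module k "tensor \<phi> \<Lambda> P N" by (rule left_module_tensor[OF assms(1,2)])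
  have "\<phi> c \<odot>\<^bsub>P\<^esub> a \<in> carrier P" using P.smult_closed[of "\<phi> c" a] assms by simp
  then show ?thesis
    by (intro tensor_eqI[of _ P N])
      (use assms ring_dual_closed[of _ "op_ring \<Lambda>" P a] in
        \<open>auto simp: pure_tensor_apply ring_dual_smult_arg tensor_smult N.smult_assoc phi_smult_commute[OF assms(2)]\<close>)
qed

text \<open>The functionals \<open>e s\<close> generate P*: g is the sum of the g(s) e_s, as one
  sees by evaluating at \<open>x\<close> and expanding \<open>x\<close> in the dual basis. In terms
  of tensors, \<open>w\<close> is the sum of the pure tensors s \<otimes> w (e s).\<close>

lemma dual_basis_expansion:
  assumes P: "left_module (op_ring \<Lambda>) P" and N: "left_module \<Lambda> N"
    and S: "finite S" "S \<subseteq> carrier P" and e: "\<And>s. s \<in> S \<Longrightarrow> e s \<in> carrier (ring_dual (op_ring \<Lambda>) P)"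
    and basis: "\<And>x. x \<in> carrier P \<Longrightarrow> finsum P (\<lambda>s. e s x \<odot>\<^bsub>P\<^esub> s) S = x"
    and w: "w \<in> mod_hom \<Lambda> (ring_dual (op_ring \<Lambda>) P) N" and g: "g \<in> carrier (ring_dual (op_ring \<Lambda>) P)"
  shows "w g = finsum N (\<lambda>s. g s \<odot>\<^bsub>N\<^esub> w (e s)) S"
proof -
  let ?D = "ring_dual (op_ring \<Lambda>) P"
  interpret P: left_module "op_ring \<Lambda>" P by fact
  interpret N: left_module \<Lambda> N by fact
  interpret D: left_module \<Lambda> ?D by (rule left_module_dual_ring[OF P])
  have V: "left_module \<Lambda> (regular_module \<Lambda>)" "left_module (op_ring \<Lambda>) (regular_module (op_ring \<Lambda>))"
    by (rule left_module_regular_module, rule ring_\<Lambda>)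
      (rule left_module_regular_module[OF ring_op_ring[OF ring_\<Lambda>]])
  have gs: "g s \<in> carrier \<Lambda>" if "s \<in> S" for s using ring_dual_closed[OF g, of s] S(2) that by auto
  have cl: "(\<lambda>s. g s \<odot>\<^bsub>?D\<^esub> e s) \<in> S \<rightarrow> carrier ?D" using gs e by auto
  have "g = finsum ?D (\<lambda>s. g s \<odot>\<^bsub>?D\<^esub> e s) S"
  proof (rule extensionalityI[of _ "carrier P"])
    show "g \<in> extensional (carrier P)" using g by (simp add: ring_dual_carrier)
    show "finsum ?D (\<lambda>s. g s \<odot>\<^bsub>?D\<^esub> e s) S \<in> extensional (carrier P)"
      using D.M.finsum_closed[OF cl] by (simp add: ring_dual_carrier)
    fix x assume x: "x \<in> carrier P"
    have ev: "(\<lambda>h. h x) \<in> mod_hom \<Lambda> ?D (regular_module \<Lambda>)"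
      by (rule mod_homI) (use x ring_dual_closed[of _ "op_ring \<Lambda>" P x] in
          \<open>auto simp: ring_dual_add ring_dual_smult\<close>)
    have ex: "e s x \<in> carrier \<Lambda>" if "s \<in> S" for s using ring_dual_closed[OF e[OF that] x] by simp
    have cl': "(\<lambda>s. e s x \<odot>\<^bsub>P\<^esub> s) \<in> S \<rightarrow> carrier P" using ex S(2) P.smult_closed by auto
    have "g x = g (finsum P (\<lambda>s. e s x \<odot>\<^bsub>P\<^esub> s) S)" using basis[OF x] by simp
    also have "\<dots> = finsum (regular_module (op_ring \<Lambda>)) (\<lambda>s. g (e s x \<odot>\<^bsub>P\<^esub> s)) S"
      by (rule mod_hom_finsum[OF P V(2) _ S(1) cl']) (use g in \<open>simp add: ring_dual_carrier\<close>)
    also have "\<dots> = finsum (regular_module \<Lambda>) (\<lambda>s. g (e s x \<odot>\<^bsub>P\<^esub> s)) S"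
      by (simp add: finsum_regular_module finsum_op_ring)
    also have "\<dots> = finsum (regular_module \<Lambda>) (\<lambda>s. (g s \<odot>\<^bsub>?D\<^esub> e s) x) S"
      using left_module.axioms(2)[OF V(1)] gs ex S(2) ring_dual_smult_arg[OF g] ring_dual_smult[OF x]
      by (intro abelian_monoid.finsum_cong')
        (auto simp: abelian_group_def subset_iff ring.ring_simprules(5)[OF ring_\<Lambda>])
    also have "\<dots> = finsum ?D (\<lambda>s. g s \<odot>\<^bsub>?D\<^esub> e s) S x"
      by (rule mod_hom_finsum[OF D.left_module_axioms V(1) ev S(1) cl, symmetric])
    finally show "g x = finsum ?D (\<lambda>s. g s \<odot>\<^bsub>?D\<^esub> e s) S x" .
  qed
  then have "w g = w (finsum ?D (\<lambda>s. g s \<odot>\<^bsub>?D\<^esub> e s) S)" by simp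
  also have "\<dots> = finsum N (\<lambda>s. w (g s \<odot>\<^bsub>?D\<^esub> e s)) S"
    by (rule mod_hom_finsum[OF D.left_module_axioms N w S(1) cl])
  also have "\<dots> = finsum N (\<lambda>s. g s \<odot>\<^bsub>N\<^esub> w (e s)) S"
    by (rule N.M.finsum_cong') (use gs e mod_homD(1,3)[OF w] in auto)
  finally show ?thesis .
qed

lemma tensor_eval_hom:
  assumes "g \<in> carrier (ring_dual (op_ring \<Lambda>) P)"
  shows "(\<lambda>w. w g) \<in> mod_hom k (tensor \<phi> \<Lambda> P N) (restrict_scalars \<phi> N)"
  by (rule mod_homI) (use assms tensor_closed in \<open>auto simp: tensor_add tensor_smult\<close>)

text \<open>A tensor is determined by its finitely many values at the \<open>e s\<close>, each in
  \<open>N\<close>. This finiteness is what allows functionals to be extended to P0 \<otimes>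
  E.\<close>

lemma finite_length_tensor:
  assumes P: "projective_module (op_ring \<Lambda>) P" and N: "left_module \<Lambda> N"
    and fin: "finite_length k (restrict_scalars \<phi> N) (carrier N)"
  shows "finite_length k (tensor \<phi> \<Lambda> P N) (carrier (tensor \<phi> \<Lambda> P N))"
proof -
  have lP: "left_module (op_ring \<Lambda>) P" using P by (simp add: projective_module_def fg_module_def)
  let ?H = "tensor \<phi> \<Lambda> P N" and ?N = "restrict_scalars \<phi> N"
  have H: "left_module k ?H" by (rule left_module_tensor[OF lP N])
  have N': "left_module k ?N" by (rule left_module_restrict[OF N])
  interpret H: left_module k ?H by (rule H)
  interpret N': left_module k ?N by (rule N')
  interpret N: left_module \<Lambda> N by (rule N)
  from projective_dual_basis[OF P] obtain S e where
    "finite S \<and> S \<subseteq> carrier P \<and> (\<forall>s\<in>S. e s \<in> carrier (ring_dual (op_ring \<Lambda>) P)) \<and>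
      (\<forall>x\<in>carrier P. finsum P (\<lambda>s. e s x \<odot>\<^bsub>P\<^esub> s) S = x)" by (elim exE)
  then have S: "finite S" "S \<subseteq> carrier P"
    and e: "\<And>s. s \<in> S \<Longrightarrow> e s \<in> carrier (ring_dual (op_ring \<Lambda>) P)"
    and basis: "\<And>x. x \<in> carrier P \<Longrightarrow> finsum P (\<lambda>s. e s x \<odot>\<^bsub>P\<^esub> s) S = x" by simp_all
  \<comment> \<open>\<open>T\<close> is the set of coordinates that may be nonzero. For empty
    \<open>T\<close> the dual basis expansion leaves only zero; enlarging \<open>T\<close> by
    \<open>t\<close> adds a layer that evaluation at \<open>e t\<close> embeds into
    \<open>N\<close>; for T = S the whole tensor product is reached.\<close>
  have "finite T \<Longrightarrow> T \<subseteq> S \<Longrightarrow>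
    finite_length k ?H {w \<in> carrier ?H. \<forall>s\<in>S - T. w (e s) = \<zero>\<^bsub>N\<^esub>} \<and>
    submodule {w \<in> carrier ?H. \<forall>s\<in>S - T. w (e s) = \<zero>\<^bsub>N\<^esub>} k ?H" for T
  proof (induction T rule: finite_induct)
    case empty
    have "w = \<zero>\<^bsub>?H\<^esub>" if w: "w \<in> carrier ?H" "\<forall>s\<in>S. w (e s) = \<zero>\<^bsub>N\<^esub>" for w
    proof (rule tensor_eqI[OF w(1) H.M.zero_closed])
      fix g assume g: "g \<in> carrier (ring_dual (op_ring \<Lambda>) P)"
      have "w g = finsum N (\<lambda>s. g s \<odot>\<^bsub>N\<^esub> w (e s)) S"
        by (rule dual_basis_expansion[OF lP N S e basis tensor_hom[OF w(1)] g])
      also have "\<dots> = finsum N (\<lambda>s. \<zero>\<^bsub>N\<^esub>) S"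
        using w(2) ring_dual_closed[OF g] S(2) by (intro N.M.finsum_cong') auto
      also have "\<dots> = \<zero>\<^bsub>N\<^esub>" by simp
      finally show "w g = \<zero>\<^bsub>?H\<^esub> g" using g by (simp add: tensor_zero)
    qed
    then have "{w \<in> carrier ?H. \<forall>s\<in>S - {}. w (e s) = \<zero>\<^bsub>N\<^esub>} = {\<zero>\<^bsub>?H\<^esub>}"
      using e by (auto simp: tensor_zero)
    then show ?case using H.submodule_zero by simp
  next
    case (insert t T)
    let ?A = "{w \<in> carrier ?H. \<forall>s\<in>S - insert t T. w (e s) = \<zero>\<^bsub>N\<^esub>}"
    have t: "t \<in> S" using insert by auto
    note ev = tensor_eval_hom[OF e[OF t], of N]
    have A: "submodule ?A k ?H"
      by (rule H.submodI) (use e in \<open>auto simp: tensor_zero tensor_add tensor_smult\<close>)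
    have "{w \<in> ?A. w (e t) = \<zero>\<^bsub>?N\<^esub>} = {w \<in> carrier ?H. \<forall>s\<in>S - T. w (e s) = \<zero>\<^bsub>N\<^esub>}"
      using t insert.hyps by auto
    moreover have "finite_length k ?N ((\<lambda>w. w (e t)) ` ?A)"
      by (rule N'.finite_length_mono[OF _ submodule_image_of[OF H N' ev A]])
        (use fin e[OF t] tensor_closed in auto)
    ultimately have "finite_length k ?H ?A"
      using finite_length_extension[OF H N' ev A] insert by simp
    with A show ?case by simp
  qed
  from this[OF S(1) order_refl] show ?thesis by simp
qed

end


section \<open>Retractions from the transpose\<close>

lemma hom_factor_inj:
  assumes "left_module R M" "left_module R K" "i \<in> mod_hom R K E" "inj_on i (carrier K)" "u \<in> mod_hom R M E"
    and im: "\<And>x. x \<in> carrier M \<Longrightarrow> u x \<in> i ` carrier K"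
  shows "\<exists>v\<in>mod_hom R M K. \<forall>x\<in>carrier M. i (v x) = u x"
proof -
  interpret M: left_module R M by fact
  interpret K: left_module R K by fact
  define v where "v x = inv_into (carrier K) i (u x)" for x
  have v: "v x \<in> carrier K" "i (v x) = u x" if "x \<in> carrier M" for x
    using im[OF that] by (auto simp: v_def inv_into_into f_inv_into_f)
  note i = mod_homD[OF assms(3)] and u = mod_homD[OF assms(5)]
  have "v \<in> mod_hom R M K"
  proof (rule mod_homI)
    fix x y assume "x \<in> carrier M" "y \<in> carrier M"
    then show "v (x \<oplus>\<^bsub>M\<^esub> y) = v x \<oplus>\<^bsub>K\<^esub> v y"
      by (intro inj_onD[OF assms(4)]) (simp_all add: v i u)
  next
    fix a x assume "a \<in> carrier R" "x \<in> carrier M"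
    then show "v (a \<odot>\<^bsub>M\<^esub> x) = a \<odot>\<^bsub>K\<^esub> v x"
      by (intro inj_onD[OF assms(4)]) (simp_all add: v i u)
  qed (rule v)
  then show ?thesis using v(2) by blast
qed

locale dual_presentation = matlis_dual k \<iota> J + artin_alg k \<phi> \<Lambda>
  for k :: "'k ring" and \<iota> :: "'k set \<Rightarrow> 'j" and J :: "('k, 'j) module"
    and \<phi> :: "'k \<Rightarrow> 'r" and \<Lambda> :: "'r ring" +
  fixes K :: "('r, 'a) module" and P1 :: "('r, 'p1) module" and f :: "'p1 \<Rightarrow> 'p0"
    and P0 :: "('r, 'p0) module" and p :: "'p0 \<Rightarrow> 'a \<Rightarrow> 'j"
  assumes K: "left_module \<Lambda> K"
    and fin_K: "finite_length k (restrict_scalars \<phi> K) (carrier K)"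
    and proj_P1: "projective_module (op_ring \<Lambda>) P1"
    and proj_P0: "projective_module (op_ring \<Lambda>) P0"
    and f: "f \<in> mod_hom (op_ring \<Lambda>) P1 P0"
    and p: "p \<in> mod_hom (op_ring \<Lambda>) P0 (dual_module k \<phi> J K)"
    and p_surj: "p ` carrier P0 = carrier (dual_module k \<phi> J K)"
    and exact: "f ` carrier P1 = {a \<in> carrier P0. p a = \<zero>\<^bsub>dual_module k \<phi> J K\<^esub>}"
begin

abbreviation "DK \<equiv> dual_module k \<phi> J K"
abbreviation "P0_dual \<equiv> ring_dual (op_ring \<Lambda>) P0"
abbreviation "P1_dual \<equiv> ring_dual (op_ring \<Lambda>) P1"
abbreviation "f_dual \<equiv> \<lambda>g. \<lambda>x\<in>carrier P1. g (f x)"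
abbreviation "T \<equiv> transpose_module (op_ring \<Lambda>) P1 f P0"

lemma P0: "left_module (op_ring \<Lambda>) P0" and P1: "left_module (op_ring \<Lambda>) P1"
  using proj_P0 proj_P1 by (auto simp: projective_module_def fg_module_def)

lemma DK: "left_module (op_ring \<Lambda>) DK"
  by (rule left_module_dual_module[OF artin_algebra left_module_J K])

sublocale K: left_module \<Lambda> K by (rule K)
sublocale P0: left_module "op_ring \<Lambda>" P0 by (rule P0)
sublocale P1: left_module "op_ring \<Lambda>" P1 by (rule P1)
sublocale DK: left_module "op_ring \<Lambda>" DK by (rule DK)
sublocale P0_dual: left_module \<Lambda> P0_dual by (rule left_module_dual_ring[OF P0])
sublocale P1_dual: left_module \<Lambda> P1_dual by (rule left_module_dual_ring[OF P1])

lemma f_dual: "f_dual \<in> mod_hom \<Lambda> P0_dual P1_dual"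
  using ring_dual_map[OF P1 P0 f] by simp

lemma T: "left_module \<Lambda> T"
  using left_module_transpose_module[OF P1 P0 f] by simp

lemma f_closed [simp]: "b \<in> carrier P1 \<Longrightarrow> f b \<in> carrier P0"
  by (rule mod_homD(1)[OF f])

lemma DK_carrier: "g \<in> carrier DK \<longleftrightarrow> g \<in> mod_hom k (restrict_scalars \<phi> K) J \<and> g \<in> extensional (carrier K)"
  by (simp add: dual_module_def hom_module_def)

lemma DK_closed: "g \<in> carrier DK \<Longrightarrow> v \<in> carrier K \<Longrightarrow> g v \<in> carrier J"
  using mod_homD(1)[of g k "restrict_scalars \<phi> K" J v] by (simp add: DK_carrier)

lemma p_closed [simp]: "a \<in> carrier P0 \<Longrightarrow> p a \<in> carrier DK"
  by (rule mod_homD(1)[OF p])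

lemma p_apply_closed [simp]: "a \<in> carrier P0 \<Longrightarrow> v \<in> carrier K \<Longrightarrow> p a v \<in> carrier J"
  using DK_closed[OF p_closed] .

lemma p_apply_add: "a \<in> carrier P0 \<Longrightarrow> v \<in> carrier K \<Longrightarrow> w \<in> carrier K \<Longrightarrow> p a (v \<oplus>\<^bsub>K\<^esub> w) = p a v \<oplus>\<^bsub>J\<^esub> p a w"
  using p_closed[of a] mod_homD(2)[of "p a" k "restrict_scalars \<phi> K" J v w] by (simp add: DK_carrier)

lemma p_apply_phi: "a \<in> carrier P0 \<Longrightarrow> v \<in> carrier K \<Longrightarrow> c \<in> carrier k \<Longrightarrow> p a (\<phi> c \<odot>\<^bsub>K\<^esub> v) = c \<odot>\<^bsub>J\<^esub> p a v"
  using p_closed[of a] mod_homD(3)[of "p a" k "restrict_scalars \<phi> K" J c v] by (simp add: DK_carrier)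

lemma DK_add: "v \<in> carrier K \<Longrightarrow> (g \<oplus>\<^bsub>DK\<^esub> h) v = g v \<oplus>\<^bsub>J\<^esub> h v"
  by (simp add: dual_module_def hom_module_def)

lemma p_balanced: "a \<in> carrier P0 \<Longrightarrow> v \<in> carrier K \<Longrightarrow> l \<in> carrier \<Lambda> \<Longrightarrow> p (l \<odot>\<^bsub>P0\<^esub> a) v = p a (l \<odot>\<^bsub>K\<^esub> v)"
  using mod_homD(3)[OF p, of l a] by (simp add: dual_module_def hom_module_def)

text \<open>This is P0 \<otimes> K \<rightarrow> DK \<otimes> K \<rightarrow> J. As tensors are
  homomorphisms here, a rule on pure tensors does not by itself define a map; \<open>w\<close> being
  the sum of s \<otimes> w (e s) for a dual basis dictates the sum of the p s (w (e s)).\<close>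

lemma evaluation_exists:
  "\<exists>ev\<in>mod_hom k (tensor \<phi> \<Lambda> P0 K) J. \<forall>a\<in>carrier P0. \<forall>v\<in>carrier K. ev (pure_tensor \<Lambda> P0 K a v) = p a v"
proof -
  let ?H = "tensor \<phi> \<Lambda> P0 K"
  from projective_dual_basis[OF proj_P0] obtain S e where
    "finite S \<and> S \<subseteq> carrier P0 \<and> (\<forall>s\<in>S. e s \<in> carrier P0_dual) \<and>
      (\<forall>x\<in>carrier P0. finsum P0 (\<lambda>s. e s x \<odot>\<^bsub>P0\<^esub> s) S = x)" by (elim exE)
  then have S: "finite S" "\<And>s. s \<in> S \<Longrightarrow> s \<in> carrier P0"
    and e: "\<And>s. s \<in> S \<Longrightarrow> e s \<in> carrier P0_dual"
    and basis: "\<And>x. x \<in> carrier P0 \<Longrightarrow> finsum P0 (\<lambda>s. e s x \<odot>\<^bsub>P0\<^esub> s) S = x" by auto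
  let ?ev = "\<lambda>w. finsum J (\<lambda>s. p s (w (e s))) S"
  have cl: "(\<lambda>s. p s (w (e s))) \<in> S \<rightarrow> carrier J" if "w \<in> carrier ?H" for w
    using S(2) e tensor_closed[OF that] by auto
  have "?ev \<in> mod_hom k ?H J"
  proof (rule mod_homI)
    fix w assume w: "w \<in> carrier ?H"
    show "?ev w \<in> carrier J" by (rule J.M.finsum_closed[OF cl[OF w]])
    fix c assume c: "c \<in> carrier k"
    have mul: "(\<lambda>j. c \<odot>\<^bsub>J\<^esub> j) \<in> mod_hom k J J"
    proof (rule mod_homI)
      fix d j assume "d \<in> carrier k" "j \<in> carrier J"
      then show "c \<odot>\<^bsub>J\<^esub> (d \<odot>\<^bsub>J\<^esub> j) = d \<odot>\<^bsub>J\<^esub> (c \<odot>\<^bsub>J\<^esub> j)"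
        using c J.smult_assoc[of c d j] J.smult_assoc[of d c j] k.m_comm[of c d] by simp
    qed (use c in \<open>auto simp: J.smult_r_distr\<close>)
    have "?ev (c \<odot>\<^bsub>?H\<^esub> w) = finsum J (\<lambda>s. c \<odot>\<^bsub>J\<^esub> p s (w (e s))) S"
      by (rule J.M.finsum_cong')
        (use S(2) e c tensor_closed[OF w] in \<open>auto simp: tensor_smult p_apply_phi\<close>)
    then show "?ev (c \<odot>\<^bsub>?H\<^esub> w) = c \<odot>\<^bsub>J\<^esub> ?ev w"
      using mod_hom_finsum[OF left_module_J left_module_J mul S(1) cl[OF w]] by simp
  next
    fix w v assume w: "w \<in> carrier ?H" and v: "v \<in> carrier ?H"
    have "?ev (w \<oplus>\<^bsub>?H\<^esub> v) = finsum J (\<lambda>s. p s (w (e s)) \<oplus>\<^bsub>J\<^esub> p s (v (e s))) S"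
      by (rule J.M.finsum_cong')
        (use S(2) e tensor_closed[OF w] tensor_closed[OF v] in \<open>auto simp: tensor_add p_apply_add\<close>)
    then show "?ev (w \<oplus>\<^bsub>?H\<^esub> v) = ?ev w \<oplus>\<^bsub>J\<^esub> ?ev v"
      using J.M.finsum_addf[OF cl[OF w] cl[OF v]] by simp
  qed
  \<comment> \<open>Balancing moves each coefficient e s a from \<open>v\<close> over to
    \<open>s\<close>, and the sum of the (e s a) s is \<open>a\<close>.\<close>
  moreover have "?ev (pure_tensor \<Lambda> P0 K a v) = p a v" if a: "a \<in> carrier P0" and v: "v \<in> carrier K" for a v
  proof -
    have es: "e s a \<in> carrier \<Lambda>" if "s \<in> S" for s using e[OF that] a by simp
    have cl': "(\<lambda>s. e s a \<odot>\<^bsub>P0\<^esub> s) \<in> S \<rightarrow> carrier P0" using es S(2) P0.smult_closed by auto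
    have "p a v = p (finsum P0 (\<lambda>s. e s a \<odot>\<^bsub>P0\<^esub> s) S) v" using basis[OF a] by simp
    also have "\<dots> = finsum J (\<lambda>s. p (e s a \<odot>\<^bsub>P0\<^esub> s) v) S"
      by (rule hom_finsum[OF P0.M.abelian_group_axioms J.M.abelian_group_axioms _ _ S(1) cl'])
        (use v mod_homD(2)[OF p] in \<open>auto simp: DK_add\<close>)
    also have "\<dots> = ?ev (pure_tensor \<Lambda> P0 K a v)"
      by (rule J.M.finsum_cong')
        (use es S(2) e v in \<open>auto simp: p_balanced pure_tensor_apply\<close>)
    finally show ?thesis by simp
  qed
  ultimately show ?thesis by (intro bexI[of _ ?ev] ballI)
qed

text \<open>Composition with \<open>f_dual\<close> is f \<otimes> K, so \<open>w\<close> is the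
  image of \<open>u\<close>. Writing \<open>u\<close> as the sum of s \<otimes> u (e s) makes
  \<open>w\<close> the sum of f s \<otimes> u (e s), on which \<open>ev\<close> is zero because p f
  = 0. So \<open>ev\<close> descends to DK \<otimes> K.\<close>

lemma evaluation_boundary:
  assumes ev: "ev \<in> mod_hom k (tensor \<phi> \<Lambda> P0 K) J"
    and ev_pure: "\<And>a v. \<lbrakk> a \<in> carrier P0; v \<in> carrier K \<rbrakk> \<Longrightarrow> ev (pure_tensor \<Lambda> P0 K a v) = p a v"
    and w: "w \<in> carrier (tensor \<phi> \<Lambda> P0 K)" and u: "u \<in> mod_hom \<Lambda> P1_dual K"
    and wu: "\<And>g. g \<in> carrier P0_dual \<Longrightarrow> w g = u (f_dual g)"
  shows "ev w = \<zero>\<^bsub>J\<^esub>"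
proof -
  let ?H = "tensor \<phi> \<Lambda> P0 K"
  have H: "left_module k ?H" by (rule left_module_tensor[OF P0 K])
  interpret H: left_module k ?H by (rule H)
  from projective_dual_basis[OF proj_P1] obtain S e where
    "finite S \<and> S \<subseteq> carrier P1 \<and> (\<forall>s\<in>S. e s \<in> carrier P1_dual) \<and>
      (\<forall>x\<in>carrier P1. finsum P1 (\<lambda>s. e s x \<odot>\<^bsub>P1\<^esub> s) S = x)" by (elim exE)
  then have S: "finite S" "S \<subseteq> carrier P1" "\<And>s. s \<in> S \<Longrightarrow> s \<in> carrier P1"
    and e: "\<And>s. s \<in> S \<Longrightarrow> e s \<in> carrier P1_dual"
    and basis: "\<And>x. x \<in> carrier P1 \<Longrightarrow> finsum P1 (\<lambda>s. e s x \<odot>\<^bsub>P1\<^esub> s) S = x" by auto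
  have ue: "u (e s) \<in> carrier K" if "s \<in> S" for s using mod_homD(1)[OF u e[OF that]] .
  let ?t = "\<lambda>s. pure_tensor \<Lambda> P0 K (f s) (u (e s))"
  have cl: "?t \<in> S \<rightarrow> carrier ?H" using S(3) ue P0 K by auto
  have "w = finsum ?H ?t S"
  proof (rule tensor_eqI[OF w H.M.finsum_closed[OF cl]])
    fix g assume g: "g \<in> carrier P0_dual"
    have "w g = finsum K (\<lambda>s. f_dual g s \<odot>\<^bsub>K\<^esub> u (e s)) S"
      unfolding wu[OF g]
      by (rule dual_basis_expansion[OF P1 K S(1,2) e basis u mod_homD(1)[OF f_dual g]])
    also have "\<dots> = finsum K (\<lambda>s. ?t s g) S"
      by (rule K.M.finsum_cong') (use S(3) ue g in \<open>auto simp: pure_tensor_apply\<close>)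
    also have "\<dots> = finsum ?H ?t S g"
      by (rule hom_finsum[OF H.M.abelian_group_axioms K.M.abelian_group_axioms _ _ S(1) cl, symmetric])
        (use g tensor_closed in \<open>auto simp: tensor_add\<close>)
    finally show "w g = finsum ?H ?t S g" .
  qed
  then have "ev w = finsum J (\<lambda>s. ev (?t s)) S"
    using mod_hom_finsum[OF H left_module_J ev S(1) cl] by simp
  also have "\<dots> = finsum J (\<lambda>s. \<zero>\<^bsub>J\<^esub>) S"
  proof (rule J.M.finsum_cong')
    fix s assume s: "s \<in> S"
    have "p (f s) = \<zero>\<^bsub>DK\<^esub>" using exact S(3)[OF s] by blast
    then show "ev (?t s) = \<zero>\<^bsub>J\<^esub>"
      using ev_pure[OF f_closed[OF S(3)[OF s]] ue[OF s]] ue[OF s]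
      by (simp add: dual_module_def hom_module_def)
  qed auto
  finally show ?thesis by simp
qed

text \<open>Injectivity of K \<rightarrow> D D K: every functional on \<open>K\<close> is some
  \<open>p a\<close>, because \<open>p\<close> is onto. Elements of \<open>K\<close> can therefore
  be compared by testing against \<open>P0\<close>.\<close>

lemma p_separates:
  assumes "v \<in> carrier K" "w \<in> carrier K" "\<And>a. a \<in> carrier P0 \<Longrightarrow> p a v = p a w"
  shows "v = w"
proof (rule ccontr)
  assume "v \<noteq> w"
  let ?W = "restrict_scalars \<phi> K"
  have W: "left_module k ?W" by (rule left_module_restrict[OF K])
  interpret W: left_module k ?W by (rule W)
  have "v \<ominus>\<^bsub>?W\<^esub> w \<in> carrier ?W" using W.M.minus_closed[of v w] assms(1,2) by simp
  moreover have "v \<ominus>\<^bsub>?W\<^esub> w \<noteq> \<zero>\<^bsub>?W\<^esub>" using W.minus_zero_iff[of v w] assms(1,2) \<open>v \<noteq> w\<close> by simp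
  ultimately obtain g where g: "g \<in> mod_hom k ?W J" "g (v \<ominus>\<^bsub>?W\<^esub> w) \<noteq> \<zero>\<^bsub>J\<^esub>"
    using dual_separates[OF W] fin_K by auto
  have "restrict g (carrier K) \<in> carrier DK"
    unfolding DK_carrier using mod_hom_cong[OF g(1) _ W] by auto
  then obtain a where a: "a \<in> carrier P0" "p a = restrict g (carrier K)" using p_surj by (metis imageE)
  have "g v = g w" using assms(3)[OF a(1)] a(2) assms(1,2) by simp
  then have "g (v \<ominus>\<^bsub>?W\<^esub> w) = \<zero>\<^bsub>J\<^esub>"
    using mod_hom_minus[OF W left_module_J g(1), of v w] mod_homD(1)[OF g(1), of w] assms(1,2)
    by (simp add: a_minus_def J.M.r_neg)
  then show False using g(2) by simp
qed

text \<open>Surjectivity of K \<rightarrow> D D K, seen from \<open>P0\<close>: a functional that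
  kills the image of \<open>f\<close>, which is the kernel of \<open>p\<close>, factors through
  \<open>p\<close> as a functional on \<open>DK\<close>.\<close>

lemma functional_representable:
  assumes \<eta>: "\<eta> \<in> mod_hom k (restrict_scalars \<phi> P0) J"
    and ker: "\<And>b. b \<in> carrier P1 \<Longrightarrow> \<eta> (f b) = \<zero>\<^bsub>J\<^esub>"
  shows "\<exists>v\<in>carrier K. \<forall>a\<in>carrier P0. \<eta> a = p a v"
proof -
  let ?W = "restrict_scalars \<phi> K" and ?P = "restrict_scalars \<phi> P0"
  have W: "left_module k ?W" by (rule left_module_restrict[OF K])
  interpret W: left_module k ?W by (rule W)
  have car: "carrier (dual ?W) = carrier DK" "\<zero>\<^bsub>dual ?W\<^esub> = \<zero>\<^bsub>DK\<^esub>"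
    by (simp_all add: dual_module_def hom_module_def)
  have P: "left_module k ?P" by (rule left_module_restrict_scalars[OF P0 ring_k phi_hom_op])
  have p': "p \<in> mod_hom k ?P (dual ?W)"
  proof (rule mod_homI)
    show "p x \<in> carrier (dual ?W)" if "x \<in> carrier ?P" for x using that car by simp
    show "p (x \<oplus>\<^bsub>?P\<^esub> y) = p x \<oplus>\<^bsub>dual ?W\<^esub> p y" if "x \<in> carrier ?P" "y \<in> carrier ?P" for x y
      using mod_homD(2)[OF p, of x y] that by (simp add: dual_module_def hom_module_def)
    show "p (c \<odot>\<^bsub>?P\<^esub> x) = c \<odot>\<^bsub>dual ?W\<^esub> p x" if "c \<in> carrier k" "x \<in> carrier ?P" for c x
      using mod_homD(3)[OF p, of "\<phi> c" x] that by (simp add: dual_module_def hom_module_def)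
  qed
  have "\<eta> a = \<zero>\<^bsub>J\<^esub>" if "a \<in> carrier ?P" "p a = \<zero>\<^bsub>dual ?W\<^esub>" for a
  proof -
    have "a \<in> f ` carrier P1" unfolding exact using that car(2) by simp
    then show ?thesis using ker by auto
  qed
  from hom_factor_surj[OF P left_module_dual[OF W] left_module_J p' _ \<eta> this]
  obtain \<xi> where \<xi>: "\<xi> \<in> mod_hom k (dual ?W) J" "\<And>a. a \<in> carrier P0 \<Longrightarrow> \<xi> (p a) = \<eta> a"
    using p_surj car(1) by auto
  from double_dual_evaluation[OF W _ \<xi>(1)] fin_K
  obtain v where "v \<in> carrier K" "\<And>g. g \<in> carrier (dual ?W) \<Longrightarrow> \<xi> g = g v" by auto
  then show ?thesis using \<xi>(2) car(1) p_closed by (intro bexI[of _ v]) auto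
qed

theorem retraction_exists:
  fixes E :: "('r, 'e) module" and X :: "('r, 'x) module"
  assumes E: "left_module \<Lambda> E" and X: "left_module \<Lambda> X"
    and fin_E: "finite_length k (restrict_scalars \<phi> E) (carrier E)"
    and i: "i \<in> mod_hom \<Lambda> K E" and inj: "inj_on i (carrier K)" and \<pi>: "\<pi> \<in> mod_hom \<Lambda> E X"
    and ex: "i ` carrier K = {x \<in> carrier E. \<pi> x = \<zero>\<^bsub>X\<^esub>}"
    and lift: "\<And>\<theta>. \<theta> \<in> mod_hom \<Lambda> T X \<Longrightarrow> \<exists>\<psi>\<in>mod_hom \<Lambda> T E. \<forall>t\<in>carrier T. \<pi> (\<psi> t) = \<theta> t"
  shows "\<exists>r\<in>mod_hom \<Lambda> E K. \<forall>v\<in>carrier K. r (i v) = v"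
proof -
  interpret E: left_module \<Lambda> E by (rule E)
  interpret X: left_module \<Lambda> X by (rule X)
  interpret T: left_module \<Lambda> T by (rule T)
  let ?HK = "tensor \<phi> \<Lambda> P0 K" and ?HE = "tensor \<phi> \<Lambda> P0 E" and ?H1 = "tensor \<phi> \<Lambda> P1 E"
  have HK: "left_module k ?HK" and HE: "left_module k ?HE" and H1: "left_module k ?H1"
    by (rule left_module_tensor[OF P0 K] left_module_tensor[OF P0 E] left_module_tensor[OF P1 E])+
  interpret HK: left_module k ?HK by (rule HK)
  interpret HE: left_module k ?HE by (rule HE)
  interpret H1: left_module k ?H1 by (rule H1)
  obtain ev where ev: "ev \<in> mod_hom k ?HK J"
    and ev_pure: "\<And>a v. \<lbrakk> a \<in> carrier P0; v \<in> carrier K \<rbrakk> \<Longrightarrow> ev (pure_tensor \<Lambda> P0 K a v) = p a v"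
    using evaluation_exists by auto
  let ?S = "direct_sum ?HK ?H1"
  have S: "left_module k ?S" by (rule left_module_direct_sum[OF HK H1])
  \<comment> \<open>The functional to be extended lives on the image of P0 \<otimes> K plus the
    image of P1 \<otimes> E inside P0 \<otimes> E. Prescribing zero on the second summand makes any
    extension a functional on the cokernel DK \<otimes> E.\<close>
  define \<rho> where "\<rho> = (\<lambda>(w, u). \<lambda>g\<in>carrier P0_dual. i (w g) \<oplus>\<^bsub>E\<^esub> u (f_dual g))"
  have \<rho>_apply: "\<rho> (w, u) g = i (w g) \<oplus>\<^bsub>E\<^esub> u (f_dual g)" if "g \<in> carrier P0_dual" for w u g
    using that by (simp add: \<rho>_def)
  note id = mod_homD[OF i] and fd = mod_homD[OF f_dual]
  have iw: "i (w g) \<in> carrier E" if "w \<in> carrier ?HK" "g \<in> carrier P0_dual" for w g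
    using id(1) tensor_closed[OF that] by simp
  have uf: "u (f_dual g) \<in> carrier E" if "u \<in> carrier ?H1" "g \<in> carrier P0_dual" for u g
    using tensor_closed[OF that(1) fd(1)[OF that(2)]] .
  have \<rho>_closed: "\<rho> (w, u) \<in> carrier ?HE" if w: "w \<in> carrier ?HK" and u: "u \<in> carrier ?H1" for w u
  proof -
    note wd = mod_homD[OF tensor_hom[OF w]] and ud = mod_homD[OF tensor_hom[OF u]]
    have "\<rho> (w, u) \<in> mod_hom \<Lambda> P0_dual E"
    proof (rule mod_homI)
      fix g assume g: "g \<in> carrier P0_dual"
      then show "\<rho> (w, u) g \<in> carrier E" using iw[OF w] uf[OF u] by (simp add: \<rho>_apply)
      fix a assume a: "a \<in> carrier \<Lambda>"
      show "\<rho> (w, u) (a \<odot>\<^bsub>P0_dual\<^esub> g) = a \<odot>\<^bsub>E\<^esub> \<rho> (w, u) g"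
        using \<rho>_apply[OF P0_dual.smult_closed[OF a g]] \<rho>_apply[OF g] wd(1)[OF g] wd(3)[OF a g]
          fd(3)[OF a g] ud(3)[OF a fd(1)[OF g]] id(3)[OF a wd(1)[OF g]] iw[OF w g] uf[OF u g] a
        by (simp only: E.smult_r_distr)
    next
      fix g h assume g: "g \<in> carrier P0_dual" and h: "h \<in> carrier P0_dual"
      show "\<rho> (w, u) (g \<oplus>\<^bsub>P0_dual\<^esub> h) = \<rho> (w, u) g \<oplus>\<^bsub>E\<^esub> \<rho> (w, u) h"
        using \<rho>_apply[OF P0_dual.M.add.m_closed[OF g h]] \<rho>_apply[OF g] \<rho>_apply[OF h] wd(2)[OF g h]
          fd(2)[OF g h] ud(2)[OF fd(1)[OF g] fd(1)[OF h]] id(2)[OF wd(1)[OF g] wd(1)[OF h]]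
          iw[OF w g] uf[OF u g] iw[OF w h] uf[OF u h]
        by (simp add: E.M.a_ac)
    qed
    then show ?thesis by (simp add: tensor_carrier \<rho>_def)
  qed
  have \<rho>: "\<rho> \<in> mod_hom k ?S ?HE"
  proof (rule mod_homI)
    show "\<rho> x \<in> carrier ?HE" if "x \<in> carrier ?S" for x using that \<rho>_closed by auto
    fix x y assume "x \<in> carrier ?S" "y \<in> carrier ?S"
    then obtain w u w' u' where x: "x = (w, u)" "w \<in> carrier ?HK" "u \<in> carrier ?H1"
      and y: "y = (w', u')" "w' \<in> carrier ?HK" "u' \<in> carrier ?H1" by auto
    show "\<rho> (x \<oplus>\<^bsub>?S\<^esub> y) = \<rho> x \<oplus>\<^bsub>?HE\<^esub> \<rho> y"
    proof (rule tensor_eqI[of _ P0 E])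
      fix g assume g: "g \<in> carrier P0_dual"
      show "\<rho> (x \<oplus>\<^bsub>?S\<^esub> y) g = (\<rho> x \<oplus>\<^bsub>?HE\<^esub> \<rho> y) g"
        using tensor_closed[OF x(2) g] tensor_closed[OF y(2) g] uf[OF x(3) g] uf[OF y(3) g] id(1)
        by (simp add: x(1) y(1) \<rho>_apply[OF g] tensor_add[OF g] tensor_add[OF fd(1)[OF g]] id(2) E.M.a_ac)
    qed (use x y \<rho>_closed in auto)
  next
    fix c x assume c: "c \<in> carrier k" and "x \<in> carrier ?S"
    then obtain w u where x: "x = (w, u)" "w \<in> carrier ?HK" "u \<in> carrier ?H1" by auto
    show "\<rho> (c \<odot>\<^bsub>?S\<^esub> x) = c \<odot>\<^bsub>?HE\<^esub> \<rho> x"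
    proof (rule tensor_eqI[of _ P0 E])
      fix g assume g: "g \<in> carrier P0_dual"
      show "\<rho> (c \<odot>\<^bsub>?S\<^esub> x) g = (c \<odot>\<^bsub>?HE\<^esub> \<rho> x) g"
        using tensor_closed[OF x(2) g] uf[OF x(3) g] id(1) c
        by (simp add: x(1) \<rho>_apply[OF g] tensor_smult[OF g] tensor_smult[OF fd(1)[OF g]] id(3) E.smult_r_distr)
    qed (use x c \<rho>_closed in auto)
  qed
  have evS: "(\<lambda>x. ev (fst x)) \<in> mod_hom k ?S J"
    by (rule mod_homI) (use mod_homD[OF ev] in auto)
  text \<open>
    By the lifting hypothesis, an element of \<open>P0 \<otimes> K\<close> that is a boundary in \<open>P0 \<otimes> E\<close> is
    already a boundary in \<open>P0 \<otimes> K\<close>, so that \<open>DK \<otimes> K \<rightarrow> DK \<otimes> E\<close> is injective.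
  \<close>
  have ker: "ev (fst x) = \<zero>\<^bsub>J\<^esub>" if "x \<in> carrier ?S" "\<rho> x = \<zero>\<^bsub>?HE\<^esub>" for x
  proof -
    from that(1) obtain w u where x: "x = (w, u)" "w \<in> carrier ?HK" "u \<in> carrier ?H1" by auto
    note ud = mod_homD[OF tensor_hom[OF x(3)]]
    have zero: "i (w g) \<oplus>\<^bsub>E\<^esub> u (f_dual g) = \<zero>\<^bsub>E\<^esub>" if g: "g \<in> carrier P0_dual" for g
      using \<rho>_apply[OF g, of w u] \<open>\<rho> x = _\<close> x(1) by (simp add: tensor_zero[OF g])
    have im: "submodule (f_dual ` carrier P0_dual) \<Lambda> P1_dual"
      by (rule submodule_image[OF P0_dual.left_module_axioms P1_dual.left_module_axioms f_dual])
    let ?q = "\<lambda>h. (f_dual ` carrier P0_dual) +>\<^bsub>P1_dual\<^esub> h"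
    have Tq: "T = quotient_module P1_dual (f_dual ` carrier P0_dual)"
      by (simp add: transpose_module_def cokernel_module_def)
    have q: "?q \<in> mod_hom \<Lambda> P1_dual T" and qs: "?q ` carrier P1_dual = carrier T"
      and q0: "\<And>h. h \<in> carrier P1_dual \<Longrightarrow> ?q h = \<zero>\<^bsub>T\<^esub> \<longleftrightarrow> h \<in> f_dual ` carrier P0_dual"
      unfolding Tq by (rule P1_dual.quotient_proj_hom[OF im] P1_dual.quotient_proj_surj[OF im]
          P1_dual.quotient_proj_zero[OF im], assumption?)+
    have pu: "(\<lambda>h. \<pi> (u h)) \<in> mod_hom \<Lambda> P1_dual X" by (rule mod_hom_compose[OF tensor_hom[OF x(3)] \<pi>])
    \<comment> \<open>On the image of \<open>f_dual\<close>, \<open>u\<close> equals -i w, which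
      \<open>\<pi>\<close> kills. So \<pi> u descends to the cokernel \<open>T\<close> and becomes a
      map to which the lifting hypothesis applies.\<close>
    have "\<pi> (u h) = \<zero>\<^bsub>X\<^esub>" if h: "h \<in> carrier P1_dual" "?q h = \<zero>\<^bsub>T\<^esub>" for h
    proof -
      from h q0 obtain g where g: "g \<in> carrier P0_dual" "h = f_dual g" by blast
      have "\<pi> (i (w g)) = \<zero>\<^bsub>X\<^esub>" using ex tensor_closed[OF x(2) g(1)] by blast
      moreover have "\<pi> (i (w g)) \<oplus>\<^bsub>X\<^esub> \<pi> (u h) = \<zero>\<^bsub>X\<^esub>"
        using zero[OF g(1)] mod_homD(2)[OF \<pi> iw[OF x(2) g(1)] uf[OF x(3) g(1)]] mod_hom_zero[OF E X \<pi>] g(2)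
        by simp
      ultimately show ?thesis using mod_homD(1)[OF pu h(1)] by simp
    qed
    from hom_factor_surj[OF P1_dual.left_module_axioms T X q qs pu this]
    obtain \<theta> where \<theta>: "\<theta> \<in> mod_hom \<Lambda> T X" "\<And>h. h \<in> carrier P1_dual \<Longrightarrow> \<theta> (?q h) = \<pi> (u h)" by auto
    from lift[OF \<theta>(1)] obtain \<psi> where \<psi>: "\<psi> \<in> mod_hom \<Lambda> T E" "\<And>t. t \<in> carrier T \<Longrightarrow> \<pi> (\<psi> t) = \<theta> t" by auto
    \<comment> \<open>Subtracting \<open>u\<close> from the lift leaves a map into the kernel of
      \<open>\<pi>\<close>, that is, into \<open>K\<close>. On the image of \<open>f_dual\<close>
      the lift vanishes and this map is -u = i w, which exhibits \<open>w\<close> as the boundary of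
      \<open>v\<close>; the sign is chosen for that.\<close>
    let ?u = "\<lambda>h. \<psi> (?q h) \<ominus>\<^bsub>E\<^esub> u h"
    have \<psi>q: "(\<lambda>h. \<psi> (?q h)) \<in> mod_hom \<Lambda> P1_dual E" by (rule mod_hom_compose[OF q \<psi>(1)])
    note \<psi>d = mod_homD[OF \<psi>q]
    have u': "?u \<in> mod_hom \<Lambda> P1_dual E"
      by (rule mod_homI)
        (simp_all add: \<psi>d ud a_minus_def E.M.minus_add E.M.a_ac E.smult_r_distr E.smult_r_minus)
    have "?u h \<in> i ` carrier K" if h: "h \<in> carrier P1_dual" for h
    proof -
      have "\<pi> (?u h) = \<pi> (\<psi> (?q h)) \<ominus>\<^bsub>X\<^esub> \<pi> (u h)"
        by (rule mod_hom_minus[OF E X \<pi> \<psi>d(1)[OF h] ud(1)[OF h]])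
      also have "\<dots> = \<zero>\<^bsub>X\<^esub>"
        using \<psi>(2)[OF mod_homD(1)[OF q h]] \<theta>(2)[OF h] mod_homD(1)[OF pu h]
        by (simp add: a_minus_def X.M.r_neg)
      finally show ?thesis using ex mod_homD(1)[OF u' h] by blast
    qed
    from hom_factor_inj[OF P1_dual.left_module_axioms K i inj u' this]
    obtain v where v: "v \<in> mod_hom \<Lambda> P1_dual K" "\<And>h. h \<in> carrier P1_dual \<Longrightarrow> i (v h) = ?u h" by auto
    have "w g = v (f_dual g)" if g: "g \<in> carrier P0_dual" for g
    proof (rule inj_onD[OF inj])
      have "?q (f_dual g) = \<zero>\<^bsub>T\<^esub>" using q0[OF fd(1)[OF g]] g by blast
      then have "i (v (f_dual g)) = \<ominus>\<^bsub>E\<^esub> u (f_dual g)"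
        using v(2)[OF fd(1)[OF g]] mod_hom_zero[OF T E \<psi>(1)] uf[OF x(3) g] by (simp add: a_minus_def)
      also have "\<dots> = i (w g)"
        using E.M.minus_equality[OF zero[OF g]] iw[OF x(2) g] uf[OF x(3) g] by simp
      finally show "i (w g) = i (v (f_dual g))" by simp
    qed (use tensor_closed[OF x(2) g] mod_homD(1)[OF v(1) fd(1)[OF g]] in auto)
    then show ?thesis using evaluation_boundary[OF ev ev_pure x(2) v(1)] x(1) by simp
  qed
  define A where "A = \<rho> ` carrier ?S"
  have A: "submodule A k ?HE" unfolding A_def by (rule submodule_image[OF S HE \<rho>])
  have \<rho>A: "\<rho> \<in> mod_hom k ?S (submod ?HE A)" by (rule mod_hom_into_submod[OF \<rho>]) (simp add: A_def)
  have "\<exists>h\<in>mod_hom k (submod ?HE A) J. \<forall>x\<in>carrier ?S. h (\<rho> x) = ev (fst x)"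
    by (rule hom_factor_surj[OF S HE.left_module_submod[OF A] left_module_J \<rho>A _ evS])
      (use ker in \<open>auto simp: A_def\<close>)
  then obtain h where h: "h \<in> mod_hom k (submod ?HE A) J" "\<And>x. x \<in> carrier ?S \<Longrightarrow> h (\<rho> x) = ev (fst x)"
    by auto
  from injective_extend_submodule[OF injective_J HE finite_length_tensor[OF proj_P0 E fin_E] A h(1)]
  obtain \<epsilon> where \<epsilon>: "\<epsilon> \<in> mod_hom k ?HE J" "\<And>x. x \<in> A \<Longrightarrow> \<epsilon> x = h x" by auto
  have \<epsilon>\<rho>: "\<epsilon> (\<rho> (w, u)) = ev w" if "w \<in> carrier ?HK" "u \<in> carrier ?H1" for w u
    using \<epsilon>(2)[of "\<rho> (w, u)"] h(2)[of "(w, u)"] that by (auto simp: A_def)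
  note \<epsilon>d = mod_homD[OF \<epsilon>(1)]
  \<comment> \<open>Representability needs the functional to vanish on the image of
    \<open>f\<close>. It does because f b \<otimes> x is the boundary of b \<otimes> x, and
    \<open>\<epsilon>\<close> was forced to be zero on boundaries.\<close>
  have "\<exists>v\<in>carrier K. \<forall>a\<in>carrier P0. \<epsilon> (pure_tensor \<Lambda> P0 E a x) = p a v" if x: "x \<in> carrier E" for x
  proof (rule functional_representable)
    show "(\<lambda>a. \<epsilon> (pure_tensor \<Lambda> P0 E a x)) \<in> mod_hom k (restrict_scalars \<phi> P0) J"
      by (rule mod_homI)
        (use x P0 E \<epsilon>d in \<open>auto simp: pure_tensor_add_left[OF P0 E] pure_tensor_smult_left[OF P0 E]\<close>)
    fix b assume b: "b \<in> carrier P1"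
    have z: "\<zero>\<^bsub>?HK\<^esub> \<in> carrier ?HK" by simp
    have t: "pure_tensor \<Lambda> P1 E b x \<in> carrier ?H1" using P1 E b x by simp
    have "pure_tensor \<Lambda> P0 E (f b) x = \<rho> (\<zero>\<^bsub>?HK\<^esub>, pure_tensor \<Lambda> P1 E b x)"
    proof (rule tensor_eqI[OF _ \<rho>_closed[OF z t]])
      fix g assume g: "g \<in> carrier P0_dual"
      show "pure_tensor \<Lambda> P0 E (f b) x g = \<rho> (\<zero>\<^bsub>?HK\<^esub>, pure_tensor \<Lambda> P1 E b x) g"
        using \<rho>_apply[OF g] tensor_zero[OF g, of K] mod_hom_zero[OF K E i] b g x fd(1)[OF g]
        by (simp add: pure_tensor_apply)
    qed (use b x P0 E in simp)
    then show "\<epsilon> (pure_tensor \<Lambda> P0 E (f b) x) = \<zero>\<^bsub>J\<^esub>"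
      using \<epsilon>\<rho>[OF z t] mod_hom_zero[OF HK left_module_J ev] by simp
  qed
  then obtain r where r: "\<And>x. x \<in> carrier E \<Longrightarrow> r x \<in> carrier K"
    and pr: "\<And>x a. \<lbrakk> x \<in> carrier E; a \<in> carrier P0 \<rbrakk> \<Longrightarrow> p a (r x) = \<epsilon> (pure_tensor \<Lambda> P0 E a x)"
    by metis
  \<comment> \<open>\<open>r\<close> was chosen pointwise. Its values are pinned down by their
    pairings with \<open>P0\<close>, so linearity is inherited from \<open>\<epsilon>\<close> and
    from the balancing of pure tensors.\<close>
  have "r \<in> mod_hom \<Lambda> E K"
  proof (rule mod_homI)
    fix x y assume xy: "x \<in> carrier E" "y \<in> carrier E"
    show "r (x \<oplus>\<^bsub>E\<^esub> y) = r x \<oplus>\<^bsub>K\<^esub> r y"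
      by (rule p_separates)
        (use xy r pr P0 E \<epsilon>d in \<open>auto simp: p_apply_add pure_tensor_add_right[OF P0 E]\<close>)
  next
    fix l x assume l: "l \<in> carrier \<Lambda>" and x: "x \<in> carrier E"
    show "r (l \<odot>\<^bsub>E\<^esub> x) = l \<odot>\<^bsub>K\<^esub> r x"
    proof (rule p_separates)
      fix a assume a: "a \<in> carrier P0"
      have "l \<odot>\<^bsub>P0\<^esub> a \<in> carrier P0" using P0.smult_closed[of l a] l a by simp
      then have "p a (l \<odot>\<^bsub>K\<^esub> r x) = \<epsilon> (pure_tensor \<Lambda> P0 E (l \<odot>\<^bsub>P0\<^esub> a) x)"
        using pr[OF x] p_balanced[OF a r[OF x] l] by simp
      also have "\<dots> = p a (r (l \<odot>\<^bsub>E\<^esub> x))"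
        using pr[of "l \<odot>\<^bsub>E\<^esub> x" a] l x a by (simp add: pure_tensor_balanced[OF P0 E])
      finally show "p a (r (l \<odot>\<^bsub>E\<^esub> x)) = p a (l \<odot>\<^bsub>K\<^esub> r x)" by simp
    qed (use l x r in auto)
  qed (rule r)
  \<comment> \<open>a \<otimes> i v comes from a \<otimes> v in P0 \<otimes> K, where
    \<open>\<epsilon>\<close> agrees with the evaluation; so r (i v) and \<open>v\<close> pair
    equally with every \<open>a\<close>.\<close>
  moreover have "r (i v) = v" if v: "v \<in> carrier K" for v
  proof (rule p_separates[OF r[OF id(1)[OF v]] v])
    fix a assume a: "a \<in> carrier P0"
    have t: "pure_tensor \<Lambda> P0 K a v \<in> carrier ?HK" using P0 K a v by simp
    have z: "\<zero>\<^bsub>?H1\<^esub> \<in> carrier ?H1" by simp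
    have "pure_tensor \<Lambda> P0 E a (i v) = \<rho> (pure_tensor \<Lambda> P0 K a v, \<zero>\<^bsub>?H1\<^esub>)"
    proof (rule tensor_eqI[OF _ \<rho>_closed[OF t z]])
      fix g assume g: "g \<in> carrier P0_dual"
      show "pure_tensor \<Lambda> P0 E a (i v) g = \<rho> (pure_tensor \<Lambda> P0 K a v, \<zero>\<^bsub>?H1\<^esub>) g"
        using \<rho>_apply[OF g] tensor_zero[OF fd(1)[OF g], of E] a v g id(1,3)
        by (simp add: pure_tensor_apply)
    qed (use a v id P0 E in simp)
    then show "p a (r (i v)) = p a v"
      using pr[OF id(1)[OF v] a] \<epsilon>\<rho>[OF t z] ev_pure[OF a v] by simp
  qed
  ultimately show ?thesis by blast
qed

end


section \<open>Determination by the transpose and the socle\<close>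

context artin_alg
begin

text \<open>\<open>\<Lambda>\<close> is finitely generated over the artinian ring \<open>k\<close>,
  hence of finite length over it. So is every cyclic module, as an image of
  \<open>\<Lambda>\<close>, and every finite sum of such.\<close>

lemma finite_length_restrict:
  assumes "fg_module \<Lambda> M"
  shows "finite_length k (restrict_scalars \<phi> M) (carrier M)"
proof -
  from assms obtain S where M: "left_module \<Lambda> M"
    and S: "finite S" "S \<subseteq> carrier M" "module_span \<Lambda> M S = carrier M"
    by (auto simp: fg_module_def)
  interpret M: left_module \<Lambda> M by (rule M)
  let ?M = "restrict_scalars \<phi> M" and ?L = "restrict_scalars \<phi> (regular_module \<Lambda>)"
  have M': "left_module k ?M" by (rule left_module_restrict[OF M])
  interpret M': left_module k ?M by (rule M')
  have reg: "left_module \<Lambda> (regular_module \<Lambda>)" by (rule left_module_regular_module[OF ring_\<Lambda>])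
  have "fg_module k ?L" using artin_algebra by (simp add: artin_algebra_def)
  from fg_module_finite_length[OF this artinian_finite_length[OF artinian_k]]
  have fin: "finite_length k ?L (carrier \<Lambda>)" by simp
  \<comment> \<open>\<open>N\<close> is kept a \<open>\<Lambda>\<close>-submodule while its length
    is measured over \<open>k\<close>; containing the generators, it is then the whole
    module.\<close>
  have "\<exists>N. submodule N \<Lambda> M \<and> S \<subseteq> N \<and> finite_length k ?M N"
    using S(1,2)
  proof (induction S rule: finite_induct)
    case empty
    show ?case using M.submodule_zero finite_length_zero[of k ?M] by auto
  next
    case (insert x S)
    then obtain N where N: "submodule N \<Lambda> M" "S \<subseteq> N" "finite_length k ?M N" by auto
    have x: "x \<in> carrier M" using insert by simp
    let ?X = "(\<lambda>c. c \<odot>\<^bsub>M\<^esub> x) ` carrier \<Lambda>"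
    have X: "submodule ?X \<Lambda> M" by (rule M.submodule_cyclic[OF x])
    have "(\<lambda>c. c \<odot>\<^bsub>M\<^esub> x) \<in> mod_hom \<Lambda> (regular_module \<Lambda>) M"
      by (rule mod_homI) (use x in \<open>auto simp: M.smult_l_distr M.smult_assoc\<close>)
    from finite_length_image[OF left_module_restrict[OF reg] M' mod_hom_restrict[OF this] fin]
    have "finite_length k ?M (?X <+>\<^bsub>?M\<^esub> N)" by (rule M'.finite_length_set_add[OF N(3)])
    moreover have "?X <+>\<^bsub>?M\<^esub> N = ?X <+>\<^bsub>M\<^esub> N" by (simp add: set_add_def')
    moreover have "insert x S \<subseteq> ?X <+>\<^bsub>M\<^esub> N"
      using M.set_add_upper[OF X N(1)] M.cyclic_self[OF x] N(2) by auto
    ultimately show ?case using M.submodule_set_add[OF X N(1)] by auto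
  qed
  then obtain N where N: "submodule N \<Lambda> M" "S \<subseteq> N" "finite_length k ?M N" by auto
  then have "N = carrier M" using M.span_least[OF N(1,2)] S(3) M.submodD(1)[OF N(1)] by auto
  then show ?thesis using N(3) by simp
qed

lemma fg_module_of_finite_length_restrict:
  assumes "left_module \<Lambda> M" "finite_length k (restrict_scalars \<phi> M) (carrier M)"
  shows "fg_module \<Lambda> M"
proof -
  interpret M: left_module \<Lambda> M by fact
  let ?M = "restrict_scalars \<phi> M"
  interpret M': left_module k ?M by (rule left_module_restrict[OF assms(1)])
  obtain S where S: "finite S" "S \<subseteq> carrier M" "module_span k ?M S = carrier M"
    using M'.finite_length_fg[OF assms(2)] by auto
  have "carrier M \<subseteq> module_span \<Lambda> M S"
    using M'.span_least[OF submodule_restrict[OF assms(1) M.submodule_span[OF S(2)]] M.span_superset] S(3)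
    by simp
  then have "module_span \<Lambda> M S = carrier M" using M.submodD(1)[OF M.submodule_span[OF S(2)]] by auto
  then show ?thesis using assms(1) S(1,2) by (auto simp: fg_module_def)
qed

text \<open>Finite length over \<open>k\<close> is inherited by submodules, and generators over
  \<open>k\<close> also generate over \<open>\<Lambda>\<close>.\<close>

lemma fg_module_submod:
  assumes "fg_module \<Lambda> M" "submodule N \<Lambda> M"
  shows "fg_module \<Lambda> (submod M N)"
proof -
  have M: "left_module \<Lambda> M" using assms(1) by (simp add: fg_module_def)
  interpret M: left_module \<Lambda> M by (rule M)
  have N: "left_module \<Lambda> (submod M N)" by (rule M.left_module_submod[OF assms(2)])
  have id: "(\<lambda>x. x) \<in> mod_hom \<Lambda> (submod M N) M"
    by (rule mod_homI) (use M.submodD(1)[OF assms(2)] in auto)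
  have "finite_length k (restrict_scalars \<phi> (submod M N)) (carrier (restrict_scalars \<phi> (submod M N)))"
    by (rule finite_length_inj[OF left_module_restrict[OF N] left_module_restrict[OF M] mod_hom_restrict[OF id]])
      (use finite_length_restrict[OF assms(1)] in simp_all)
  then show ?thesis using fg_module_of_finite_length_restrict[OF N] by simp
qed

text \<open>Among the nonzero \<open>\<Lambda>\<close>-submodules of \<open>N\<close>, one of least
  length over \<open>k\<close> is simple, since a proper submodule of it has a strictly shorter
  series.\<close>

lemma ex_simple_submodule:
  assumes "fg_module \<Lambda> M" "submodule N \<Lambda> M" "N \<noteq> {\<zero>\<^bsub>M\<^esub>}"
  shows "\<exists>S. simple_submodule S \<Lambda> M \<and> S \<subseteq> N"
proof -
  have M: "left_module \<Lambda> M" using assms(1) by (simp add: fg_module_def)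
  let ?M = "restrict_scalars \<phi> M"
  interpret M': left_module k ?M by (rule left_module_restrict[OF M])
  let ?Q = "\<lambda>n. \<exists>L. submodule L \<Lambda> M \<and> L \<subseteq> N \<and> L \<noteq> {\<zero>\<^bsub>M\<^esub>} \<and> has_length k ?M n L"
  have "finite_length k ?M N"
    using M'.finite_length_mono[OF _ submodule_restrict[OF M assms(2)]] finite_length_restrict[OF assms(1)]
      M'.submodD(1)[OF submodule_restrict[OF M assms(2)]] by simp
  then have "\<exists>n. ?Q n" using assms(2,3) by (auto simp: finite_length_def)
  then have "?Q (LEAST n. ?Q n)" by (rule LeastI_ex)
  then obtain L where L: "submodule L \<Lambda> M" "L \<subseteq> N" "L \<noteq> {\<zero>\<^bsub>M\<^esub>}" "has_length k ?M (LEAST n. ?Q n) L"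
    by blast
  have "L' = {\<zero>\<^bsub>M\<^esub>} \<or> L' = L" if L': "submodule L' \<Lambda> M" "L' \<subseteq> L" for L'
  proof (rule ccontr)
    assume *: "\<not> ?thesis"
    then obtain m where m: "m < (LEAST n. ?Q n)" "has_length k ?M m L'"
      using M'.has_length_mono[OF L(4) submodule_restrict[OF M L'(1)] L'(2)] by auto
    then have "?Q m" using L' L(2) * by blast
    then show False using not_less_Least[OF m(1)] by contradiction
  qed
  then have "simple_submodule L \<Lambda> M"
    unfolding simple_submodule_def by (intro conjI allI impI L(1,3)) blast
  then show ?thesis using L(2) by (intro exI[of _ L] conjI)
qed

end

section \<open>Simple summands of the socle\<close>

lemma simple_submodule_subset_socle: "simple_submodule S R M \<Longrightarrow> S \<subseteq> socle R M"
  by (auto simp: socle_def module_span_def)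

text \<open>A projective cover of the socle maps onto the simple submodule \<open>S\<close> only
  through such a projection. The complement is an \<open>H\<close> maximal in the socle without a
  fixed nonzero \<open>x\<close> in \<open>S\<close>. Then H \<inter> S = 0, and a simple
  \<open>T\<close> outside H + S would allow H to be enlarged to H + T, still without
  \<open>x\<close>.\<close>

lemma (in left_module) socle_projection:
  assumes "simple_submodule S R M"
  shows "\<exists>h\<in>mod_hom R (submod M (socle R M)) (submod M S). \<forall>x\<in>S. h x = x"
proof -
  let ?soc = "socle R M"
  have S: "submodule S R M" "S \<noteq> {\<zero>}"
    and Smin: "\<And>L. submodule L R M \<Longrightarrow> L \<subseteq> S \<Longrightarrow> L = {\<zero>} \<or> L = S"
    using assms by (auto simp: simple_submodule_def)
  have simples: "\<Union>{N. simple_submodule N R M} \<subseteq> carrier M"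
    using submodD(1) by (auto simp: simple_submodule_def)
  have soc: "submodule ?soc R M" unfolding socle_def by (rule submodule_span[OF simples])
  have S_soc: "S \<subseteq> ?soc" by (rule simple_submodule_subset_socle[OF assms])
  obtain x where x: "x \<in> S" "x \<noteq> \<zero>" using S submodD(2)[OF S(1)] by auto
  obtain H where H: "submodule H R M" "H \<subseteq> ?soc" "x \<notin> H"
    and Hmax: "\<And>L. submodule L R M \<Longrightarrow> H \<subseteq> L \<Longrightarrow> L \<subseteq> ?soc \<Longrightarrow> x \<notin> L \<Longrightarrow> L = H"
    using ex_maximal_avoiding[OF soc x(2)] by auto
  note Hc = submodD(1)[OF H(1)] and Sc = submodD(1)[OF S(1)]
  have HS0: "H \<inter> S = {\<zero>}" using Smin[OF submodule_Int[OF H(1) S(1)]] H(3) x(1) by auto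
  note HS = submodule_set_add[OF H(1) S(1)]
  have "T \<subseteq> H <+>\<^bsub>M\<^esub> S" if T: "simple_submodule T R M" for T
  proof (rule ccontr)
    assume nT: "\<not> T \<subseteq> H <+>\<^bsub>M\<^esub> S"
    have T': "submodule T R M" and Tmin: "\<And>L. submodule L R M \<Longrightarrow> L \<subseteq> T \<Longrightarrow> L = {\<zero>} \<or> L = T"
      using T by (auto simp: simple_submodule_def)
    have T0: "T \<inter> (H <+>\<^bsub>M\<^esub> S) = {\<zero>}" using Tmin[OF submodule_Int[OF T' HS]] nT by auto
    have T_soc: "T \<subseteq> ?soc" by (rule simple_submodule_subset_socle[OF T])
    \<comment> \<open>If x = h + t, then t = x - h lies both in \<open>T\<close> and in H + S, which
      meet in zero. So x = h would lie in \<open>H\<close>.\<close>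
    have "x \<notin> H <+>\<^bsub>M\<^esub> T"
    proof
      assume "x \<in> H <+>\<^bsub>M\<^esub> T"
      then obtain h t where h: "h \<in> H" "t \<in> T" "x = h \<oplus> t" by (auto simp: mem_set_add)
      have c: "h \<in> carrier M" "t \<in> carrier M" using h Hc submodD(1)[OF T'] by auto
      have "t = x \<ominus> h" using add_minus_cancel[OF c] h(3) by simp
      moreover have "x \<ominus> h \<in> H <+>\<^bsub>M\<^esub> S"
        using set_add_upper[OF H(1) S(1)] h(1) x(1) by (intro minus_closed[OF HS]) auto
      ultimately have "t = \<zero>" using T0 h(2) by auto
      then show False using h H(3) c by simp
    qed
    then have "H <+>\<^bsub>M\<^esub> T = H"
      by (intro Hmax submodule_set_add[OF H(1) T'] set_add_upper(1)[OF H(1) T'] set_add_least[OF soc H(2) T_soc])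
    then show False using set_add_upper(2)[OF H(1) T'] set_add_upper(1)[OF H(1) S(1)] nT by auto
  qed
  then have "?soc \<subseteq> H <+>\<^bsub>M\<^esub> S" unfolding socle_def by (intro span_least[OF HS]) auto
  then have soc_eq: "?soc = H <+>\<^bsub>M\<^esub> S" using set_add_least[OF soc H(2) S_soc] by auto
  let ?D = "direct_sum (submod M H) (submod M S)"
  have D: "left_module R ?D"
    by (rule left_module_direct_sum[OF left_module_submod[OF H(1)] left_module_submod[OF S(1)]])
  have p: "(\<lambda>(h, s). h \<oplus> s) \<in> mod_hom R ?D (submod M ?soc)"
  proof (rule mod_homI)
    fix u assume "u \<in> carrier ?D"
    then show "(\<lambda>(h, s). h \<oplus> s) u \<in> carrier (submod M ?soc)" by (auto simp: soc_eq mem_set_add)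
  qed (use Hc Sc in \<open>auto simp: subset_iff smult_r_distr M.a_ac\<close>)
  have ps: "(\<lambda>(h, s). h \<oplus> s) ` carrier ?D = carrier (submod M ?soc)"
    by (force simp: soc_eq mem_set_add image_iff)
  have q: "snd \<in> mod_hom R ?D (submod M S)" by (rule mod_homI) auto
  have ker: "snd u = \<zero>\<^bsub>submod M S\<^esub>" if u: "u \<in> carrier ?D" "(\<lambda>(h, s). h \<oplus> s) u = \<zero>\<^bsub>submod M ?soc\<^esub>" for u
  proof -
    obtain h s where hs: "u = (h, s)" "h \<in> H" "s \<in> S" using u(1) by auto
    have c: "h \<in> carrier M" "s \<in> carrier M" using hs Hc Sc by auto
    have "s \<oplus> h = \<zero>" using u(2) hs(1) c by (simp add: M.a_comm)
    then have "\<ominus> h = s" using M.minus_equality c by simp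
    then have "s \<in> H \<inter> S" using submodD(5)[OF H(1) hs(2)] hs(3) by auto
    then show ?thesis using HS0 hs(1) by auto
  qed
  from hom_factor_surj[OF D left_module_submod[OF soc] left_module_submod[OF S(1)] p ps q ker]
  obtain h where h: "h \<in> mod_hom R (submod M ?soc) (submod M S)"
    and hv: "\<And>a s. a \<in> H \<Longrightarrow> s \<in> S \<Longrightarrow> h (a \<oplus> s) = s" by auto
  have "h s = s" if "s \<in> S" for s
    using hv[OF submodD(2)[OF H(1)] that] that Sc by auto
  then show ?thesis using h by blast
qed

theorem theorem1:
  fixes k :: "'k ring" and \<phi> :: "'k \<Rightarrow> 'r" and \<Lambda> :: "'r ring"
    and J :: "('k, 'j) module" and \<iota> :: "'k set \<Rightarrow> 'j"
    and X :: "('r, 'a) module" and Y :: "('r, 'b) module" and \<alpha> :: "'a \<Rightarrow> 'b"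
    and P0 :: "('r, 'p0) module" and P1 :: "('r, 'p1) module"
    and f :: "'p1 \<Rightarrow> 'p0" and p :: "'p0 \<Rightarrow> 'a \<Rightarrow> 'j"
    and P :: "('r, 'p) module" and \<pi> :: "'p \<Rightarrow> 'b set"
  assumes "artin_algebra k \<phi> \<Lambda>"
    and "injective_envelope k (quotient_module (regular_module k) (jacobson_radical k)) \<iota> J"
    and "fg_module \<Lambda> X" and "fg_module \<Lambda> Y" and "\<alpha> \<in> mod_hom \<Lambda> X Y"
    and K: "K = kernel_module X Y \<alpha>"
    and Q: "Q = cokernel_module X Y \<alpha>"
    and "minimal_projective_presentation (op_ring \<Lambda>) P1 f P0 p (dual_module k \<phi> J K)"
    and "projective_cover \<Lambda> P \<pi> (submod Q (socle \<Lambda> Q))"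
  shows "right_determined TYPE('x) \<Lambda> X \<alpha> Y
           (direct_sum (transpose_module (op_ring \<Lambda>) P1 f P0) P)"
  unfolding right_determined_def
proof (intro allI impI, elim conjE)
  fix X' :: "('r, 'x) module" and \<alpha>'
  let ?T = "transpose_module (op_ring \<Lambda>) P1 f P0"
  let ?C = "direct_sum ?T P"
  assume fgX': "fg_module \<Lambda> X'" and \<alpha>': "\<alpha>' \<in> mod_hom \<Lambda> X' Y"
    and det: "\<forall>\<theta>\<in>mod_hom \<Lambda> ?C X'. \<exists>\<theta>'\<in>mod_hom \<Lambda> ?C X. \<forall>c\<in>carrier ?C. \<alpha>' (\<theta> c) = \<alpha> (\<theta>' c)"
  note fgX = assms(3) and fgY = assms(4) and \<alpha> = assms(5)
  have X: "left_module \<Lambda> X" and Y: "left_module \<Lambda> Y" and X': "left_module \<Lambda> X'"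
    using fgX fgY fgX' by (auto simp: fg_module_def)
  interpret X: left_module \<Lambda> X by (rule X)
  interpret Y: left_module \<Lambda> Y by (rule Y)
  interpret X': left_module \<Lambda> X' by (rule X')
  interpret artin_alg k \<phi> \<Lambda> by (rule artin_alg.intro[OF assms(1)])
  have Kc: "carrier K = {x \<in> carrier X. \<alpha> x = \<zero>\<^bsub>Y\<^esub>}"
    by (simp add: K kernel_module_def a_kernel_def')
  have subK: "submodule (carrier K) \<Lambda> X"
    using submodule_vimage[OF X Y \<alpha> Y.submodule_zero] by (simp add: Kc)
  have KX: "K = submod X (carrier K)"
    by (simp add: K kernel_module_def)
  have fgK: "fg_module \<Lambda> K" using fg_module_submod[OF fgX subK] KX by simp
  have Kops: "x \<oplus>\<^bsub>K\<^esub> y = x \<oplus>\<^bsub>X\<^esub> y" "a \<odot>\<^bsub>K\<^esub> x = a \<odot>\<^bsub>X\<^esub> x" for x y a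
    by (simp_all add: K kernel_module_def)
  let ?DK = "dual_module k \<phi> J K"
  have cov0: "projective_cover (op_ring \<Lambda>) P0 p ?DK"
    and cov1: "projective_cover (op_ring \<Lambda>) P1 f (kernel_module P0 ?DK p)"
    using assms(8) by (auto simp: minimal_projective_presentation_def)
  interpret dual_presentation k \<iota> J \<phi> \<Lambda> K P1 f P0 p
  proof (intro dual_presentation.intro matlis_dual.intro artin_alg.intro dual_presentation_axioms.intro)
    show "artinian_cring k" by (rule artinian_k)
    show "artin_algebra k \<phi> \<Lambda>" by (rule assms(1))
    show "injective_envelope k (quotient_module (regular_module k) (jacobson_radical k)) \<iota> J" by (rule assms(2))
    show "left_module \<Lambda> K" using fgK by (simp add: fg_module_def)
    show "finite_length k (restrict_scalars \<phi> K) (carrier K)" by (rule finite_length_restrict[OF fgK])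
    show "projective_module (op_ring \<Lambda>) P1" "projective_module (op_ring \<Lambda>) P0"
      "p \<in> mod_hom (op_ring \<Lambda>) P0 ?DK" "p ` carrier P0 = carrier ?DK"
      using cov0 cov1 by (auto simp: projective_cover_def)
    show "f ` carrier P1 = {a \<in> carrier P0. p a = \<zero>\<^bsub>?DK\<^esub>}"
      using cov1 by (simp add: projective_cover_def kernel_module_def a_kernel_def')
    have "f \<in> mod_hom (op_ring \<Lambda>) P1 (kernel_module P0 ?DK p)" using cov1 by (simp add: projective_cover_def)
    from mod_homD[OF this] show "f \<in> mod_hom (op_ring \<Lambda>) P1 P0"
      by (intro mod_homI) (auto simp: kernel_module_def a_kernel_def')
  qed
  have projP: "projective_module \<Lambda> P" and \<pi>: "\<pi> \<in> mod_hom \<Lambda> P (submod Q (socle \<Lambda> Q))"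
    and \<pi>_surj: "\<pi> ` carrier P = socle \<Lambda> Q"
    using assms(9) by (auto simp: projective_cover_def)
  have P: "left_module \<Lambda> P" using projP by (simp add: projective_module_def fg_module_def)
  interpret P: left_module \<Lambda> P by (rule P)
  interpret T: left_module \<Lambda> ?T by (rule T)
  let ?I = "\<alpha> ` carrier X"
  have I: "submodule ?I \<Lambda> Y" by (rule submodule_image[OF X Y \<alpha>])
  have Qq: "Q = quotient_module Y ?I" by (simp add: Q cokernel_module_def)
  have Qm: "left_module \<Lambda> Q" unfolding Qq by (rule Y.left_module_quotient[OF I])
  interpret Q: left_module \<Lambda> Q by (rule Qm)
  let ?q = "\<lambda>y. ?I +>\<^bsub>Y\<^esub> y"
  have q: "?q \<in> mod_hom \<Lambda> Y Q" and q_surj: "?q ` carrier Y = carrier Q"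
    and q0: "\<And>y. y \<in> carrier Y \<Longrightarrow> ?q y = \<zero>\<^bsub>Q\<^esub> \<longleftrightarrow> y \<in> ?I"
    unfolding Qq by (rule Y.quotient_proj_hom[OF I] Y.quotient_proj_surj[OF I]
        Y.quotient_proj_zero[OF I], assumption?)+
  have fgQ: "fg_module \<Lambda> Q" by (rule fg_module_image[OF fgY Qm q q_surj])
  have q\<alpha>: "(\<lambda>x. ?q (\<alpha>' x)) \<in> mod_hom \<Lambda> X' Q" by (rule mod_hom_compose[OF \<alpha>' q])
  have im: "\<alpha>' x \<in> ?I" if x: "x \<in> carrier X'" for x
  proof (rule ccontr)
    assume nx: "\<alpha>' x \<notin> ?I"
    let ?N = "(\<lambda>x. ?q (\<alpha>' x)) ` carrier X'"
    have N: "submodule ?N \<Lambda> Q" by (rule submodule_image[OF X' Qm q\<alpha>])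
    have "?q (\<alpha>' x) \<noteq> \<zero>\<^bsub>Q\<^esub>" using q0[OF mod_homD(1)[OF \<alpha>' x]] nx by simp
    then have "?N \<noteq> {\<zero>\<^bsub>Q\<^esub>}" using x by auto
    from ex_simple_submodule[OF fgQ N this]
    obtain S where S: "simple_submodule S \<Lambda> Q" "S \<subseteq> ?N" by auto
    have S': "submodule S \<Lambda> Q" "S \<noteq> {\<zero>\<^bsub>Q\<^esub>}" using S(1) by (auto simp: simple_submodule_def)
    from Q.socle_projection[OF S(1)] obtain h where
      h: "h \<in> mod_hom \<Lambda> (submod Q (socle \<Lambda> Q)) (submod Q S)" "\<And>s. s \<in> S \<Longrightarrow> h s = s" by auto
    have S_soc: "S \<subseteq> socle \<Lambda> Q" by (rule simple_submodule_subset_socle[OF S(1)])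
    \<comment> \<open>Restricting \<open>\<alpha>'\<close> to the preimage of \<open>S\<close> makes
      the map to \<open>S\<close> surjective, as lifting from \<open>P\<close> requires.\<close>
    let ?U = "{x \<in> carrier X'. ?q (\<alpha>' x) \<in> S}"
    have U: "submodule ?U \<Lambda> X'" by (rule submodule_vimage[OF X' Qm q\<alpha> S'(1)])
    have e: "(\<lambda>x. ?q (\<alpha>' x)) \<in> mod_hom \<Lambda> (submod X' ?U) (submod Q S)"
      by (rule mod_hom_into_submod[OF mod_hom_submod[OF q\<alpha>]]) auto
    have e_surj: "(\<lambda>x. ?q (\<alpha>' x)) ` carrier (submod X' ?U) = carrier (submod Q S)"
      using S(2) by auto
    from projective_lift[OF projP fg_module_submod[OF fgX' U] fg_module_submod[OF fgQ S'(1)] e e_surj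
        mod_hom_compose[OF \<pi> h(1)]]
    obtain t where t: "t \<in> mod_hom \<Lambda> P (submod X' ?U)" "\<And>y. y \<in> carrier P \<Longrightarrow> ?q (\<alpha>' (t y)) = h (\<pi> y)" by auto
    \<comment> \<open>Extended by zero on the transpose, \<open>t\<close> is a map out of the direct
      sum. The factorisation of \<alpha>' t through \<open>\<alpha>\<close> puts its values into the
      image of \<open>\<alpha>\<close>, so h \<pi> = 0.\<close>
    have "(\<lambda>c. t (snd c)) \<in> mod_hom \<Lambda> ?C X'"
      by (rule mod_homI) (use mod_homD[OF t(1)] in auto)
    from bspec[OF det this] obtain \<theta> where \<theta>: "\<theta> \<in> mod_hom \<Lambda> ?C X" "\<And>c. c \<in> carrier ?C \<Longrightarrow> \<alpha>' (t (snd c)) = \<alpha> (\<theta> c)"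
      by auto
    have zero: "h (\<pi> y) = \<zero>\<^bsub>Q\<^esub>" if y: "y \<in> carrier P" for y
    proof -
      have c: "(\<zero>\<^bsub>?T\<^esub>, y) \<in> carrier ?C" using y by simp
      have "\<alpha>' (t y) \<in> ?I" using \<theta>(2)[OF c] mod_homD(1)[OF \<theta>(1) c] by auto
      moreover have "\<alpha>' (t y) \<in> carrier Y" using mod_homD(1)[OF t(1) y] mod_homD(1)[OF \<alpha>'] by auto
      ultimately have "?q (\<alpha>' (t y)) = \<zero>\<^bsub>Q\<^esub>" by (simp only: q0)
      then show ?thesis using t(2)[OF y] by simp
    qed
    \<comment> \<open>\<open>S\<close> lies in the socle, hence in the image of
      \<open>\<pi>\<close>, and \<open>h\<close> fixes it. So h \<pi> = 0 makes \<open>S\<close>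
      zero.\<close>
    have "s = \<zero>\<^bsub>Q\<^esub>" if s: "s \<in> S" for s
    proof -
      obtain y where "y \<in> carrier P" "s = \<pi> y" using s S_soc \<pi>_surj by blast
      then show ?thesis using zero h(2)[OF s] by simp
    qed
    then have "S \<subseteq> {\<zero>\<^bsub>Q\<^esub>}" by (intro subsetI) (simp only: singleton_iff)
    then show False using S'(2) Q.submodD(2)[OF S'(1)] by (metis subset_singletonD empty_iff)
  qed
  let ?XX = "direct_sum X X'"
  let ?E = "{z \<in> carrier ?XX. \<alpha> (fst z) = \<alpha>' (snd z)}"
  have XX: "left_module \<Lambda> ?XX" by (rule left_module_direct_sum[OF X X'])
  interpret XX: left_module \<Lambda> ?XX by (rule XX)
  note ad = mod_homD[OF \<alpha>] and ad' = mod_homD[OF \<alpha>']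
  have E: "submodule ?E \<Lambda> ?XX"
    by (rule XX.submodI) (auto simp: ad ad' mod_hom_zero[OF X Y \<alpha>] mod_hom_zero[OF X' Y \<alpha>'])
  have Em: "left_module \<Lambda> (submod ?XX ?E)" by (rule XX.left_module_submod[OF E])
  interpret E: left_module \<Lambda> "submod ?XX ?E" by (rule Em)
  have fin_E: "finite_length k (restrict_scalars \<phi> (submod ?XX ?E)) (carrier (submod ?XX ?E))"
  proof -
    let ?Z = "direct_sum (restrict_scalars \<phi> X) (restrict_scalars \<phi> X')"
    have Z: "left_module k ?Z"
      by (rule left_module_direct_sum[OF left_module_restrict[OF X] left_module_restrict[OF X']])
    have "(\<lambda>z. z) \<in> mod_hom k (restrict_scalars \<phi> (submod ?XX ?E)) ?Z"
      by (rule mod_homI) auto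
    from finite_length_inj[OF left_module_restrict[OF Em] Z this]
    show ?thesis
      using finite_length_direct_sum[OF left_module_restrict[OF X] left_module_restrict[OF X']]
        finite_length_restrict[OF fgX] finite_length_restrict[OF fgX'] by simp
  qed
  let ?i = "\<lambda>x. (x, \<zero>\<^bsub>X'\<^esub>)"
  have i: "?i \<in> mod_hom \<Lambda> K (submod ?XX ?E)"
    by (rule mod_homI) (auto simp: Kc Kops mod_hom_zero[OF X' Y \<alpha>'])
  have snd: "snd \<in> mod_hom \<Lambda> (submod ?XX ?E) X'"
    by (rule mod_homI) auto
  \<comment> \<open>A lift of \<open>\<theta>\<close> to the pullback is a pair whose second
    component is \<open>\<theta>\<close>. The first one is the factorisation supplied for
    \<open>\<theta>\<close> extended by zero on \<open>P\<close>.\<close>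
  have lift: "\<exists>\<psi>\<in>mod_hom \<Lambda> ?T (submod ?XX ?E). \<forall>t\<in>carrier ?T. snd (\<psi> t) = \<theta> t"
    if \<theta>: "\<theta> \<in> mod_hom \<Lambda> ?T X'" for \<theta>
  proof -
    have "(\<lambda>c. \<theta> (fst c)) \<in> mod_hom \<Lambda> ?C X'"
      by (rule mod_homI) (use mod_homD[OF \<theta>] in auto)
    from bspec[OF det this] obtain \<eta> where \<eta>: "\<eta> \<in> mod_hom \<Lambda> ?C X" "\<And>c. c \<in> carrier ?C \<Longrightarrow> \<alpha>' (\<theta> (fst c)) = \<alpha> (\<eta> c)"
      by auto
    have "(\<lambda>t. (t, \<zero>\<^bsub>P\<^esub>)) \<in> mod_hom \<Lambda> ?T ?C" by (rule mod_homI) auto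
    from mod_homD[OF mod_hom_compose[OF this \<eta>(1)]]
    have "(\<lambda>t. (\<eta> (t, \<zero>\<^bsub>P\<^esub>), \<theta> t)) \<in> mod_hom \<Lambda> ?T (submod ?XX ?E)"
      by (intro mod_homI) (use mod_homD[OF \<theta>] \<eta>(2)[of "(_, \<zero>\<^bsub>P\<^esub>)"] in auto)
    then show ?thesis by (intro bexI[of _ "\<lambda>t. (\<eta> (t, \<zero>\<^bsub>P\<^esub>), \<theta> t)"]) auto
  qed
  have "?i ` carrier K = {z \<in> carrier (submod ?XX ?E). snd z = \<zero>\<^bsub>X'\<^esub>}"
    by (auto simp: Kc mod_hom_zero[OF X' Y \<alpha>'])
  from retraction_exists[OF Em X' fin_E i _ snd this lift]
  obtain r where r: "r \<in> mod_hom \<Lambda> (submod ?XX ?E) K" "\<And>x. x \<in> carrier K \<Longrightarrow> r (x, \<zero>\<^bsub>X'\<^esub>) = x"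
    by (auto simp: inj_on_def)
  note rd = mod_homD[OF r(1)]
  have rK: "r z \<in> carrier X" "\<alpha> (r z) = \<zero>\<^bsub>Y\<^esub>" if "z \<in> ?E" for z
    using rd(1)[of z] that by (auto simp: Kc)
  \<comment> \<open>Subtracting the retraction makes the first projection vanish on
    \<open>K\<close>, the kernel of \<open>snd\<close>. As \<open>im\<close> makes
    \<open>snd\<close> onto, the difference descends to a map from \<open>X'\<close> to
    \<open>X\<close>. Since \<open>\<alpha>\<close> kills the values of \<open>r\<close>, the
    subtraction does not change the composite with \<open>\<alpha>\<close>.\<close>
  let ?g = "\<lambda>z. fst z \<ominus>\<^bsub>X\<^esub> r z"
  have g: "?g \<in> mod_hom \<Lambda> (submod ?XX ?E) X"
  proof (rule mod_homI)
    fix z assume z: "z \<in> carrier (submod ?XX ?E)"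
    then show "?g z \<in> carrier X" using rK(1)[of z] by auto
    fix a assume a: "a \<in> carrier \<Lambda>"
    show "?g (a \<odot>\<^bsub>submod ?XX ?E\<^esub> z) = a \<odot>\<^bsub>X\<^esub> ?g z"
      using rd(3)[OF a z] rK(1)[of z] z a
      by (cases z) (simp add: Kops a_minus_def X.smult_r_distr X.smult_r_minus)
  next
    fix z w assume zw: "z \<in> carrier (submod ?XX ?E)" "w \<in> carrier (submod ?XX ?E)"
    then show "?g (z \<oplus>\<^bsub>submod ?XX ?E\<^esub> w) = ?g z \<oplus>\<^bsub>X\<^esub> ?g w"
      using rd(2)[OF zw] rK(1)[of z] rK(1)[of w]
      by (cases z; cases w) (simp add: Kops a_minus_def X.M.minus_add X.M.a_ac)
  qed
  have snd_surj: "snd ` carrier (submod ?XX ?E) = carrier X'"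
  proof (intro equalityI subsetI)
    fix x assume x: "x \<in> carrier X'"
    then obtain y where "y \<in> carrier X" "\<alpha>' x = \<alpha> y" using im by blast
    then show "x \<in> snd ` carrier (submod ?XX ?E)" using x by (intro image_eqI[of _ _ "(y, x)"]) auto
  qed auto
  have ker: "?g z = \<zero>\<^bsub>X\<^esub>" if z: "z \<in> carrier (submod ?XX ?E)" "snd z = \<zero>\<^bsub>X'\<^esub>" for z
  proof -
    obtain x where x: "z = (x, \<zero>\<^bsub>X'\<^esub>)" "x \<in> carrier K"
      using z by (cases z) (auto simp: Kc mod_hom_zero[OF X' Y \<alpha>'])
    then show ?thesis using r(2)[OF x(2)] by (simp add: a_minus_def Kc X.M.r_neg)
  qed
  from hom_factor_surj[OF Em X' X snd snd_surj g ker]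
  obtain \<beta> where \<beta>: "\<beta> \<in> mod_hom \<Lambda> X' X" "\<And>z. z \<in> carrier (submod ?XX ?E) \<Longrightarrow> \<beta> (snd z) = ?g z" by auto
  have "\<alpha>' x = \<alpha> (\<beta> x)" if x: "x \<in> carrier X'" for x
  proof -
    obtain y where y: "y \<in> carrier X" "\<alpha>' x = \<alpha> y" using im[OF x] by blast
    then have z: "(y, x) \<in> ?E" using x by simp
    have "\<alpha> (\<beta> x) = \<alpha> y \<ominus>\<^bsub>Y\<^esub> \<alpha> (r (y, x))"
      using \<beta>(2)[of "(y, x)"] z mod_hom_minus[OF X Y \<alpha> y(1) rK(1)[OF z]] by simp
    then show ?thesis using rK(2)[OF z] y(2) ad(1)[OF y(1)] by (simp add: a_minus_def)
  qed
  then show "\<exists>\<beta>\<in>mod_hom \<Lambda> X' X. \<forall>x\<in>carrier X'. \<alpha>' x = \<alpha> (\<beta> x)" using \<beta>(1) by blast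
qed

end
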